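(* Let $d\ge 1$ and let $G$ be a symmorphic magnetic space group in $\mathbb{R}^d$. Consider a simple band with $G$ symmetry whose projection operator is analytic throughout the Brillouin torus $T^d$. Then the simple band is a band representation of $G$ if and only if it is topologically trivial as a complex vector bundle of rank one over $T^d$. (The latter condition is known to be equivalent to the vanishing of the first Chern class of this line bundle.)
   Context: Groups. $BL\subset\mathbb{R}^d$ is a full-rank lattice (the Bravais lattice), $RL=\{K\in\mathbb{R}^d: K\cdot R\in 2\pi\mathbb{Z}\ \forall R\in BL\}$ is its reciprocal lattice, and $T^d=\mathbb{R}^d/RL$ is the Brillouin torus, with volume $|T^d|$. A point group $\mathcal P$ is a finite group of pairs $p=(\check p,s_p)\in O(d)\times\{\pm1\}$ with $\check p\,BL=BL$; $s_p=-1$ means that $p$ involves time reversal. The symmorphic magnetic space group $G$ is the set of all $(p|R)$, $p\in\mathcal P$, $R\in BL$, with multiplication $(q|R')(p|R)=(qp|\check qR+R')$ and $s_{qp}=s_qs_p$; it acts on space by $(p|R)\circ r=\check p r+R$. $E$ is the identity of $\mathcal P$. For a complex number $a$ put $\bar a^{\,1}=a$, $\bar a^{\,-1}=\bar a$ (complex conjugate). For $g=(p|R)$ the operator $\hat g$ acts on functions $f:\mathbb{R}^d\to\mathbb{C}$ by $(\hat g f)(r)=\overline{f(g^{-1}\circ r)}^{\,s_p}$. Simple bands. A Bloch function with wavevector $k\in\mathbb{R}^d$ is a locally square-integrable $\psi_k:\mathbb{R}^d\to\mathbb{C}$ with $\psi_k(r+R)=e^{ik\cdot R}\psi_k(r)$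 for all $R\in BL$. A simple band with $G$ symmetry assigns to each $k$ a one-dimensional space spanned by a Bloch function $\psi_k$ normalized over a unit cell (its phase is not fixed), such that the projection $P(k)=|\psi_k\rangle\langle\psi_k|$ satisfies $P(k+K)=P(k)$ for all $K\in RL$, and such that for every $g=(p|R)\in G$ and every $k$ there is $\rho_g(k)\in U(1)$ with $\hat g\psi_k=\rho_g(k)\psi_{s_p\check p k}$. The projection is analytic if $k\mapsto e^{-ik\cdot r}P(k)e^{ik\cdot r}$, as an operator-valued function on $L^2(\mathbb{R}^d/BL)$, is real-analytic on $\mathbb{R}^d$. A choice of $\psi_k$ is called continuous (analytic) if $k\mapsto e^{-ik\cdot r}\psi_k\in L^2(\mathbb{R}^d/BL)$ is continuous (real-analytic) on $\mathbb{R}^d$, and periodic if $\psi_{k+K}=\psi_k$ for all $K\in RL$. (Bands of tight-binding models built from exponentially localized orthonormal orbitals are included, since their Bloch vectors define such $\psi_k$.) Topological triviality. The simple band is topologically trivial if the normalized $\psi_k$ can be chosen continuous and periodic, i.e. if the complex line bundle over $T^d$ with fibre $\mathbb{C}\psi_k$ at $k$ is trivial. Band representations. For $\varpi\in\mathbb{R}^d$, the site stabilizer is $G_\varpi=\{g\in G: g\circ\varpi=\varpi\}$; $\varpi$ has unit multiplicity if $g\circ\varpi-\varpi\in BL$ for all $g\in G$. If $\psi_k$ is chosen analytic and periodic, the Wannier functions are the exponentially localized functions $w_R(r)=|T^d|^{-1/2}\int_{T^d}e^{-ik\cdot R}\psi_k(r)\,dk$, $R\in BL$. The simple band is a band representation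 of $G$ if there exist an analytic and periodic choice of $\psi_k$ and a point $\varpi\in\mathbb{R}^d$ of unit multiplicity such that for every $R\in BL$ the Wannier function $w_R$ forms a (one-dimensional) representation of the site stabilizer $G_{\varpi+R}$, i.e. for every $g\in G_{\varpi+R}$, $\hat g w_R$ is a unimodular scalar multiple of $w_R$. *)

theory Defs
  imports "HOL-Analysis.Analysis" "HOL-Algebra.Group"
begin

section \<open>Lattices\<close>

definition lattice_of :: "real^'n^'n \<Rightarrow> (real^'n) set" where
  "lattice_of A = {A *v x | x. \<forall>i. x $ i \<in> \<int>}"

definition full_rank_lattice :: "(real^'n) set \<Rightarrow> bool" where
  "full_rank_lattice L \<longleftrightarrow> (\<exists>A. invertible A \<and> L = lattice_of A)"

text \<open>The half-open parallelepiped over an arbitrarily chosen basis. Integrals over the unit cell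
  are only ever taken of functions that are periodic up to null sets, so they do not depend on that
  choice.\<close>

definition unit_cell :: "(real^'n) set \<Rightarrow> (real^'n) set" where
  "unit_cell L =
    (let A = (SOME A. invertible A \<and> L = lattice_of A)
     in {A *v x | x. \<forall>i. 0 \<le> x $ i \<and> x $ i < 1})"

definition reciprocal_lattice :: "(real^'n) set \<Rightarrow> (real^'n) set" where
  "reciprocal_lattice BL = {K. \<forall>R\<in>BL. \<exists>m::int. K \<bullet> R = 2 * pi * of_int m}"


section \<open>Symmorphic magnetic space groups\<close>

text \<open>A point group element is a pair of an orthogonal matrix and a sign; the sign \<open>-1\<close> means that
  time reversal is involved. Inverses in the group are given by transposed matrices.\<close>

type_synonym 'n point_op = "(real^'n^'n) \<times> int"
type_synonym 'n space_op = "'n point_op \<times> (real^'n)"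

definition point_group :: "(real^'n) set \<Rightarrow> 'n point_op set \<Rightarrow> bool" where
  "point_group BL P \<longleftrightarrow>
     finite P \<and>
     (\<forall>(p, s)\<in>P. orthogonal_matrix p \<and> s \<in> {1, -1} \<and> (\<lambda>R. p *v R) ` BL = BL) \<and>
     (mat 1, 1) \<in> P \<and>
     (\<forall>(q, t)\<in>P. \<forall>(p, s)\<in>P. (q ** p, t * s) \<in> P) \<and>
     (\<forall>(p, s)\<in>P. (transpose p, s) \<in> P)"

definition magnetic_space_group ::
    "(real^'n) set \<Rightarrow> 'n point_op set \<Rightarrow> 'n space_op monoid" where
  "magnetic_space_group BL P =
     \<lparr>carrier = P \<times> BL,
      mult = (\<lambda>((q, t), R') ((p, s), R). ((q ** p, t * s), q *v R + R')),
      one = ((mat 1, 1), 0)\<rparr>"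

fun sg_act :: "'n::finite space_op \<Rightarrow> real^'n \<Rightarrow> real^'n" where
  "sg_act ((p, s), R) r = p *v r + R"

fun sg_act_k :: "'n::finite space_op \<Rightarrow> real^'n \<Rightarrow> real^'n" where
  "sg_act_k ((p, s), R) k = of_int s *\<^sub>R (p *v k)"

definition tr_conj :: "int \<Rightarrow> complex \<Rightarrow> complex" where
  "tr_conj s a = (if s = -1 then cnj a else a)"

definition sg_op ::
    "'n::finite space_op monoid \<Rightarrow> 'n space_op \<Rightarrow> (real^'n \<Rightarrow> complex) \<Rightarrow> real^'n \<Rightarrow> complex" where
  "sg_op G g f r = tr_conj (snd (fst g)) (f (sg_act (inv\<^bsub>G\<^esub> g) r))"

definition site_stabilizer :: "'n::finite space_op monoid \<Rightarrow> real^'n \<Rightarrow> 'n space_op set" where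
  "site_stabilizer G w = {g \<in> carrier G. sg_act g w = w}"

definition unit_multiplicity ::
    "(real^'n) set \<Rightarrow> 'n::finite space_op monoid \<Rightarrow> real^'n \<Rightarrow> bool" where
  "unit_multiplicity BL G w \<longleftrightarrow> (\<forall>g\<in>carrier G. sg_act g w - w \<in> BL)"


section \<open>Square-integrable functions over a unit cell\<close>

text \<open>Elements of the various \<open>L\<^sup>2\<close> spaces are represented by Borel measurable functions, and all
  identities between them are understood almost everywhere.\<close>

definition plane_wave :: "real^'n \<Rightarrow> real^'n \<Rightarrow> complex" where
  "plane_wave k r = exp (\<i> * of_real (k \<bullet> r))"

definition locally_square_integrable :: "(real^'n \<Rightarrow> complex) \<Rightarrow> bool" where
  "locally_square_integrable f \<longleftrightarrow>
     f \<in> borel_measurable lborel \<and>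
     (\<forall>C. compact C \<longrightarrow> set_integrable lborel C (\<lambda>r. (cmod (f r))\<^sup>2))"

definition bloch_functions :: "(real^'n) set \<Rightarrow> real^'n \<Rightarrow> (real^'n \<Rightarrow> complex) set" where
  "bloch_functions BL k =
     {f. locally_square_integrable f \<and>
         (\<forall>R\<in>BL. AE r in lborel. f (r + R) = plane_wave k R * f r)}"

text \<open>The space \<open>L\<^sup>2(\<real>\<^sup>d/BL)\<close>, as functions on \<open>\<real>\<^sup>d\<close>.\<close>

definition L2_torus :: "(real^'n) set \<Rightarrow> (real^'n \<Rightarrow> complex) set" where
  "L2_torus BL =
     {u. locally_square_integrable u \<and> (\<forall>R\<in>BL. AE r in lborel. u (r + R) = u r)}"

definition cell_inner ::
    "(real^'n) set \<Rightarrow> (real^'n \<Rightarrow> complex) \<Rightarrow> (real^'n \<Rightarrow> complex) \<Rightarrow> complex" where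
  "cell_inner BL u v = (LINT r:unit_cell BL|lborel. cnj (u r) * v r)"

definition cell_norm :: "(real^'n) set \<Rightarrow> (real^'n \<Rightarrow> complex) \<Rightarrow> real" where
  "cell_norm BL u = sqrt (LINT r:unit_cell BL|lborel. (cmod (u r))\<^sup>2)"

definition L2_bounded_operator ::
    "(real^'n) set \<Rightarrow> ((real^'n \<Rightarrow> complex) \<Rightarrow> real^'n \<Rightarrow> complex) \<Rightarrow> bool" where
  "L2_bounded_operator BL A \<longleftrightarrow>
     (\<forall>u\<in>L2_torus BL. A u \<in> L2_torus BL) \<and>
     (\<forall>u\<in>L2_torus BL. \<forall>v\<in>L2_torus BL. \<forall>a b.
        AE r in lborel. A (\<lambda>x. a * u x + b * v x) r = a * A u r + b * A v r) \<and>
     (\<exists>C. \<forall>u\<in>L2_torus BL. cell_norm BL (A u) \<le> C * cell_norm BL u)"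


section \<open>Continuity and real-analyticity in the wavevector\<close>

definition L2_continuous :: "(real^'n) set \<Rightarrow> (real^'n \<Rightarrow> real^'n \<Rightarrow> complex) \<Rightarrow> bool" where
  "L2_continuous BL u \<longleftrightarrow>
     (\<forall>k0. ((\<lambda>k. cell_norm BL (\<lambda>r. u k r - u k0 r)) \<longlongrightarrow> 0) (at k0))"

definition monomial :: "real^'n \<Rightarrow> ('n \<Rightarrow> nat) \<Rightarrow> real" where
  "monomial x \<alpha> = (\<Prod>i\<in>UNIV. (x $ i) ^ \<alpha> i)"

text \<open>Real-analyticity: near every point the map is the sum of a power series whose coefficients
  lie in the Banach space at hand, i.e. \<open>L\<^sup>2(\<real>\<^sup>d/BL)\<close> in the first definition, and the bounded
  operators on it, with the operator norm, in the second. The sum over all multi-indices is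
  unconditional.\<close>

definition L2_analytic :: "(real^'n) set \<Rightarrow> (real^'n \<Rightarrow> real^'n \<Rightarrow> complex) \<Rightarrow> bool" where
  "L2_analytic BL u \<longleftrightarrow>
     (\<forall>k0. \<exists>\<epsilon>>0. \<exists>a :: ('n \<Rightarrow> nat) \<Rightarrow> real^'n \<Rightarrow> complex.
        (\<forall>\<alpha>. a \<alpha> \<in> L2_torus BL) \<and>
        (\<forall>k\<in>ball k0 \<epsilon>.
           ((\<lambda>F. cell_norm BL (\<lambda>r. u k r - (\<Sum>\<alpha>\<in>F. of_real (monomial (k - k0) \<alpha>) * a \<alpha> r)))
              \<longlongrightarrow> 0) (finite_subsets_at_top UNIV)))"

definition operator_analytic ::
    "(real^'n) set \<Rightarrow> (real^'n \<Rightarrow> (real^'n \<Rightarrow> complex) \<Rightarrow> real^'n \<Rightarrow> complex) \<Rightarrow> bool" where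
  "operator_analytic BL Q \<longleftrightarrow>
     (\<forall>k0. \<exists>\<epsilon>>0. \<exists>A :: ('n \<Rightarrow> nat) \<Rightarrow> (real^'n \<Rightarrow> complex) \<Rightarrow> real^'n \<Rightarrow> complex.
        (\<forall>\<alpha>. L2_bounded_operator BL (A \<alpha>)) \<and>
        (\<forall>k\<in>ball k0 \<epsilon>. \<forall>\<delta>>0. \<forall>\<^sub>F F in finite_subsets_at_top UNIV. \<forall>u\<in>L2_torus BL.
           cell_norm BL (\<lambda>r. Q k u r - (\<Sum>\<alpha>\<in>F. of_real (monomial (k - k0) \<alpha>) * A \<alpha> u r))
             \<le> \<delta> * cell_norm BL u))"


section \<open>Simple bands\<close>

definition rank_one_projection ::
    "(real^'n) set \<Rightarrow> (real^'n \<Rightarrow> complex) \<Rightarrow> (real^'n \<Rightarrow> complex) \<Rightarrow> real^'n \<Rightarrow> complex" where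
  "rank_one_projection BL \<phi> f r = cell_inner BL \<phi> f * \<phi> r"

definition simple_band ::
    "(real^'n) set \<Rightarrow> 'n::finite space_op monoid \<Rightarrow> (real^'n \<Rightarrow> real^'n \<Rightarrow> complex) \<Rightarrow> bool" where
  "simple_band BL G \<psi> \<longleftrightarrow>
     (\<forall>k. \<psi> k \<in> bloch_functions BL k \<and> cell_norm BL (\<psi> k) = 1) \<and>
     (\<forall>k. \<forall>K\<in>reciprocal_lattice BL. \<forall>f\<in>bloch_functions BL k.
        AE r in lborel.
          rank_one_projection BL (\<psi> (k + K)) f r = rank_one_projection BL (\<psi> k) f r) \<and>
     (\<forall>g\<in>carrier G. \<forall>k. \<exists>\<rho>. cmod \<rho> = 1 \<and>
        (AE r in lborel. sg_op G g (\<psi> k) r = \<rho> * \<psi> (sg_act_k g k) r))"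

definition analytic_projection ::
    "(real^'n) set \<Rightarrow> (real^'n \<Rightarrow> real^'n \<Rightarrow> complex) \<Rightarrow> bool" where
  "analytic_projection BL \<psi> \<longleftrightarrow>
     operator_analytic BL
       (\<lambda>k u r. plane_wave (-k) r * rank_one_projection BL (\<psi> k) (\<lambda>x. plane_wave k x * u x) r)"

text \<open>A choice of normalized Bloch functions spanning the band given by \<open>\<psi>\<close>.\<close>

definition band_choice ::
    "(real^'n) set \<Rightarrow> (real^'n \<Rightarrow> real^'n \<Rightarrow> complex) \<Rightarrow> (real^'n \<Rightarrow> real^'n \<Rightarrow> complex) \<Rightarrow> bool" where
  "band_choice BL \<psi> \<phi> \<longleftrightarrow>
     (\<forall>k. \<phi> k \<in> bloch_functions BL k \<and>
        (\<exists>c. cmod c = 1 \<and> (AE r in lborel. \<phi> k r = c * \<psi> k r)))"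

definition continuous_choice ::
    "(real^'n) set \<Rightarrow> (real^'n \<Rightarrow> real^'n \<Rightarrow> complex) \<Rightarrow> bool" where
  "continuous_choice BL \<phi> \<longleftrightarrow> L2_continuous BL (\<lambda>k r. plane_wave (-k) r * \<phi> k r)"

definition analytic_choice ::
    "(real^'n) set \<Rightarrow> (real^'n \<Rightarrow> real^'n \<Rightarrow> complex) \<Rightarrow> bool" where
  "analytic_choice BL \<phi> \<longleftrightarrow> L2_analytic BL (\<lambda>k r. plane_wave (-k) r * \<phi> k r)"

definition periodic_choice ::
    "(real^'n) set \<Rightarrow> (real^'n \<Rightarrow> real^'n \<Rightarrow> complex) \<Rightarrow> bool" where
  "periodic_choice BL \<phi> \<longleftrightarrow>
     (\<forall>k. \<forall>K\<in>reciprocal_lattice BL. AE r in lborel. \<phi> (k + K) r = \<phi> k r)"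

definition topologically_trivial ::
    "(real^'n) set \<Rightarrow> (real^'n \<Rightarrow> real^'n \<Rightarrow> complex) \<Rightarrow> bool" where
  "topologically_trivial BL \<psi> \<longleftrightarrow>
     (\<exists>\<phi>. band_choice BL \<psi> \<phi> \<and> continuous_choice BL \<phi> \<and> periodic_choice BL \<phi>)"


section \<open>Band representations\<close>

definition wannier ::
    "(real^'n) set \<Rightarrow> (real^'n \<Rightarrow> real^'n \<Rightarrow> complex) \<Rightarrow> real^'n \<Rightarrow> real^'n \<Rightarrow> complex" where
  "wannier BL \<phi> R r =
     (let T = unit_cell (reciprocal_lattice BL)
      in of_real (measure lborel T powr (-1/2)) * (LINT k:T|lborel. plane_wave (-k) R * \<phi> k r))"

text \<open>The members \<open>\<phi> k\<close> are only determined up to null sets in \<open>r\<close>, separately for each \<open>k\<close>. Joint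
  measurability of the representatives makes the integral over \<open>k\<close> in the Wannier functions exist for
  almost every \<open>r\<close>, with a result that is unique almost everywhere; it can always be arranged
  for a continuous choice.\<close>

definition band_representation ::
    "(real^'n) set \<Rightarrow> 'n::finite space_op monoid \<Rightarrow> (real^'n \<Rightarrow> real^'n \<Rightarrow> complex) \<Rightarrow> bool" where
  "band_representation BL G \<psi> \<longleftrightarrow>
     (\<exists>\<phi> w. band_choice BL \<psi> \<phi> \<and> analytic_choice BL \<phi> \<and> periodic_choice BL \<phi> \<and>
        (\<lambda>(k, r). \<phi> k r) \<in> borel_measurable (lborel \<Otimes>\<^sub>M lborel) \<and>
        unit_multiplicity BL G w \<and>
        (\<forall>R\<in>BL. \<forall>g\<in>site_stabilizer G (w + R). \<exists>c. cmod c = 1 \<and>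
           (AE r in lborel. sg_op G g (wannier BL \<phi> R) r = c * wannier BL \<phi> R r)))"


section \<open>Basic facts about lattices and groups\<close>

lemma lattice_of_zero: "0 \<in> lattice_of A"
  unfolding lattice_of_def by (intro CollectI exI[of _ 0]) simp

lemma lattice_of_add: "x \<in> lattice_of A \<Longrightarrow> y \<in> lattice_of A \<Longrightarrow> x + y \<in> lattice_of A"
  unfolding lattice_of_def
  by clarsimp (metis Ints_add matrix_vector_right_distrib vector_add_component)

lemma lattice_of_uminus: "x \<in> lattice_of A \<Longrightarrow> - x \<in> lattice_of A"
proof -
  assume "x \<in> lattice_of A"
  then obtain y where y: "x = A *v y" "\<forall>i. y $ i \<in> \<int>"
    unfolding lattice_of_def by auto
  have "- x = A *v (- y)"
    using y(1) matrix_vector_mult_diff_distrib[of A 0 y] by simp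
  then show ?thesis
    unfolding lattice_of_def using y(2) by (intro CollectI exI[of _ "- y"]) auto
qed

lemma point_groupD:
  fixes p :: "real^'n^'n"
  assumes "point_group BL P" "(p, s) \<in> P"
  shows "orthogonal_matrix p" "s * s = 1" "(transpose p, s) \<in> P" "R \<in> BL \<Longrightarrow> p *v R \<in> BL"
proof -
  have *: "orthogonal_matrix p \<and> s \<in> {1, -1} \<and> (\<lambda>R. p *v R) ` BL = BL"
    using assms unfolding point_group_def by fast
  show "orthogonal_matrix p" "s * s = 1" using * by auto
  show "R \<in> BL \<Longrightarrow> p *v R \<in> BL" using * by blast
  show "(transpose p, s) \<in> P" using assms unfolding point_group_def by fast
qed

lemma group_magnetic_space_group:
  fixes BL :: "(real^'n) set"
  assumes "full_rank_lattice BL" "point_group BL P"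
  shows "group (magnetic_space_group BL P)"
proof (rule groupI)
  obtain A where A: "BL = lattice_of A"
    using assms(1) unfolding full_rank_lattice_def by auto
  note [simp] = magnetic_space_group_def
  have img: "p *v R \<in> BL" if "(p, s) \<in> P" "R \<in> BL" for p s R
    using point_groupD(4)[OF assms(2)] that by blast
  have mul: "(q ** p, t * s) \<in> P" if "(q, t) \<in> P" "(p, s) \<in> P" for p q s t
    using assms(2) that unfolding point_group_def by fast
  show "x \<otimes>\<^bsub>magnetic_space_group BL P\<^esub> y \<in> carrier (magnetic_space_group BL P)"
    if "x \<in> carrier (magnetic_space_group BL P)" "y \<in> carrier (magnetic_space_group BL P)" for x y
    using that img mul lattice_of_add[of _ A] unfolding A by (auto split: prod.splits)
  show "\<one>\<^bsub>magnetic_space_group BL P\<^esub> \<in> carrier (magnetic_space_group BL P)"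
    using assms(2) A lattice_of_zero unfolding point_group_def by auto
  show "x \<otimes>\<^bsub>magnetic_space_group BL P\<^esub> y \<otimes>\<^bsub>magnetic_space_group BL P\<^esub> z =
        x \<otimes>\<^bsub>magnetic_space_group BL P\<^esub> (y \<otimes>\<^bsub>magnetic_space_group BL P\<^esub> z)" for x y z
    by (auto split: prod.splits
        simp: matrix_mul_assoc matrix_vector_mul_assoc matrix_vector_right_distrib add.assoc)
  show "\<one>\<^bsub>magnetic_space_group BL P\<^esub> \<otimes>\<^bsub>magnetic_space_group BL P\<^esub> x = x" for x
    by (auto split: prod.splits)
  show "\<exists>y\<in>carrier (magnetic_space_group BL P).
          y \<otimes>\<^bsub>magnetic_space_group BL P\<^esub> x = \<one>\<^bsub>magnetic_space_group BL P\<^esub>"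
    if x: "x \<in> carrier (magnetic_space_group BL P)" for x
  proof -
    obtain p s R where x_eq: "x = ((p, s), R)" by (metis prod.exhaust)
    have ps: "(p, s) \<in> P" and R: "R \<in> BL" using x x_eq by auto
    note o = point_groupD(1)[OF assms(2) ps] and s = point_groupD(2)[OF assms(2) ps]
      and i = point_groupD(3)[OF assms(2) ps]
    have "- (transpose p *v R) \<in> BL"
      using img[OF i R] lattice_of_uminus A by blast
    then show ?thesis
      using i s o[unfolded orthogonal_matrix_def]
      by (intro bexI[of _ "((transpose p, s), - (transpose p *v R))"]) (auto simp: x_eq)
  qed
qed

lemma inv_magnetic_space_group:
  fixes BL :: "(real^'n) set"
  assumes "full_rank_lattice BL" "point_group BL P" "((p, s), R) \<in> P \<times> BL"
  shows "sg_act (inv\<^bsub>magnetic_space_group BL P\<^esub> ((p, s), R)) r = transpose p *v (r - R)"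
proof -
  let ?G = "magnetic_space_group BL P"
  let ?y = "((transpose p, s), - (transpose p *v R))"
  interpret group ?G by (rule group_magnetic_space_group) fact+
  have ps: "(p, s) \<in> P" and R: "R \<in> BL" using assms(3) by auto
  note o = point_groupD(1)[OF assms(2) ps] and s = point_groupD(2)[OF assms(2) ps]
    and i = point_groupD(3)[OF assms(2) ps]
  obtain A where A: "BL = lattice_of A"
    using assms(1) unfolding full_rank_lattice_def by auto
  have "transpose p *v R \<in> BL"
    by (rule point_groupD(4)[OF assms(2) i R])
  then have "?y \<in> carrier ?G"
    using i lattice_of_uminus A by (auto simp: magnetic_space_group_def)
  moreover have "?y \<otimes>\<^bsub>?G\<^esub> ((p, s), R) = \<one>\<^bsub>?G\<^esub>"
    using s o[unfolded orthogonal_matrix_def] by (simp add: magnetic_space_group_def)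
  ultimately have "inv\<^bsub>?G\<^esub> ((p, s), R) = ?y"
    using assms(3) by (intro inv_equality) (auto simp: magnetic_space_group_def)
  then show ?thesis
    by (simp add: matrix_vector_mult_diff_distrib)
qed

lemma full_rank_reciprocal_lattice:
  fixes BL :: "(real^'n) set"
  assumes "full_rank_lattice BL"
  shows "full_rank_lattice (reciprocal_lattice BL)"
proof -
  obtain A where A: "invertible A" "BL = lattice_of A"
    using assms unfolding full_rank_lattice_def by auto
  then obtain A' where AI: "A ** A' = mat 1" "A' ** A = mat 1"
    unfolding invertible_def by auto
  define C where "C = transpose A'"
  define B where "B = (2 * pi) *\<^sub>R C"
  have TC: "transpose A ** C = mat 1" "C ** transpose A = mat 1"
    unfolding C_def using AI by (simp_all add: matrix_transpose_mul[symmetric])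
  have Bv: "B *v x = (2 * pi) *\<^sub>R (C *v x)" for x
    unfolding B_def by (simp add: scaleR_matrix_vector_assoc)
  have key: "K \<bullet> (A *v x) = (transpose A *v K) \<bullet> x" for K x
    by (simp add: dot_lmul_matrix[symmetric] transpose_matrix_vector)
  have "reciprocal_lattice BL = lattice_of B"
  proof (intro Set.set_eqI iffI)
    fix K assume K: "K \<in> reciprocal_lattice BL"
    define y where "y = (1 / (2 * pi)) *\<^sub>R (transpose A *v K)"
    have "y $ i \<in> \<int>" for i
    proof -
      have "A *v axis i 1 \<in> BL"
        unfolding A(2) lattice_of_def by (intro CollectI exI[of _ "axis i 1"]) (auto simp: axis_def)
      then obtain m :: int where "K \<bullet> (A *v axis i 1) = 2 * pi * of_int m"
        using K unfolding reciprocal_lattice_def by auto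
      then show ?thesis
        unfolding key y_def by (simp add: inner_axis)
    qed
    moreover have "K = B *v y"
      unfolding Bv y_def using TC(2)
      by (simp add: matrix_vector_mult_scaleR matrix_vector_mul_assoc del: transpose_matrix_vector)
    ultimately show "K \<in> lattice_of B"
      unfolding lattice_of_def by auto
  next
    fix K assume "K \<in> lattice_of B"
    then obtain y where y: "K = B *v y" "\<forall>i. y $ i \<in> \<int>"
      unfolding lattice_of_def by auto
    have "\<exists>m::int. K \<bullet> R = 2 * pi * of_int m" if R: "R \<in> BL" for R
    proof -
      obtain x where x: "R = A *v x" "\<forall>i. x $ i \<in> \<int>"
        using R unfolding A(2) lattice_of_def by auto
      have "transpose A *v K = (2 * pi) *\<^sub>R y"
        unfolding y Bv using TC(1) by (simp add: matrix_vector_mult_scaleR matrix_vector_mul_assoc del: transpose_matrix_vector)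
      then have "K \<bullet> R = 2 * pi * (\<Sum>i\<in>UNIV. y $ i * x $ i)"
        unfolding x key by (simp add: inner_vec_def sum_distrib_left mult.assoc)
      moreover have "(\<Sum>i\<in>UNIV. y $ i * x $ i) \<in> \<int>"
        using x y by (intro Ints_sum Ints_mult) auto
      ultimately show ?thesis by (metis Ints_cases)
    qed
    then show "K \<in> reciprocal_lattice BL"
      unfolding reciprocal_lattice_def by auto
  qed
  moreover have "invertible B"
    unfolding invertible_def
  proof (intro exI[of _ "(1 / (2 * pi)) *\<^sub>R transpose A"] conjI)
    show "B ** ((1 / (2 * pi)) *\<^sub>R transpose A) = mat 1"
      unfolding B_def using TC(2) by (simp add: matrix_scalar_ac scalar_matrix_assoc)
    show "((1 / (2 * pi)) *\<^sub>R transpose A) ** B = mat 1"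
      unfolding B_def using TC(1) by (simp add: matrix_scalar_ac scalar_matrix_assoc)
  qed
  ultimately show ?thesis
    unfolding full_rank_lattice_def by blast
qed

end

theory Submission
  imports Defs "HOL-Library.Function_Algebras"
begin

text \<open>A continuous periodic choice \<open>\<phi>\<close> turns the symmetry into continuous phases \<open>\<rho>\<^sub>p(k)\<close> that satisfy
  a cocycle condition. They lift to real functions \<open>h\<^sub>p\<close> on \<open>\<real>\<^sup>d\<close>, and averaging over the point group
  exhibits \<open>h\<^sub>p\<close> as a coboundary of some \<open>H\<close> up to a constant. The lattice increments of \<open>H\<close> are additive;
  they determine the Wannier centre \<open>w\<close>, and the periodic remainder of \<open>H\<close> is absorbed into the phase
  of \<open>\<phi>\<close>. Then \<open>g = (p | w - p w)\<close> acts on \<open>\<phi>\<close> with a phase that does not depend on \<open>k\<close>.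

  For analyticity, \<open>\<phi>\<close> is replaced by \<open>(s / |s|) \<phi>\<close>, where \<open>s(k)\<close> is a symmetrized sum of the overlaps
  \<open>\<langle>\<phi>\<^sub>k, \<phi>\<^sub>\<kappa>\<rangle>\<close> with finitely many \<open>\<kappa>\<close>, each weighted by a large power of a trigonometric bump
  centred at \<open>\<kappa>\<close>, so that \<open>Re s > 0\<close>. The bra in \<open>s(k)\<close> cancels the phase freedom of the ket, so the
  result is the normalization of an analytic, nowhere vanishing function. Wannier functions inherit
  the symmetry by a change of variables in the integral over the Brillouin torus.\<close>

section \<open>Power series in several real variables\<close>

text \<open>The hypotheses provide analyticity of the projection only; the starting choice
  \<open>\<phi>\<close> is merely continuous in k, and each of its phases is determined separately.
  The lifts \<open>h\<close> satisfy the cocycle condition only up to integer multiples of 2 pi. By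
  continuity these integers do not depend on k, which is the origin of the constant in the
  coboundary formula, and this constant becomes the k-independent phase of the final representation.
  Averaging divides by the group order, so the lattice increments of \<open>H\<close> need not be
  multiples of 2 pi, whereas those of each \<open>h\<close> are. Hence w need not be a lattice
  point, but p w - w is one, because BL is the dual of its own dual. The regularization has to
  preserve periodicity, symmetry and absence of zeros at the same time. Trigonometric bumps are
  periodic and analytic by construction. Symmetrizing adds up values and complex conjugates of
  values, which could cancel in general but cannot when all real parts are positive. The converse
  direction rests only on the fact that an analytic choice is continuous.\<close>

abbreviation multi_degree :: "('n::finite \<Rightarrow> nat) \<Rightarrow> nat" where
  "multi_degree \<alpha> \<equiv> sum \<alpha> UNIV"

text \<open>The limit \<open>s\<close> is given in advance because the target space is not assumed
  complete. Absolute summability makes all contributions outside some finite \<open>F0\<close>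
  small, so it suffices to find arbitrarily large finite sets whose sums come near
  \<open>s\<close>.\<close>

lemma has_sum_absI:
  fixes f :: "'i \<Rightarrow> 'a::real_normed_vector"
  assumes abs: "(\<lambda>i. norm (f i)) summable_on A"
    and approx: "\<And>e F0. e > 0 \<Longrightarrow> finite F0 \<Longrightarrow> F0 \<subseteq> A \<Longrightarrow>
      \<exists>F. finite F \<and> F0 \<subseteq> F \<and> F \<subseteq> A \<and> norm (sum f F - s) < e"
  shows "(f has_sum s) A"
  unfolding has_sum_def tendsto_iff eventually_finite_subsets_at_top
proof (intro allI impI)
  fix e :: real assume "e > 0"
  let ?n = "\<lambda>i. norm (f i)"
  have "(?n has_sum infsum ?n A) A" using abs by simp
  then have "\<forall>\<^sub>F F in finite_subsets_at_top A. dist (sum ?n F) (infsum ?n A) < e / 3"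
    unfolding has_sum_def tendsto_iff using \<open>e > 0\<close> by (meson zero_less_divide_iff zero_less_numeral)
  then obtain F0 where F0: "finite F0" "F0 \<subseteq> A"
    "\<And>F. finite F \<Longrightarrow> F0 \<subseteq> F \<Longrightarrow> F \<subseteq> A \<Longrightarrow> dist (sum ?n F) (infsum ?n A) < e / 3"
    unfolding eventually_finite_subsets_at_top by (elim exE conjE) simp
  have "dist (sum f F) s < e" if F: "finite F" "F0 \<subseteq> F" "F \<subseteq> A" for F
  proof -
    obtain F' where F': "finite F'" "F \<subseteq> F'" "F' \<subseteq> A" "norm (sum f F' - s) < e / 3"
      using approx[of "e/3" F] F(1,3) \<open>e > 0\<close> by (meson zero_less_divide_iff zero_less_numeral)
    have "norm (sum f F' - sum f F) = norm (sum f (F' - F))"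
      using F' F by (simp add: sum_diff)
    also have "\<dots> \<le> sum ?n (F' - F)" by (rule norm_sum)
    also have "\<dots> = sum ?n F' - sum ?n F" using F' F by (simp add: sum_diff)
    also have "\<dots> < 2 * e / 3"
    proof -
      have "dist (sum ?n F') (infsum ?n A) < e / 3"
        using F0(3)[of F'] F(2) F' by blast
      then show ?thesis using F0(3)[OF F] unfolding dist_real_def abs_less_iff by linarith
    qed
    finally have "norm (sum f F' - sum f F) < 2 * e / 3" .
    moreover have "dist (sum f F) s \<le> norm (sum f F' - sum f F) + norm (sum f F' - s)"
      by (metis dist_commute dist_norm dist_triangle2)
    ultimately show ?thesis using F'(4) by linarith
  qed
  then show "\<exists>X. finite X \<and> X \<subseteq> A \<and> (\<forall>Y. finite Y \<and> X \<subseteq> Y \<and> Y \<subseteq> A \<longrightarrow> dist (sum f Y) s < e)"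
    using F0(1,2) by (intro exI[of _ F0]) auto
qed

lemma summable_on_Times:
  fixes f :: "'i \<Rightarrow> real" and g :: "'j \<Rightarrow> real"
  assumes "f summable_on A" "g summable_on B" "\<And>i. f i \<ge> 0" "\<And>j. g j \<ge> 0"
  shows "(\<lambda>(i, j). f i * g j) summable_on A \<times> B"
proof (rule summable_on_SigmaI)
  show "((\<lambda>j. case (i, j) of (i, j) \<Rightarrow> f i * g j) has_sum f i * infsum g B) B" for i
    using has_sum_cmult_right[OF has_sum_infsum[OF assms(2)], of "f i"] by simp
  show "(\<lambda>i. f i * infsum g B) summable_on A"
    using assms by (intro summable_on_cmult_left)
qed (use assms in auto)

text \<open>Every finite set of multi-indices lies in a box, and over a box the sum of products
  factorizes. The product of the one-variable sums therefore bounds all partial sums.\<close>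

lemma summable_on_prod_UNIV:
  fixes g :: "'n::finite \<Rightarrow> nat \<Rightarrow> real"
  assumes g: "\<And>i. g i summable_on UNIV" and pos: "\<And>i n. g i n \<ge> 0"
  shows "(\<lambda>\<alpha>. \<Prod>i\<in>UNIV. g i (\<alpha> i)) summable_on UNIV"
proof (rule nonneg_bdd_above_summable_on)
  show "bdd_above (sum (\<lambda>\<alpha>. \<Prod>i\<in>UNIV. g i (\<alpha> i)) ` {F. F \<subseteq> UNIV \<and> finite F})"
  proof (rule bdd_aboveI2)
    fix F :: "('n \<Rightarrow> nat) set" assume "F \<in> {F. F \<subseteq> UNIV \<and> finite F}"
    then have F: "finite F" by simp
    define B where "B i = (\<lambda>\<alpha>. \<alpha> i) ` F" for i
    have sub: "F \<subseteq> PiE UNIV B" by (auto simp: B_def PiE_def)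
    have "(\<Sum>\<alpha>\<in>F. \<Prod>i\<in>UNIV. g i (\<alpha> i)) \<le> (\<Sum>\<alpha>\<in>PiE UNIV B. \<Prod>i\<in>UNIV. g i (\<alpha> i))"
      using sub F by (intro sum_mono2 prod_nonneg finite_PiE) (auto simp: B_def pos)
    also have "\<dots> = (\<Prod>i\<in>UNIV. \<Sum>n\<in>B i. g i n)"
      using F by (intro prod_sum_PiE[symmetric]) (auto simp: B_def)
    also have "\<dots> \<le> (\<Prod>i\<in>UNIV. infsum (g i) UNIV)"
      using F by (intro prod_mono conjI sum_nonneg pos finite_sum_le_infsum g) (auto simp: B_def pos)
    finally show "(\<Sum>\<alpha>\<in>F. \<Prod>i\<in>UNIV. g i (\<alpha> i)) \<le> (\<Prod>i\<in>UNIV. infsum (g i) UNIV)" .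
  qed
qed (use pos in \<open>auto intro: prod_nonneg\<close>)

lemma summable_on_multi_geometric:
  fixes q :: real
  assumes "0 \<le> q" "q < 1"
  shows "(\<lambda>\<alpha>::'n::finite \<Rightarrow> nat. q ^ multi_degree \<alpha>) summable_on UNIV"
proof -
  have "(\<lambda>n::nat. q ^ n) summable_on UNIV"
    using assms by (subst summable_on_UNIV_nonneg_real_iff) auto
  then have "(\<lambda>\<alpha>::'n \<Rightarrow> nat. \<Prod>i\<in>UNIV. q ^ \<alpha> i) summable_on UNIV"
    using assms by (intro summable_on_prod_UNIV) auto
  then show ?thesis by (simp add: power_sum)
qed

section \<open>Monomials and local power series\<close>

lemma monomial_add: "monomial x (\<alpha> + \<beta>) = monomial x \<alpha> * monomial x \<beta>"
  by (simp add: monomial_def power_add prod.distrib)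

lemma monomial_zero [simp]: "monomial x 0 = 1"
  by (simp add: monomial_def)

lemma abs_monomial_le:
  assumes "\<And>i. \<bar>x $ i\<bar> \<le> r"
  shows "\<bar>monomial x \<alpha>\<bar> \<le> r ^ multi_degree \<alpha>"
proof -
  have "\<bar>monomial x \<alpha>\<bar> = (\<Prod>i\<in>UNIV. \<bar>x $ i\<bar> ^ \<alpha> i)"
    by (simp add: monomial_def abs_prod power_abs)
  also have "\<dots> \<le> (\<Prod>i\<in>UNIV. r ^ \<alpha> i)"
    using assms by (intro prod_mono conjI power_mono) auto
  finally show ?thesis by (simp add: power_sum)
qed

lemma monomial_origin: "monomial (0::real^'n) \<alpha> = (if \<alpha> = 0 then 1 else 0)"
proof (cases "\<alpha> = 0")
  case False
  then obtain i where "\<alpha> i \<noteq> 0" unfolding fun_eq_iff by auto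
  then have "\<exists>i\<in>UNIV. (0::real^'n) $ i ^ \<alpha> i = 0" by auto
  then show ?thesis using False by (simp add: monomial_def)
qed simp

text \<open>A closed cube instead of a ball: on it a monomial is at most
  \<open>r ^ multi_degree \<alpha>\<close>, so the weighted sum of coefficient norms dominates the
  series at every point. The same weighted sum is the norm in which products and compositions are
  estimated.\<close>

definition has_power_series ::
    "(real^'n \<Rightarrow> 'a::real_normed_vector) \<Rightarrow> real^'n \<Rightarrow> real \<Rightarrow> (('n \<Rightarrow> nat) \<Rightarrow> 'a) \<Rightarrow> bool" where
  "has_power_series f k0 r a \<longleftrightarrow>
     0 < r \<and> (\<lambda>\<alpha>. norm (a \<alpha>) * r ^ multi_degree \<alpha>) summable_on UNIV \<and>
     (\<forall>k. (\<forall>i. \<bar>(k - k0) $ i\<bar> \<le> r) \<longrightarrow>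
        ((\<lambda>\<alpha>. monomial (k - k0) \<alpha> *\<^sub>R a \<alpha>) has_sum f k) UNIV)"

definition real_analytic_at :: "(real^'n \<Rightarrow> 'a::real_normed_vector) \<Rightarrow> real^'n \<Rightarrow> bool" where
  "real_analytic_at f k0 \<longleftrightarrow> (\<exists>r a. has_power_series f k0 r a)"

lemma has_power_seriesD:
  assumes "has_power_series f k0 r a"
  shows "0 < r" "(\<lambda>\<alpha>. norm (a \<alpha>) * r ^ multi_degree \<alpha>) summable_on UNIV"
    "(\<And>i. \<bar>(k - k0) $ i\<bar> \<le> r) \<Longrightarrow> ((\<lambda>\<alpha>. monomial (k - k0) \<alpha> *\<^sub>R a \<alpha>) has_sum f k) UNIV"
  using assms unfolding has_power_series_def by blast+

lemma has_power_series_mono: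
  assumes "has_power_series f k0 r a" "0 < r'" "r' \<le> r"
  shows "has_power_series f k0 r' a"
  unfolding has_power_series_def
proof (intro conjI allI impI)
  show "(\<lambda>\<alpha>. norm (a \<alpha>) * r' ^ multi_degree \<alpha>) summable_on UNIV"
    using assms by (intro summable_on_comparison_test[OF has_power_seriesD(2)[OF assms(1)]])
      (auto intro!: mult_left_mono power_mono)
  show "((\<lambda>\<alpha>. monomial (k - k0) \<alpha> *\<^sub>R a \<alpha>) has_sum f k) UNIV"
    if "\<forall>i. \<bar>(k - k0) $ i\<bar> \<le> r'" for k
    using assms(3) that by (intro has_power_seriesD(3)[OF assms(1)]) (meson order_trans)
qed fact

lemma has_power_series_center:
  fixes f :: "real^'n \<Rightarrow> 'a::real_normed_vector"
  assumes "has_power_series f k0 r a"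
  shows "f k0 = a 0"
proof -
  have "((\<lambda>\<alpha>. monomial (k0 - k0) \<alpha> *\<^sub>R a \<alpha>) has_sum f k0) UNIV"
    using has_power_seriesD(1)[OF assms] by (intro has_power_seriesD(3)[OF assms]) auto
  then have "((\<lambda>\<alpha>::'n \<Rightarrow> nat. if \<alpha> = 0 then a 0 else 0) has_sum f k0) UNIV"
    by (simp add: monomial_origin if_distrib if_distribR cong: if_cong)
  moreover have "((\<lambda>\<alpha>::'n \<Rightarrow> nat. if \<alpha> = 0 then a 0 else 0) has_sum a 0) UNIV"
    by (rule has_sum_finite_neutralI[of "{0}"]) auto
  ultimately show ?thesis by (rule has_sum_unique)
qed

text \<open>A term outside \<open>F0\<close> is the difference of two partial sums that both lie
  within 1 of the limit.\<close>

lemma has_sum_imp_bounded_terms: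
  fixes f :: "'i \<Rightarrow> 'a::real_normed_vector"
  assumes "(f has_sum s) A"
  shows "\<exists>M. \<forall>i\<in>A. norm (f i) \<le> M"
proof -
  have "\<forall>\<^sub>F F in finite_subsets_at_top A. dist (sum f F) s < 1"
    using assms unfolding has_sum_def tendsto_iff by simp
  then obtain F0 where F0: "finite F0" "F0 \<subseteq> A"
    "\<And>F. finite F \<Longrightarrow> F0 \<subseteq> F \<Longrightarrow> F \<subseteq> A \<Longrightarrow> dist (sum f F) s < 1"
    unfolding eventually_finite_subsets_at_top by (elim exE conjE) simp
  have "norm (f i) \<le> 2 + (\<Sum>j\<in>F0. norm (f j))" if "i \<in> A" for i
  proof (cases "i \<in> F0")
    case True
    then have "norm (f i) \<le> (\<Sum>j\<in>F0. norm (f j))" using F0(1) by (intro member_le_sum) auto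
    then show ?thesis by simp
  next
    case False
    have "norm (f i) = dist (sum f (insert i F0)) (sum f F0)"
      using False F0(1) by (simp add: dist_norm)
    also have "\<dots> \<le> dist (sum f (insert i F0)) s + dist (sum f F0) s" by (rule dist_triangle2)
    also have "\<dots> \<le> 2"
    proof -
      have "dist (sum f (insert i F0)) s < 1" using F0(1,2) that by (intro F0(3)) auto
      then show ?thesis using F0(3)[OF F0(1) order_refl F0(2)] by linarith
    qed
    also have "\<dots> \<le> 2 + (\<Sum>j\<in>F0. norm (f j))" by (simp add: sum_nonneg)
    finally show ?thesis .
  qed
  then show ?thesis by blast
qed

text \<open>Convergence at one point of the diagonal bounds the coefficients geometrically, hence
  unconditional convergence on a ball gives absolute convergence on a smaller cube.\<close>

lemma real_analytic_atI:
  fixes f :: "real^'n \<Rightarrow> 'a::real_normed_vector"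
  assumes "e > 0"
    and sum: "\<And>k. k \<in> ball k0 e \<Longrightarrow> ((\<lambda>\<alpha>. monomial (k - k0) \<alpha> *\<^sub>R a \<alpha>) has_sum f k) UNIV"
  shows "\<exists>r. has_power_series f k0 r a"
proof -
  define d where "d = real CARD('n)"
  have d: "d \<ge> 1" unfolding d_def by (simp add: Suc_leI)
  \<comment> \<open>The norm is at most the sum of the absolute coordinates, so a cube of half-side
    \<open>t\<close> stays within distance \<open>e / 2\<close> of its centre.\<close>
  define t where "t = e / (2 * d)"
  have t: "t > 0" using assms d by (simp add: t_def)
  have in_ball: "k \<in> ball k0 e" if "\<And>i. \<bar>(k - k0) $ i\<bar> \<le> t" for k
  proof -
    have "norm (k - k0) \<le> (\<Sum>i\<in>UNIV. \<bar>(k - k0) $ i\<bar>)" by (rule norm_le_l1_cart)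
    also have "\<dots> \<le> (\<Sum>i\<in>(UNIV::'n set). t)" by (intro sum_mono that)
    also have "\<dots> < e" using assms d by (simp add: t_def d_def field_simps)
    finally show ?thesis by (simp add: dist_norm norm_minus_commute)
  qed
  \<comment> \<open>At this corner every monomial equals \<open>t ^ multi_degree \<alpha>\<close>,
    so bounded terms there bound all coefficients. Halving the side then gains a factor
    \<open>1 / 2\<close> per degree.\<close>
  define k1 where "k1 = k0 + (\<chi> i. t)"
  have "((\<lambda>\<alpha>. monomial (k1 - k0) \<alpha> *\<^sub>R a \<alpha>) has_sum f k1) UNIV"
    using t by (intro sum in_ball) (simp add: k1_def)
  moreover have "monomial (k1 - k0) \<alpha> = t ^ multi_degree \<alpha>" for \<alpha>
    by (simp add: monomial_def k1_def power_sum)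
  ultimately obtain M where M: "\<And>\<alpha>. t ^ multi_degree \<alpha> * norm (a \<alpha>) \<le> M"
    using has_sum_imp_bounded_terms t by fastforce
  have "has_power_series f k0 (t / 2) a"
    unfolding has_power_series_def
  proof (intro conjI allI impI)
    show "(\<lambda>\<alpha>. norm (a \<alpha>) * (t / 2) ^ multi_degree \<alpha>) summable_on UNIV"
    proof (rule summable_on_comparison_test)
      show "(\<lambda>\<alpha>::'n \<Rightarrow> nat. M * (1 / 2) ^ multi_degree \<alpha>) summable_on UNIV"
        by (intro summable_on_cmult_right summable_on_multi_geometric) auto
      show "norm (a \<alpha>) * (t / 2) ^ multi_degree \<alpha> \<le> M * (1 / 2) ^ multi_degree \<alpha>" for \<alpha>
        using M[of \<alpha>] by (simp add: power_divide divide_right_mono mult.commute)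
    qed (use t in auto)
    show "((\<lambda>\<alpha>. monomial (k - k0) \<alpha> *\<^sub>R a \<alpha>) has_sum f k) UNIV"
      if "\<forall>i. \<bar>(k - k0) $ i\<bar> \<le> t / 2" for k
    proof (intro sum in_ball)
      show "\<bar>(k - k0) $ i\<bar> \<le> t" for i
        using that[rule_format, of i] t by linarith
    qed
  qed (use t in auto)
  then show ?thesis by blast
qed

lemma real_analytic_at_ball:
  assumes "real_analytic_at f k0"
  shows "\<exists>e>0. \<exists>a. \<forall>k\<in>ball k0 e. ((\<lambda>\<alpha>. monomial (k - k0) \<alpha> *\<^sub>R a \<alpha>) has_sum f k) UNIV"
proof -
  obtain r a where ra: "has_power_series f k0 r a"
    using assms unfolding real_analytic_at_def by blast
  have "((\<lambda>\<alpha>. monomial (k - k0) \<alpha> *\<^sub>R a \<alpha>) has_sum f k) UNIV" if "k \<in> ball k0 r" for k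
  proof (rule has_power_seriesD(3)[OF ra])
    show "\<bar>(k - k0) $ i\<bar> \<le> r" for i
      using component_le_norm_cart[of "k - k0" i] that
      by (simp add: dist_norm norm_minus_commute)
  qed
  then show ?thesis using has_power_seriesD(1)[OF ra] by blast
qed

lemma real_analytic_at_cong:
  assumes "real_analytic_at f k0" and ev: "\<forall>\<^sub>F k in nhds k0. f k = g k"
  shows "real_analytic_at g k0"
proof -
  obtain e a where e: "e > 0"
    "\<And>k. k \<in> ball k0 e \<Longrightarrow> ((\<lambda>\<alpha>. monomial (k - k0) \<alpha> *\<^sub>R a \<alpha>) has_sum f k) UNIV"
    using real_analytic_at_ball[OF assms(1)] by blast
  obtain e' where e': "e' > 0" "\<And>k. dist k k0 < e' \<Longrightarrow> f k = g k"
    using ev unfolding eventually_nhds_metric by blast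
  have "((\<lambda>\<alpha>. monomial (k - k0) \<alpha> *\<^sub>R a \<alpha>) has_sum g k) UNIV" if "k \<in> ball k0 (min e e')" for k
    using e(2)[of k] e'(2)[of k] that by (simp add: dist_commute)
  then show ?thesis
    using real_analytic_atI[of "min e e'" k0 a g] e(1) e'(1) unfolding real_analytic_at_def by auto
qed

text \<open>Apart from the constant term every multi-index has degree at least 1, so shrinking the
  cube by \<open>s\<close> gains a factor \<open>s\<close> in each term. Continuity at the centre
  follows.\<close>

lemma has_power_series_norm_diff_le:
  fixes f :: "real^'n \<Rightarrow> 'a::real_normed_vector"
  assumes ps: "has_power_series f k0 r a" and k: "\<And>i. \<bar>(k - k0) $ i\<bar> \<le> r * s" and s: "0 \<le> s" "s \<le> 1"
  shows "norm (f k - f k0) \<le> s * (\<Sum>\<^sub>\<infinity>\<alpha>. norm (a \<alpha>) * r ^ multi_degree \<alpha>)"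
proof -
  note r = has_power_seriesD(1)[OF ps] and abs = has_power_seriesD(2)[OF ps]
  let ?t = "\<lambda>\<alpha>. monomial (k - k0) \<alpha> *\<^sub>R a \<alpha>"
  let ?b = "\<lambda>\<alpha>. norm (a \<alpha>) * r ^ multi_degree \<alpha>"
  have k': "\<bar>(k - k0) $ i\<bar> \<le> r" for i
    using k[of i] mult_left_le[of s r] s r by linarith
  have "(?t has_sum f k) UNIV" using k' by (rule has_power_seriesD(3)[OF ps])
  moreover have "((\<lambda>\<alpha>::'n \<Rightarrow> nat. if \<alpha> = 0 then a 0 else 0) has_sum f k0) UNIV"
    by (rule has_sum_finite_neutralI[of "{0}"]) (auto simp: has_power_series_center[OF ps])
  ultimately have diff: "((\<lambda>\<alpha>. ?t \<alpha> + - (if \<alpha> = 0 then a 0 else 0)) has_sum f k + - f k0) UNIV"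
    by (intro has_sum_add) (auto simp: has_sum_uminus)
  have le: "norm (?t \<alpha> + - (if \<alpha> = 0 then a 0 else 0)) \<le> s * ?b \<alpha>" for \<alpha>
  proof (cases "\<alpha> = 0")
    case False
    then obtain i where "\<alpha> i \<noteq> 0" by (auto simp: fun_eq_iff)
    then have deg: "multi_degree \<alpha> \<ge> 1" using member_le_sum[of i UNIV \<alpha>] by simp
    have "\<bar>monomial (k - k0) \<alpha>\<bar> \<le> (r * s) ^ multi_degree \<alpha>" by (rule abs_monomial_le[OF k])
    also have "\<dots> \<le> r ^ multi_degree \<alpha> * s"
      unfolding power_mult_distrib using r s power_decreasing[OF deg s] by (intro mult_left_mono) auto
    finally have "\<bar>monomial (k - k0) \<alpha>\<bar> * norm (a \<alpha>) \<le> r ^ multi_degree \<alpha> * s * norm (a \<alpha>)"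
      by (intro mult_right_mono) auto
    then show ?thesis using False by (simp add: ac_simps)
  qed (use s in simp)
  have sb: "(\<lambda>\<alpha>. s * ?b \<alpha>) summable_on UNIV" by (intro summable_on_cmult_right abs)
  have "norm (f k + - f k0) \<le> (\<Sum>\<^sub>\<infinity>\<alpha>. norm (?t \<alpha> + - (if \<alpha> = 0 then a 0 else 0)))"
    by (rule norm_has_sum_bound[OF has_sum_infsum diff]) (rule summable_on_comparison_test[OF sb le], auto)
  also have "\<dots> \<le> (\<Sum>\<^sub>\<infinity>\<alpha>. s * ?b \<alpha>)"
    by (rule infsum_mono[OF summable_on_comparison_test[OF sb le] sb le]) auto
  also have "\<dots> = s * infsum ?b UNIV" by (rule infsum_cmult_right) (simp add: abs)
  finally show ?thesis by simp
qed

lemma real_analytic_at_isCont: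
  fixes f :: "real^'n \<Rightarrow> 'a::real_normed_vector"
  assumes "real_analytic_at f k0"
  shows "isCont f k0"
proof -
  obtain r a where ps: "has_power_series f k0 r a"
    using assms unfolding real_analytic_at_def by blast
  note r = has_power_seriesD(1)[OF ps]
  define S where "S = (\<Sum>\<^sub>\<infinity>\<alpha>. norm (a \<alpha>) * r ^ multi_degree \<alpha>)"
  have bound: "norm (f k - f k0) \<le> norm (k - k0) / r * S" if "norm (k - k0) \<le> r" for k
    unfolding S_def
  proof (rule has_power_series_norm_diff_le[OF ps])
    show "\<bar>(k - k0) $ i\<bar> \<le> r * (norm (k - k0) / r)" for i
      using component_le_norm_cart[of "k - k0" i] r by simp
  qed (use that r in auto)
  have "((\<lambda>k. f k - f k0) \<longlongrightarrow> 0) (at k0)"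
  proof (rule Lim_null_comparison)
    show "\<forall>\<^sub>F k in at k0. norm (f k - f k0) \<le> norm (k - k0) / r * S"
      unfolding eventually_at using r bound by (intro exI[of _ r]) (auto simp: dist_norm)
    show "((\<lambda>k. norm (k - k0) / r * S) \<longlongrightarrow> 0) (at k0)"
      by (intro tendsto_eq_intros) (use r in auto)
  qed
  then show ?thesis unfolding isCont_def by (simp add: LIM_zero_iff)
qed

lemma has_power_series_bounded_linear:
  assumes h: "bounded_linear h" and ps: "has_power_series f k0 r a"
  shows "has_power_series (\<lambda>k. h (f k)) k0 r (\<lambda>\<alpha>. h (a \<alpha>))"
  unfolding has_power_series_def
proof (intro conjI allI impI)
  interpret h: bounded_linear h by fact
  obtain K where K: "\<And>x. norm (h x) \<le> norm x * K" using h.bounded by blast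
  note r = has_power_seriesD(1)[OF ps]
  show "0 < r" by fact
  show "(\<lambda>\<alpha>. norm (h (a \<alpha>)) * r ^ multi_degree \<alpha>) summable_on UNIV"
  proof (rule summable_on_comparison_test)
    show "(\<lambda>\<alpha>. norm (a \<alpha>) * r ^ multi_degree \<alpha> * K) summable_on UNIV"
      by (intro summable_on_cmult_left has_power_seriesD(2)[OF ps])
    show "norm (h (a \<alpha>)) * r ^ multi_degree \<alpha> \<le> norm (a \<alpha>) * r ^ multi_degree \<alpha> * K" for \<alpha>
      using mult_right_mono[OF K[of "a \<alpha>"], of "r ^ multi_degree \<alpha>"] r by (simp add: ac_simps)
  qed (use r in auto)
  show "((\<lambda>\<alpha>. monomial (k - k0) \<alpha> *\<^sub>R h (a \<alpha>)) has_sum h (f k)) UNIV"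
    if "\<forall>i. \<bar>(k - k0) $ i\<bar> \<le> r" for k
    using has_sum_bounded_linear[OF h has_power_seriesD(3)[OF ps], of k] that
    by (simp add: o_def h.scaleR)
qed

lemma real_analytic_at_bounded_linear:
  "bounded_linear h \<Longrightarrow> real_analytic_at f k0 \<Longrightarrow> real_analytic_at (\<lambda>k. h (f k)) k0"
  unfolding real_analytic_at_def using has_power_series_bounded_linear by blast

lemma real_analytic_at_const [intro]: "real_analytic_at (\<lambda>k. c) (k0 :: real^'n)"
proof -
  have "((\<lambda>\<alpha>. monomial (k - k0) \<alpha> *\<^sub>R (if \<alpha> = 0 then c else 0)) has_sum c) UNIV" for k
    by (rule has_sum_finite_neutralI[of "{0}"]) (auto split: if_splits)
  then show ?thesis using real_analytic_atI[of 1 k0 _ "\<lambda>k. c"] unfolding real_analytic_at_def by (meson zero_less_one)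
qed

lemma real_analytic_at_add:
  assumes "real_analytic_at f k0" "real_analytic_at g k0"
  shows "real_analytic_at (\<lambda>k. f k + g k) k0"
proof -
  obtain e a where e: "e > 0"
    "\<And>k. k \<in> ball k0 e \<Longrightarrow> ((\<lambda>\<alpha>. monomial (k - k0) \<alpha> *\<^sub>R a \<alpha>) has_sum f k) UNIV"
    using real_analytic_at_ball[OF assms(1)] by blast
  obtain e' b where e': "e' > 0"
    "\<And>k. k \<in> ball k0 e' \<Longrightarrow> ((\<lambda>\<alpha>. monomial (k - k0) \<alpha> *\<^sub>R b \<alpha>) has_sum g k) UNIV"
    using real_analytic_at_ball[OF assms(2)] by blast
  have "((\<lambda>\<alpha>. monomial (k - k0) \<alpha> *\<^sub>R (a \<alpha> + b \<alpha>)) has_sum (f k + g k)) UNIV"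
    if "k \<in> ball k0 (min e e')" for k
    unfolding scaleR_add_right using that by (intro has_sum_add e(2) e'(2)) auto
  then have "\<exists>r. has_power_series (\<lambda>k. f k + g k) k0 r (\<lambda>\<alpha>. a \<alpha> + b \<alpha>)"
    using e(1) e'(1) by (intro real_analytic_atI[of "min e e'"]) auto
  then show ?thesis unfolding real_analytic_at_def by blast
qed

lemma real_analytic_at_sum:
  assumes "\<And>j. j \<in> J \<Longrightarrow> real_analytic_at (f j) k0"
  shows "real_analytic_at (\<lambda>k. \<Sum>j\<in>J. f j k) k0"
proof (cases "finite J")
  case True
  then show ?thesis using assms
    by (induction J rule: finite_induct) (auto intro: real_analytic_at_add)
qed auto

subsection \<open>Cauchy products\<close>

text \<open>The multiplication \<open>m\<close> is a parameter so that products of numbers, real and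
  complex inner products, and scaling of vectors are covered by one argument.\<close>

definition cauchy_coeff ::
    "('a \<Rightarrow> 'b \<Rightarrow> 'c::comm_monoid_add) \<Rightarrow> (('n::finite \<Rightarrow> nat) \<Rightarrow> 'a) \<Rightarrow> (('n \<Rightarrow> nat) \<Rightarrow> 'b) \<Rightarrow> ('n \<Rightarrow> nat) \<Rightarrow> 'c" where
  "cauchy_coeff m a b \<gamma> = (\<Sum>\<alpha> | \<alpha> \<le> \<gamma>. m (a \<alpha>) (b (\<gamma> - \<alpha>)))"

lemma finite_multi_index_le: "finite {\<alpha>::'n::finite \<Rightarrow> nat. \<alpha> \<le> \<gamma>}"
proof (rule finite_subset)
  show "{\<alpha>. \<alpha> \<le> \<gamma>} \<subseteq> PiE UNIV (\<lambda>i. {..\<gamma> i})" by (auto simp: le_fun_def)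
qed (intro finite_PiE; simp)

lemma bij_betw_multi_index_split:
  "bij_betw (\<lambda>(\<gamma>, \<alpha>). (\<alpha>, \<gamma> - \<alpha>)) (Sigma UNIV (\<lambda>\<gamma>. {\<alpha>. \<alpha> \<le> \<gamma>})) (UNIV \<times> (UNIV :: ('n \<Rightarrow> nat) set))"
  by (rule bij_betwI[where g = "\<lambda>(\<alpha>, \<beta>). (\<alpha> + \<beta>, \<alpha>)"]) (auto simp: le_fun_def fun_eq_iff)

text \<open>An unconditional double sum may be grouped by the total multi-index; the groups are
  finite, and monomials multiply along them.\<close>

lemma has_sum_cauchy_coeff:
  fixes m :: "'a \<Rightarrow> 'b \<Rightarrow> 'c::real_normed_vector" and x :: "real^'n"
  assumes "((\<lambda>(\<alpha>, \<beta>). monomial x \<alpha> *\<^sub>R monomial x \<beta> *\<^sub>R m (a \<alpha>) (b \<beta>)) has_sum s) (UNIV \<times> UNIV)"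
  shows "((\<lambda>\<gamma>. monomial x \<gamma> *\<^sub>R cauchy_coeff m a b \<gamma>) has_sum s) UNIV"
proof (rule has_sum_SigmaD[where B = "\<lambda>\<gamma>. {\<alpha>. \<alpha> \<le> \<gamma>}"])
  have "((\<lambda>p. case (case p of (\<gamma>, \<alpha>) \<Rightarrow> (\<alpha>, \<gamma> - \<alpha>)) of
      (\<alpha>, \<beta>) \<Rightarrow> monomial x \<alpha> *\<^sub>R monomial x \<beta> *\<^sub>R m (a \<alpha>) (b \<beta>)) has_sum s) (Sigma UNIV (\<lambda>\<gamma>. {\<alpha>. \<alpha> \<le> \<gamma>}))"
    by (subst has_sum_reindex_bij_betw[OF bij_betw_multi_index_split]) fact
  also have "?this \<longleftrightarrow> ((\<lambda>(\<gamma>, \<alpha>). monomial x \<gamma> *\<^sub>R m (a \<alpha>) (b (\<gamma> - \<alpha>))) has_sum s) (Sigma UNIV (\<lambda>\<gamma>. {\<alpha>. \<alpha> \<le> \<gamma>}))"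
  proof (rule has_sum_cong)
    fix p :: "('n \<Rightarrow> nat) \<times> ('n \<Rightarrow> nat)" assume p: "p \<in> Sigma UNIV (\<lambda>\<gamma>. {\<alpha>. \<alpha> \<le> \<gamma>})"
    obtain \<gamma> \<alpha> where p_eq: "p = (\<gamma>, \<alpha>)" by (cases p)
    have "\<gamma> = \<alpha> + (\<gamma> - \<alpha>)" using p by (auto simp: p_eq le_fun_def fun_eq_iff)
    then have "monomial x \<gamma> = monomial x \<alpha> * monomial x (\<gamma> - \<alpha>)" by (metis monomial_add)
    then show "(case (case p of (\<gamma>, \<alpha>) \<Rightarrow> (\<alpha>, \<gamma> - \<alpha>)) of
      (\<alpha>, \<beta>) \<Rightarrow> monomial x \<alpha> *\<^sub>R monomial x \<beta> *\<^sub>R m (a \<alpha>) (b \<beta>)) =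
      (case p of (\<gamma>, \<alpha>) \<Rightarrow> monomial x \<gamma> *\<^sub>R m (a \<alpha>) (b (\<gamma> - \<alpha>)))"
      by (simp add: p_eq)
  qed
  finally show "((\<lambda>(\<gamma>, \<alpha>). monomial x \<gamma> *\<^sub>R m (a \<alpha>) (b (\<gamma> - \<alpha>))) has_sum s) (Sigma UNIV (\<lambda>\<gamma>. {\<alpha>. \<alpha> \<le> \<gamma>}))" .
  show "((\<lambda>\<alpha>. case (\<gamma>, \<alpha>) of (\<gamma>, \<alpha>) \<Rightarrow> monomial x \<gamma> *\<^sub>R m (a \<alpha>) (b (\<gamma> - \<alpha>))) has_sum
      monomial x \<gamma> *\<^sub>R cauchy_coeff m a b \<gamma>) {\<alpha>. \<alpha> \<le> \<gamma>}" for \<gamma>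
    by (simp add: cauchy_coeff_def scaleR_sum_right has_sum_finiteI finite_multi_index_le)
qed

text \<open>Over a rectangle the sum is \<open>m\<close> applied to two partial sums, and these
  values tend to \<open>m s t\<close>. Every finite set of pairs lies in a rectangle, so
  \<open>has_sum_absI\<close> applies.\<close>

lemma has_sum_bounded_bilinear_Times:
  fixes f :: "'i \<Rightarrow> 'a::real_normed_vector" and g :: "'j \<Rightarrow> 'b::real_normed_vector"
  assumes "bounded_bilinear m"
    and f: "(\<lambda>i. norm (f i)) summable_on UNIV" "(f has_sum s) UNIV"
    and g: "(\<lambda>j. norm (g j)) summable_on UNIV" "(g has_sum t) UNIV"
  shows "((\<lambda>(i, j). m (f i) (g j)) has_sum m s t) (UNIV \<times> UNIV)"
proof (rule has_sum_absI)
  interpret m: bounded_bilinear m by fact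
  obtain K where K: "\<And>x y. norm (m x y) \<le> norm x * norm y * K" using m.bounded by blast
  show "(\<lambda>p. norm (case p of (i, j) \<Rightarrow> m (f i) (g j))) summable_on UNIV \<times> UNIV"
  proof (rule summable_on_comparison_test)
    show "(\<lambda>p. (case p of (i, j) \<Rightarrow> norm (f i) * norm (g j)) * K) summable_on UNIV \<times> UNIV"
      by (intro summable_on_cmult_left summable_on_Times f g) auto
  qed (use K in auto)
  fix e :: real and F0 :: "('i \<times> 'j) set"
  assume e: "e > 0" and F0: "finite F0"
  let ?U = "finite_subsets_at_top (UNIV :: 'i set)" and ?V = "finite_subsets_at_top (UNIV :: 'j set)"
  have "((\<lambda>p. m (sum f (fst p)) (sum g (snd p))) \<longlongrightarrow> m s t) (?U \<times>\<^sub>F ?V)"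
    using f(2) g(2) unfolding has_sum_def
    by (intro m.tendsto filterlim_compose[OF _ filterlim_fst] filterlim_compose[OF _ filterlim_snd])
  then have "\<forall>\<^sub>F p in ?U \<times>\<^sub>F ?V. dist (m (sum f (fst p)) (sum g (snd p))) (m s t) < e"
    using e by (rule tendstoD)
  moreover have "\<forall>\<^sub>F p in ?U \<times>\<^sub>F ?V. (finite (fst p) \<and> fst ` F0 \<subseteq> fst p) \<and> (finite (snd p) \<and> snd ` F0 \<subseteq> snd p)"
    using F0 unfolding eventually_prod_filter eventually_finite_subsets_at_top
    by (intro exI[of _ "\<lambda>X. finite X \<and> fst ` F0 \<subseteq> X"] exI[of _ "\<lambda>X. finite X \<and> snd ` F0 \<subseteq> X"]) auto
  ultimately have "\<forall>\<^sub>F p in ?U \<times>\<^sub>F ?V. dist (m (sum f (fst p)) (sum g (snd p))) (m s t) < e \<and>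
      (finite (fst p) \<and> fst ` F0 \<subseteq> fst p) \<and> (finite (snd p) \<and> snd ` F0 \<subseteq> snd p)"
    by (rule eventually_conj)
  moreover have "?U \<times>\<^sub>F ?V \<noteq> bot" by (simp add: prod_filter_eq_bot)
  ultimately obtain p where p: "dist (m (sum f (fst p)) (sum g (snd p))) (m s t) < e"
      "finite (fst p)" "fst ` F0 \<subseteq> fst p" "finite (snd p)" "snd ` F0 \<subseteq> snd p"
    using eventually_happens by (metis (no_types, lifting))
  have "sum (\<lambda>(i, j). m (f i) (g j)) (fst p \<times> snd p) = m (sum f (fst p)) (sum g (snd p))"
    by (simp only: m.sum_left m.sum_right sum.cartesian_product[symmetric]) (rule sum.swap)
  moreover have "F0 \<subseteq> fst p \<times> snd p" using p by force
  ultimately show "\<exists>F. finite F \<and> F0 \<subseteq> F \<and> F \<subseteq> UNIV \<times> UNIV \<and> norm (sum (\<lambda>(i, j). m (f i) (g j)) F - m s t) < e"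
    using p by (intro exI[of _ "fst p \<times> snd p"]) (auto simp: dist_norm)
qed

lemma has_power_series_abs_summable:
  assumes "has_power_series f k0 r a" "\<And>i. \<bar>x $ i\<bar> \<le> r"
  shows "(\<lambda>\<alpha>. norm (monomial x \<alpha> *\<^sub>R a \<alpha>)) summable_on UNIV"
proof (rule summable_on_comparison_test[OF has_power_seriesD(2)[OF assms(1)]])
  show "norm (monomial x \<alpha> *\<^sub>R a \<alpha>) \<le> norm (a \<alpha>) * r ^ multi_degree \<alpha>" for \<alpha>
    using mult_right_mono[OF abs_monomial_le[of x r \<alpha>, OF assms(2)], of "norm (a \<alpha>)"] by (simp add: mult.commute)
qed auto

text \<open>The norms of the coefficients are themselves multiplied as real power series, with the
  product \<open>x * y * K\<close>, at the corner point \<open>x\<close> whose coordinates are all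
  \<open>r\<close>. There the monomials coincide with the weights
  \<open>r ^ multi_degree \<alpha>\<close>.\<close>

lemma cauchy_coeff_summable:
  fixes a :: "('n::finite \<Rightarrow> nat) \<Rightarrow> 'a::real_normed_vector" and b :: "('n \<Rightarrow> nat) \<Rightarrow> 'b::real_normed_vector"
    and m :: "'a \<Rightarrow> 'b \<Rightarrow> 'c::real_normed_vector"
  assumes K: "\<And>x y. norm (m x y) \<le> norm x * norm y * K" and r: "0 < r"
    and a: "(\<lambda>\<alpha>. norm (a \<alpha>) * r ^ multi_degree \<alpha>) summable_on UNIV"
    and b: "(\<lambda>\<alpha>. norm (b \<alpha>) * r ^ multi_degree \<alpha>) summable_on UNIV"
  shows "(\<lambda>\<alpha>. norm (cauchy_coeff m a b \<alpha>) * r ^ multi_degree \<alpha>) summable_on UNIV" (is ?A)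
    and "(\<Sum>\<^sub>\<infinity>\<alpha>. norm (cauchy_coeff m a b \<alpha>) * r ^ multi_degree \<alpha>) \<le>
      (\<Sum>\<^sub>\<infinity>\<alpha>. norm (a \<alpha>) * r ^ multi_degree \<alpha>) * (\<Sum>\<^sub>\<infinity>\<alpha>. norm (b \<alpha>) * r ^ multi_degree \<alpha>) * K" (is ?B)
proof -
  let ?a = "\<lambda>\<alpha>. norm (a \<alpha>)" and ?b = "\<lambda>\<alpha>. norm (b \<alpha>)" and ?m = "\<lambda>x y. x * y * K"
  define x :: "real^'n" where "x = (\<chi> i. r)"
  have mon: "monomial x \<alpha> = r ^ multi_degree \<alpha>" for \<alpha>
    by (simp add: monomial_def x_def power_sum)
  have as: "((\<lambda>\<alpha>. monomial x \<alpha> * ?a \<alpha>) has_sum (\<Sum>\<^sub>\<infinity>\<alpha>. norm (a \<alpha>) * r ^ multi_degree \<alpha>)) UNIV"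
    and bs: "((\<lambda>\<alpha>. monomial x \<alpha> * ?b \<alpha>) has_sum (\<Sum>\<^sub>\<infinity>\<alpha>. norm (b \<alpha>) * r ^ multi_degree \<alpha>)) UNIV"
    using a b by (simp_all add: mon mult.commute)
  have bil: "bounded_bilinear ?m"
    by (rule bounded_bilinear.intro) (auto simp: algebra_simps intro!: exI[of _ "\<bar>K\<bar>"] simp: abs_mult)
  have "((\<lambda>(\<alpha>, \<beta>). ?m (monomial x \<alpha> * ?a \<alpha>) (monomial x \<beta> * ?b \<beta>)) has_sum
      ?m (\<Sum>\<^sub>\<infinity>\<alpha>. norm (a \<alpha>) * r ^ multi_degree \<alpha>) (\<Sum>\<^sub>\<infinity>\<alpha>. norm (b \<alpha>) * r ^ multi_degree \<alpha>)) (UNIV \<times> UNIV)"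
    using as bs r has_sum_imp_summable[OF as] has_sum_imp_summable[OF bs]
    by (intro has_sum_bounded_bilinear_Times[OF bil]) (simp_all add: mon abs_mult)
  then have c: "((\<lambda>\<gamma>. monomial x \<gamma> *\<^sub>R cauchy_coeff ?m ?a ?b \<gamma>) has_sum
      ?m (\<Sum>\<^sub>\<infinity>\<alpha>. norm (a \<alpha>) * r ^ multi_degree \<alpha>) (\<Sum>\<^sub>\<infinity>\<alpha>. norm (b \<alpha>) * r ^ multi_degree \<alpha>)) UNIV"
    by (intro has_sum_cauchy_coeff) (simp add: ac_simps)
  have le: "norm (cauchy_coeff m a b \<gamma>) * r ^ multi_degree \<gamma> \<le> monomial x \<gamma> *\<^sub>R cauchy_coeff ?m ?a ?b \<gamma>" for \<gamma>
  proof -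
    have "norm (cauchy_coeff m a b \<gamma>) \<le> cauchy_coeff ?m ?a ?b \<gamma>"
      unfolding cauchy_coeff_def by (intro sum_norm_le K)
    then show ?thesis using r by (simp add: mon mult.commute mult_left_mono)
  qed
  show ?A
    by (rule summable_on_comparison_test[OF has_sum_imp_summable[OF c] le]) (use r in auto)
  then show ?B using infsum_mono[OF _ has_sum_imp_summable[OF c] le] infsumI[OF c] by simp
qed

lemma has_power_series_bounded_bilinear:
  assumes bil: "bounded_bilinear m"
    and f: "has_power_series f k0 r a" and g: "has_power_series g k0 r b"
  shows "has_power_series (\<lambda>k. m (f k) (g k)) k0 r (cauchy_coeff m a b)"
  unfolding has_power_series_def
proof (intro conjI allI impI)
  interpret m: bounded_bilinear m by fact
  obtain K where K: "\<And>x y. norm (m x y) \<le> norm x * norm y * K" using m.bounded by blast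
  show r: "0 < r" by (rule has_power_seriesD(1)[OF f])
  show "(\<lambda>\<alpha>. norm (cauchy_coeff m a b \<alpha>) * r ^ multi_degree \<alpha>) summable_on UNIV"
    by (rule cauchy_coeff_summable[OF K r has_power_seriesD(2)[OF f] has_power_seriesD(2)[OF g]])
  fix k assume k: "\<forall>i. \<bar>(k - k0) $ i\<bar> \<le> r"
  then have "((\<lambda>(\<alpha>, \<beta>). m (monomial (k - k0) \<alpha> *\<^sub>R a \<alpha>) (monomial (k - k0) \<beta> *\<^sub>R b \<beta>)) has_sum m (f k) (g k)) (UNIV \<times> UNIV)"
    using has_power_series_abs_summable[OF f] has_power_series_abs_summable[OF g]
      has_power_seriesD(3)[OF f] has_power_seriesD(3)[OF g]
    by (intro has_sum_bounded_bilinear_Times bil) auto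
  then show "((\<lambda>\<gamma>. monomial (k - k0) \<gamma> *\<^sub>R cauchy_coeff m a b \<gamma>) has_sum m (f k) (g k)) UNIV"
    by (intro has_sum_cauchy_coeff) (simp add: m.scaleR_left m.scaleR_right mult.commute)
qed

lemma real_analytic_at_bounded_bilinear:
  assumes bil: "bounded_bilinear m" and "real_analytic_at f k0" "real_analytic_at g k0"
  shows "real_analytic_at (\<lambda>k. m (f k) (g k)) k0"
proof -
  obtain r a where f: "has_power_series f k0 r a" using assms(2) unfolding real_analytic_at_def by blast
  obtain s b where g: "has_power_series g k0 s b" using assms(3) unfolding real_analytic_at_def by blast
  have "0 < min r s" using has_power_seriesD(1)[OF f] has_power_seriesD(1)[OF g] by simp
  then have "has_power_series (\<lambda>k. m (f k) (g k)) k0 (min r s) (cauchy_coeff m a b)"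
    using f g by (intro has_power_series_bounded_bilinear[OF bil]) (auto intro: has_power_series_mono)
  then show ?thesis unfolding real_analytic_at_def by blast
qed

lemma real_analytic_at_power:
  fixes f :: "real^'n \<Rightarrow> real"
  assumes "real_analytic_at f k0"
  shows "real_analytic_at (\<lambda>k. f k ^ N) k0"
proof (induction N)
  case (Suc N)
  then show ?case
    using real_analytic_at_bounded_bilinear[OF bounded_bilinear_mult assms] by simp
qed auto

subsection \<open>Inverse square roots\<close>

primrec power_coeff :: "(('n::finite \<Rightarrow> nat) \<Rightarrow> real) \<Rightarrow> nat \<Rightarrow> ('n \<Rightarrow> nat) \<Rightarrow> real" where
  "power_coeff a 0 = (\<lambda>\<alpha>. if \<alpha> = 0 then 1 else 0)"
| "power_coeff a (Suc n) = cauchy_coeff (*) (power_coeff a n) a"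

text \<open>The weighted coefficient sum is submultiplicative, so the n-th power of a series has at
  most the n-th power of its weighted sum. This makes substitution into another power series
  possible on a fixed cube.\<close>

lemma power_coeff:
  fixes t :: "real^'n \<Rightarrow> real"
  assumes ps: "has_power_series t k0 r a"
  shows "has_power_series (\<lambda>k. t k ^ n) k0 r (power_coeff a n)"
    and "(\<Sum>\<^sub>\<infinity>\<alpha>. norm (power_coeff a n \<alpha>) * r ^ multi_degree \<alpha>) \<le> (\<Sum>\<^sub>\<infinity>\<alpha>. norm (a \<alpha>) * r ^ multi_degree \<alpha>) ^ n"
proof (induction n)
  case 0
  let ?\<delta> = "\<lambda>\<alpha>::'n \<Rightarrow> nat. norm (if \<alpha> = 0 then 1 else 0 :: real) * r ^ multi_degree \<alpha>"
  have s: "(?\<delta> has_sum 1) UNIV"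
    by (rule has_sum_finite_neutralI[of "{0}"]) (auto split: if_splits)
  {
    case 1
    have "((\<lambda>\<alpha>. monomial (k - k0) \<alpha> *\<^sub>R (if \<alpha> = 0 then 1 else 0 :: real)) has_sum 1) UNIV" for k
      by (rule has_sum_finite_neutralI[of "{0}"]) (auto split: if_splits)
    then show ?case
      using has_power_seriesD(1)[OF ps] has_sum_imp_summable[OF s] by (simp add: has_power_series_def)
  next
    case 2
    show ?case using infsumI[OF s] by simp
  }
next
  case (Suc n)
  note r = has_power_seriesD(1)[OF ps]
  {
    case 1
    show ?case
      using has_power_series_bounded_bilinear[OF bounded_bilinear_mult Suc.IH(1) ps] by (simp add: mult.commute)
  next
    case 2
    have "(\<Sum>\<^sub>\<infinity>\<alpha>. norm (power_coeff a (Suc n) \<alpha>) * r ^ multi_degree \<alpha>) \<le>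
       (\<Sum>\<^sub>\<infinity>\<alpha>. norm (power_coeff a n \<alpha>) * r ^ multi_degree \<alpha>) * (\<Sum>\<^sub>\<infinity>\<alpha>. norm (a \<alpha>) * r ^ multi_degree \<alpha>) * 1"
      unfolding power_coeff.simps
      by (rule cauchy_coeff_summable(2)[OF _ r has_power_seriesD(2)[OF Suc.IH(1)] has_power_seriesD(2)[OF ps]])
        (simp add: abs_mult)
    also have "\<dots> \<le> (\<Sum>\<^sub>\<infinity>\<alpha>. norm (a \<alpha>) * r ^ multi_degree \<alpha>) ^ n * (\<Sum>\<^sub>\<infinity>\<alpha>. norm (a \<alpha>) * r ^ multi_degree \<alpha>)"
      using r Suc.IH(2) by (auto intro!: mult_right_mono infsum_nonneg)
    finally show ?case by (simp add: mult.commute)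
  }
qed

text \<open>Without constant term every coefficient has a weight of degree at least 1, so shrinking
  the cube by \<open>c\<close> shrinks the weighted sum at least by \<open>c\<close>.\<close>

lemma has_power_series_small:
  assumes ps: "has_power_series t k0 r a" and a0: "a 0 = 0" and "0 < e"
  shows "\<exists>r'>0. has_power_series t k0 r' a \<and> (\<Sum>\<^sub>\<infinity>\<alpha>. norm (a \<alpha>) * r' ^ multi_degree \<alpha>) < e"
proof -
  note r = has_power_seriesD(1)[OF ps] and abs = has_power_seriesD(2)[OF ps]
  define S where "S = (\<Sum>\<^sub>\<infinity>\<alpha>. norm (a \<alpha>) * r ^ multi_degree \<alpha>)"
  have S: "S \<ge> 0" unfolding S_def using r by (intro infsum_nonneg) auto
  \<comment> \<open>The bound 1 keeps the new cube inside the old one; the other bound gives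
    \<open>c * S < e\<close>, with \<open>S + 1\<close> avoiding a division by zero.\<close>
  define c where "c = min 1 (e / (2 * (S + 1)))"
  have c: "0 < c" "c \<le> 1" using S \<open>0 < e\<close> by (auto simp: c_def)
  have ps': "has_power_series t k0 (c * r) a"
    using ps r c by (intro has_power_series_mono[OF ps]) (auto simp: mult_left_le_one_le)
  have le: "norm (a \<alpha>) * (c * r) ^ multi_degree \<alpha> \<le> c * (norm (a \<alpha>) * r ^ multi_degree \<alpha>)" for \<alpha>
  proof (cases "\<alpha> = 0")
    case False
    then obtain i where "\<alpha> i \<noteq> 0" by (auto simp: fun_eq_iff)
    then have deg: "multi_degree \<alpha> \<ge> 1" using member_le_sum[of i UNIV \<alpha>] by simp
    then have "c ^ multi_degree \<alpha> \<le> c" using c power_decreasing[of 1 "multi_degree \<alpha>" c] by simp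
    then have "c ^ multi_degree \<alpha> * (norm (a \<alpha>) * r ^ multi_degree \<alpha>) \<le> c * (norm (a \<alpha>) * r ^ multi_degree \<alpha>)"
      using r by (intro mult_right_mono) auto
    then show ?thesis by (simp add: power_mult_distrib ac_simps)
  qed (use c a0 in simp)
  have "(\<Sum>\<^sub>\<infinity>\<alpha>. norm (a \<alpha>) * (c * r) ^ multi_degree \<alpha>) \<le> (\<Sum>\<^sub>\<infinity>\<alpha>. c * (norm (a \<alpha>) * r ^ multi_degree \<alpha>))"
    by (rule infsum_mono[OF has_power_seriesD(2)[OF ps'] summable_on_cmult_right[OF abs] le])
  also have "\<dots> = c * S" unfolding S_def by (rule infsum_cmult_right) (simp add: abs)
  also have "\<dots> \<le> e / (2 * (S + 1)) * S" using S by (intro mult_right_mono) (auto simp: c_def)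
  also have "\<dots> < e" using S \<open>0 < e\<close> by (simp add: field_simps add_nonneg_pos)
  finally show ?thesis using ps' c r by (intro exI[of _ "c * r"]) auto
qed

text \<open>Write \<open>f\<close> as \<open>f k0\<close> times \<open>1 + t\<close> with
  \<open>t\<close> vanishing at \<open>k0\<close> and substitute the series of \<open>t\<close> into
  the binomial series for the exponent -1/2. On a small cube the weighted sum of \<open>t\<close> is
  below 1/2, within the radius of convergence 1, so the double series converges absolutely and can
  be reordered by monomials.\<close>

lemma real_analytic_at_inverse_sqrt:
  fixes f :: "real^'n \<Rightarrow> real"
  assumes f: "real_analytic_at f k0" and pos: "f k0 > 0"
  shows "real_analytic_at (\<lambda>k. f k powr (-1/2)) k0"
proof -
  define t where "t = (\<lambda>k. f k / f k0 + (- 1))"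
  have "bounded_linear (\<lambda>x::real. x / f k0)" by (rule bounded_linear_divide)
  then have "real_analytic_at (\<lambda>k. f k / f k0 + (- 1)) k0"
    by (intro real_analytic_at_add real_analytic_at_bounded_linear[OF _ f] real_analytic_at_const)
  then obtain r0 a where ps0: "has_power_series t k0 r0 a"
    unfolding real_analytic_at_def t_def[symmetric] by blast
  have "a 0 = 0" using has_power_series_center[OF ps0] pos by (simp add: t_def)
  then obtain r where r: "r > 0" and ps: "has_power_series t k0 r a"
    and q: "(\<Sum>\<^sub>\<infinity>\<alpha>. norm (a \<alpha>) * r ^ multi_degree \<alpha>) < 1/2" (is "?q < _")
    using has_power_series_small[OF ps0, of "1/2"] by auto
  have q0: "?q \<ge> 0" using r by (intro infsum_nonneg) auto
  define b :: "nat \<Rightarrow> real" where "b n = ((-1/2) gchoose n)" for n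
  let ?T = "\<lambda>n \<alpha>. norm (power_coeff a n \<alpha>) * r ^ multi_degree \<alpha>"
  let ?B = "\<lambda>(n, \<alpha>). \<bar>b n\<bar> * ?T n \<alpha>"
  \<comment> \<open>For a natural exponent the binomial series is a polynomial with infinite radius;
    the radius is 1 only in the other case.\<close>
  have "(-1/2 :: real) \<notin> \<nat>"
  proof
    assume "(-1/2 :: real) \<in> \<nat>"
    then obtain n where "(-1/2 :: real) = real n" by (elim Nats_cases)
    then show False using of_nat_0_le_iff[of n, where 'a = real] by linarith
  qed
  then have "conv_radius b = 1" unfolding b_def conv_radius_gchoose by simp
  then have "summable (\<lambda>n. norm (b n * ?q ^ n))"
    using q q0 by (intro abs_summable_in_conv_radius) auto
  then have sb: "(\<lambda>n. \<bar>b n\<bar> * ?q ^ n) summable_on UNIV"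
    using q0 by (subst summable_on_UNIV_nonneg_real_iff) (auto simp: abs_mult)
  have Tn: "?T n summable_on UNIV" for n by (rule has_power_seriesD(2)[OF power_coeff(1)[OF ps]])
  have sB: "?B summable_on UNIV \<times> UNIV"
  proof (rule summable_on_SigmaI)
    show "((\<lambda>\<alpha>. ?B (n, \<alpha>)) has_sum \<bar>b n\<bar> * infsum (?T n) UNIV) UNIV" for n
      using has_sum_cmult_right[OF has_sum_infsum[OF Tn]] by simp
    show "(\<lambda>n. \<bar>b n\<bar> * infsum (?T n) UNIV) summable_on UNIV"
    proof (rule summable_on_comparison_test[OF sb])
      show "\<bar>b n\<bar> * infsum (?T n) UNIV \<le> \<bar>b n\<bar> * ?q ^ n" for n
        by (intro mult_left_mono power_coeff(2)[OF ps]) simp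
      show "0 \<le> \<bar>b n\<bar> * infsum (?T n) UNIV" for n
        using r by (intro mult_nonneg_nonneg infsum_nonneg) auto
    qed
  qed (use r in auto)
  define c where "c \<alpha> = (\<Sum>\<^sub>\<infinity>n. b n * power_coeff a n \<alpha>)" for \<alpha>
  have sum: "((\<lambda>\<alpha>. monomial (k - k0) \<alpha> * c \<alpha>) has_sum (1 + t k) powr (-1/2)) UNIV"
    if k: "\<And>i. \<bar>(k - k0) $ i\<bar> \<le> r" for k
  proof -
    let ?x = "k - k0"
    let ?f = "\<lambda>(n, \<alpha>). b n * (monomial ?x \<alpha> * power_coeff a n \<alpha>)"
    have fB: "norm (?f p) \<le> ?B p" for p
    proof -
      obtain n \<alpha> where p: "p = (n, \<alpha>)" by (cases p)
      have "\<bar>monomial ?x \<alpha>\<bar> * \<bar>power_coeff a n \<alpha>\<bar> \<le> r ^ multi_degree \<alpha> * \<bar>power_coeff a n \<alpha>\<bar>"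
        using k by (intro mult_right_mono abs_monomial_le) auto
      then show ?thesis by (simp add: p abs_mult mult_left_mono mult.commute)
    qed
    then have "(\<lambda>p. norm (?f p)) summable_on UNIV \<times> UNIV"
      by (intro summable_on_comparison_test[OF sB]) auto
    then have sf: "?f summable_on UNIV \<times> UNIV" by (rule abs_summable_summable)
    have inner: "((\<lambda>\<alpha>. ?f (n, \<alpha>)) has_sum b n * t k ^ n) UNIV" for n
      using has_sum_cmult_right[OF has_power_seriesD(3)[OF power_coeff(1)[OF ps] k], of "b n" n] by simp
    have "norm (t k) \<le> ?q"
    proof (rule order_trans)
      show "norm (t k) \<le> (\<Sum>\<^sub>\<infinity>\<alpha>. norm (monomial ?x \<alpha> *\<^sub>R a \<alpha>))"
        by (rule norm_has_sum_bound[OF has_sum_infsum[OF has_power_series_abs_summable[OF ps k]] has_power_seriesD(3)[OF ps k]])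
      show "(\<Sum>\<^sub>\<infinity>\<alpha>. norm (monomial ?x \<alpha> *\<^sub>R a \<alpha>)) \<le> ?q"
      proof (rule infsum_mono[OF has_power_series_abs_summable[OF ps k] has_power_seriesD(2)[OF ps]])
        show "norm (monomial ?x \<alpha> *\<^sub>R a \<alpha>) \<le> norm (a \<alpha>) * r ^ multi_degree \<alpha>" for \<alpha>
          using mult_right_mono[OF abs_monomial_le[of ?x r \<alpha>, OF k], of "norm (a \<alpha>)"]
          by (simp add: abs_mult mult.commute)
      qed
    qed
    then have tq: "\<bar>t k\<bar> \<le> ?q" by simp
    have "(\<lambda>n. b n * t k ^ n) sums (1 + t k) powr (-1/2)"
      unfolding b_def using tq q by (intro gen_binomial_real) linarith
    moreover have "summable (\<lambda>n. norm (b n * t k ^ n))"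
    proof (rule summable_comparison_test)
      show "summable (\<lambda>n. \<bar>b n\<bar> * ?q ^ n)" using summable_on_imp_summable[OF sb] .
      show "\<exists>N. \<forall>n\<ge>N. norm (norm (b n * t k ^ n)) \<le> \<bar>b n\<bar> * ?q ^ n"
        using tq by (auto simp: abs_mult power_abs intro!: mult_left_mono power_mono)
    qed
    ultimately have outer: "((\<lambda>n. b n * t k ^ n) has_sum (1 + t k) powr (-1/2)) UNIV"
      by (intro norm_summable_imp_has_sum)
    have "(?f has_sum (1 + t k) powr (-1/2)) (UNIV \<times> UNIV)"
      by (rule has_sum_SigmaI[OF inner outer sf])
    then have sw: "((\<lambda>(\<alpha>, n). ?f (n, \<alpha>)) has_sum (1 + t k) powr (-1/2)) (UNIV \<times> UNIV)"
      by (subst (asm) has_sum_swap)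
    show ?thesis
    proof (rule has_sum_SigmaD[OF sw])
      fix \<alpha> :: "'n \<Rightarrow> nat"
      \<comment> \<open>For fixed \<open>\<alpha>\<close> the inner family in \<open>n\<close>
        inherits absolute summability from the double family after division by the positive weight.
        So \<open>c \<alpha>\<close> is a genuine sum.\<close>
      have "(\<lambda>p. norm (case p of (\<alpha>, n) \<Rightarrow> \<bar>b n\<bar> * ?T n \<alpha>)) summable_on UNIV \<times> UNIV"
        using sB r by (subst (asm) summable_on_swap) (simp add: case_prod_unfold abs_mult)
      from this[unfolded Infinite_Sum.abs_summable_on_Sigma_iff]
      have "(\<lambda>n. norm (case (\<alpha>, n) of (\<alpha>, n) \<Rightarrow> \<bar>b n\<bar> * ?T n \<alpha>)) summable_on UNIV"
        by (rule conjunct1[THEN bspec]) (rule UNIV_I)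
      then have "(\<lambda>n. norm (\<bar>b n\<bar> * ?T n \<alpha>)) summable_on UNIV" by simp
      then have "(\<lambda>n. inverse (r ^ multi_degree \<alpha>) * norm (\<bar>b n\<bar> * ?T n \<alpha>)) summable_on UNIV"
        by (rule summable_on_cmult_right)
      then have "(\<lambda>n. norm (b n * power_coeff a n \<alpha>)) summable_on UNIV"
      proof (rule summable_on_comparison_test)
        show "norm (b n * power_coeff a n \<alpha>) \<le> inverse (r ^ multi_degree \<alpha>) * norm (\<bar>b n\<bar> * ?T n \<alpha>)" for n
          using r by (simp add: abs_mult field_simps)
      qed (rule norm_ge_zero)
      then have "(\<lambda>n. b n * power_coeff a n \<alpha>) summable_on UNIV"
        by (rule abs_summable_summable)
      then have "((\<lambda>n. monomial ?x \<alpha> * (b n * power_coeff a n \<alpha>)) has_sum monomial ?x \<alpha> * c \<alpha>) UNIV"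
        unfolding c_def by (rule has_sum_cmult_right[OF has_sum_infsum])
      then show "((\<lambda>n. case (\<alpha>, n) of (\<alpha>, n) \<Rightarrow> ?f (n, \<alpha>)) has_sum monomial ?x \<alpha> * c \<alpha>) UNIV"
        unfolding prod.case by (simp only: mult.left_commute)
    qed
  qed
  have "\<exists>r'. has_power_series (\<lambda>k. (1 + t k) powr (-1/2)) k0 r' c"
  proof (rule real_analytic_atI[OF r])
    fix k assume "k \<in> ball k0 r"
    then show "((\<lambda>\<alpha>. monomial (k - k0) \<alpha> *\<^sub>R c \<alpha>) has_sum (1 + t k) powr (-1/2)) UNIV"
      unfolding real_scaleR_def using order_trans[OF component_le_norm_cart[of "k - k0"], of r]
      by (intro sum) (simp add: dist_norm norm_minus_commute)
  qed
  then have "real_analytic_at (\<lambda>k. (1 + t k) powr (-1/2)) k0" unfolding real_analytic_at_def by blast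
  then have "real_analytic_at (\<lambda>k. (1 + t k) powr (-1/2) * f k0 powr (-1/2)) k0"
    by (rule real_analytic_at_bounded_linear[OF bounded_linear_mult_left])
  moreover have "\<forall>\<^sub>F k in nhds k0. (1 + t k) powr (-1/2) * f k0 powr (-1/2) = f k powr (-1/2)"
  proof -
    have "\<forall>\<^sub>F k in nhds k0. f k > 0"
      using real_analytic_at_isCont[OF f] pos
      unfolding isCont_def tendsto_at_iff_tendsto_nhds by (rule order_tendstoD(1))
    then show ?thesis
    proof eventually_elim
      case (elim k)
      have "1 + t k = f k / f k0" by (simp add: t_def)
      then show ?case using powr_mult[of "f k / f k0" "f k0" "-1/2"] pos elim by simp
    qed
  qed
  ultimately show ?thesis by (rule real_analytic_at_cong)
qed

text \<open>The norm enters only through \<open>f k \<bullet> f k\<close>, which is bilinear in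
  \<open>f\<close>; the normalizing factor is the inverse square root of it.\<close>

lemma real_analytic_at_normalize:
  fixes f :: "real^'n \<Rightarrow> 'a::real_inner"
  assumes f: "real_analytic_at f k0" and "f k0 \<noteq> 0"
  shows "real_analytic_at (\<lambda>k. f k /\<^sub>R norm (f k)) k0"
proof -
  have "real_analytic_at (\<lambda>k. f k \<bullet> f k) k0"
    by (rule real_analytic_at_bounded_bilinear[OF bounded_bilinear_inner f f])
  then have "real_analytic_at (\<lambda>k. (f k \<bullet> f k) powr (-1/2)) k0"
    using assms(2) by (intro real_analytic_at_inverse_sqrt) auto
  then have *: "real_analytic_at (\<lambda>k. (f k \<bullet> f k) powr (-1/2) *\<^sub>R f k) k0"
    by (rule real_analytic_at_bounded_bilinear[OF bounded_bilinear_scaleR _ f])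
  have that: "(x \<bullet> x) powr (-1/2) = inverse (norm x)" if "x \<noteq> 0" for x :: 'a
    using powr_minus[of "x \<bullet> x" "1/2"] powr_half_sqrt[of "x \<bullet> x"] norm_eq_sqrt_inner[of x] by simp
  have "(f k \<bullet> f k) powr (-1/2) *\<^sub>R f k = f k /\<^sub>R norm (f k)" for k
    using that[of "f k"] by (cases "f k = 0") auto
  then have "\<forall>\<^sub>F k in nhds k0. (f k \<bullet> f k) powr (-1/2) *\<^sub>R f k = f k /\<^sub>R norm (f k)"
    by (rule always_eventually[OF allI])
  with * show ?thesis by (rule real_analytic_at_cong)
qed

section \<open>The Hilbert space of square-integrable functions\<close>

definition square_integrable :: "('a::euclidean_space \<Rightarrow> complex) \<Rightarrow> bool" where
  "square_integrable f \<longleftrightarrow> f \<in> borel_measurable lborel \<and> integrable lborel (\<lambda>x. (cmod (f x))\<^sup>2)"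

definition l2_rel :: "('a::euclidean_space \<Rightarrow> complex) \<Rightarrow> ('a \<Rightarrow> complex) \<Rightarrow> bool" where
  "l2_rel f g \<longleftrightarrow> square_integrable f \<and> square_integrable g \<and> (AE x in lborel. f x = g x)"

lemma square_integrable_measurable [measurable_dest]: "square_integrable f \<Longrightarrow> f \<in> borel_measurable borel"
  by (simp add: square_integrable_def)

lemma square_integrable_zero: "square_integrable (\<lambda>x. 0)"
  by (simp add: square_integrable_def)

lemma square_integrable_bound:
  assumes "square_integrable f" "g \<in> borel_measurable borel" "AE x in lborel. cmod (g x) \<le> B * cmod (f x)"
  shows "square_integrable g"
  unfolding square_integrable_def
proof
  show "g \<in> borel_measurable lborel" using assms(2) by simp
  show "integrable lborel (\<lambda>x. (cmod (g x))\<^sup>2)"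
  proof (rule Bochner_Integration.integrable_bound)
    show "integrable lborel (\<lambda>x. B\<^sup>2 * (cmod (f x))\<^sup>2)"
      using assms(1) unfolding square_integrable_def by (intro integrable_mult_right) auto
    show "AE x in lborel. norm ((cmod (g x))\<^sup>2) \<le> norm (B\<^sup>2 * (cmod (f x))\<^sup>2)"
      using assms(3)
    proof eventually_elim
      case (elim x)
      then have "(cmod (g x))\<^sup>2 \<le> (B * cmod (f x))\<^sup>2" by (intro power_mono) auto
      then show ?case by (simp add: power_mult_distrib)
    qed
  qed (use assms(2) in simp)
qed

lemma square_integrable_cmult: "square_integrable f \<Longrightarrow> square_integrable (\<lambda>x. c * f x)"
  by (rule square_integrable_bound[where B = "cmod c" and f = f])
    (auto simp: norm_mult intro!: borel_measurable_times dest: square_integrable_measurable)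

lemma square_integrable_uminus: "square_integrable f \<Longrightarrow> square_integrable (\<lambda>x. - f x)"
  using square_integrable_cmult[of f "-1"] by simp

lemma borel_measurable_cnj: "f \<in> borel_measurable M \<Longrightarrow> (\<lambda>x. cnj (f x)) \<in> borel_measurable M"
  by (rule borel_measurable_continuous_on) (auto intro: continuous_intros)

lemma square_integrable_add:
  assumes "square_integrable f" "square_integrable g"
  shows "square_integrable (\<lambda>x. f x + g x)"
  unfolding square_integrable_def
proof
  note [measurable] = square_integrable_measurable[OF assms(1)] square_integrable_measurable[OF assms(2)]
  show "(\<lambda>x. f x + g x) \<in> borel_measurable lborel" by simp
  show "integrable lborel (\<lambda>x. (cmod (f x + g x))\<^sup>2)"
  proof (rule Bochner_Integration.integrable_bound)
    show "integrable lborel (\<lambda>x. 2 * (cmod (f x))\<^sup>2 + 2 * (cmod (g x))\<^sup>2)"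
      using assms unfolding square_integrable_def by auto
    have "(cmod (f x + g x))\<^sup>2 \<le> 2 * (cmod (f x))\<^sup>2 + 2 * (cmod (g x))\<^sup>2" for x
    proof -
      have "(cmod (f x + g x))\<^sup>2 \<le> (cmod (f x) + cmod (g x))\<^sup>2"
        by (intro power_mono norm_triangle_ineq) auto
      also have "\<dots> \<le> 2 * (cmod (f x))\<^sup>2 + 2 * (cmod (g x))\<^sup>2"
        using sum_squares_bound[of "cmod (f x)" "cmod (g x)"] by (simp add: power2_sum)
      finally show ?thesis .
    qed
    then show "AE x in lborel. norm ((cmod (f x + g x))\<^sup>2) \<le> norm (2 * (cmod (f x))\<^sup>2 + 2 * (cmod (g x))\<^sup>2)"
      by simp
  qed simp
qed

lemma integrable_cnj_mult:
  assumes "square_integrable f" "square_integrable g"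
  shows "integrable lborel (\<lambda>x. cnj (f x) * g x)"
proof (rule Bochner_Integration.integrable_bound)
  note [measurable] = square_integrable_measurable[OF assms(1)] square_integrable_measurable[OF assms(2)]
  show "integrable lborel (\<lambda>x. (cmod (f x))\<^sup>2 + (cmod (g x))\<^sup>2)"
    using assms unfolding square_integrable_def by auto
  have "cmod (f x) * cmod (g x) \<le> (cmod (f x))\<^sup>2 + (cmod (g x))\<^sup>2" for x
    using sum_squares_bound[of "cmod (f x)" "cmod (g x)"] mult_nonneg_nonneg[OF norm_ge_zero[of "f x"] norm_ge_zero[of "g x"]]
    by linarith
  then show "AE x in lborel. norm (cnj (f x) * g x) \<le> norm ((cmod (f x))\<^sup>2 + (cmod (g x))\<^sup>2)"
    by (simp add: norm_mult)
  show "(\<lambda>x. cnj (f x) * g x) \<in> borel_measurable lborel"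
    by (intro borel_measurable_times borel_measurable_cnj) auto
qed

\<comment> \<open>A type of classes modulo null sets lets the theory of power series in normed
  spaces apply to L2. The instance is a real inner product space; sums of series in it are always
  exhibited explicitly, never inferred from a Cauchy criterion.\<close>
quotient_type (overloaded) 'a l2 = "'a::euclidean_space \<Rightarrow> complex" / partial: l2_rel
proof (rule part_equivpI)
  show "\<exists>x. l2_rel x x" by (intro exI[of _ "\<lambda>x. 0"]) (simp add: l2_rel_def square_integrable_zero)
  show "symp l2_rel" by (intro sympI) (auto simp: l2_rel_def elim: AE_mp)
  show "transp l2_rel" by (intro transpI) (auto simp: l2_rel_def elim: AE_mp)
qed

lemma integral_cnj_mult_cong:
  assumes "l2_rel f f'" "l2_rel g g'"
  shows "(LINT x|lborel. cnj (f x) * g x) = (LINT x|lborel. cnj (f' x) * g' x)"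
proof (rule integral_cong_AE)
  note [measurable] = square_integrable_measurable
  show "(\<lambda>x. cnj (f x) * g x) \<in> borel_measurable lborel" "(\<lambda>x. cnj (f' x) * g' x) \<in> borel_measurable lborel"
    using assms unfolding l2_rel_def
    by (auto intro!: borel_measurable_times borel_measurable_cnj dest!: square_integrable_measurable)
  have "AE x in lborel. f x = f' x" "AE x in lborel. g x = g' x"
    using assms by (auto simp: l2_rel_def)
  then show "AE x in lborel. cnj (f x) * g x = cnj (f' x) * g' x"
    by eventually_elim simp
qed

lemma integral_Re_cnj_mult_commute:
  assumes "square_integrable f" "square_integrable g"
  shows "Re (LINT x|lborel. cnj (f x) * g x) = Re (LINT x|lborel. cnj (g x) * f x)"
proof -
  have "(LINT x|lborel. cnj (f x) * g x) = (LINT x|lborel. cnj (cnj (g x) * f x))"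
    by (simp add: mult.commute)
  also have "\<dots> = cnj (LINT x|lborel. cnj (g x) * f x)" by (rule Bochner_Integration.integral_cnj)
  finally show ?thesis by simp
qed

lemma integral_cnj_mult_self:
  "(LINT x|lborel. cnj (f x) * f x) = of_real (LINT x|lborel. (cmod (f x))\<^sup>2)"
  by (subst integral_complex_of_real[symmetric])
    (rule arg_cong[where f = "integral\<^sup>L lborel"], auto simp: complex_norm_square mult.commute simp flip: of_real_power)

instantiation l2 :: (euclidean_space) real_inner
begin

lift_definition zero_l2 :: "'a l2" is "\<lambda>x. 0"
  by (simp add: l2_rel_def square_integrable_zero)
lift_definition plus_l2 :: "'a l2 \<Rightarrow> 'a l2 \<Rightarrow> 'a l2" is "\<lambda>f g x. f x + g x"
  by (auto simp: l2_rel_def square_integrable_add elim: AE_mp)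
lift_definition uminus_l2 :: "'a l2 \<Rightarrow> 'a l2" is "\<lambda>f x. - f x"
  by (auto simp: l2_rel_def square_integrable_uminus elim: AE_mp)
definition minus_l2 :: "'a l2 \<Rightarrow> 'a l2 \<Rightarrow> 'a l2" where "minus_l2 f g = f + - g"
lift_definition scaleR_l2 :: "real \<Rightarrow> 'a l2 \<Rightarrow> 'a l2" is "\<lambda>c f x. of_real c * f x"
  by (auto simp: l2_rel_def square_integrable_cmult elim: AE_mp)
lift_definition inner_l2 :: "'a l2 \<Rightarrow> 'a l2 \<Rightarrow> real" is "\<lambda>f g. Re (LINT x|lborel. cnj (f x) * g x)"
  by (simp add: integral_cnj_mult_cong)

definition norm_l2 :: "'a l2 \<Rightarrow> real" where "norm_l2 f = sqrt (f \<bullet> f)"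
definition sgn_l2 :: "'a l2 \<Rightarrow> 'a l2" where "sgn_l2 f = inverse (norm f) *\<^sub>R f"
definition dist_l2 :: "'a l2 \<Rightarrow> 'a l2 \<Rightarrow> real" where "dist_l2 f g = norm (f - g)"
definition uniformity_l2 :: "('a l2 \<times> 'a l2) filter" where
  "uniformity_l2 = (INF e\<in>{0<..}. principal {(x, y). dist x y < e})"
definition open_l2 :: "'a l2 set \<Rightarrow> bool" where
  "open_l2 U \<longleftrightarrow> (\<forall>x\<in>U. \<forall>\<^sub>F (x', y) in uniformity. x' = x \<longrightarrow> y \<in> U)"

instance
proof
  fix f g h :: "'a l2" and r s :: real
  show "f + g + h = f + (g + h)"
    by transfer (auto simp: l2_rel_def square_integrable_add add.assoc)
  show "f + g = g + f"
    by transfer (auto simp: l2_rel_def square_integrable_add add.commute)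
  show "0 + f = f" by transfer (auto simp: l2_rel_def)
  show "- f + f = 0"
    by transfer (auto simp: l2_rel_def square_integrable_zero)
  show "f - g = f + - g" by (rule minus_l2_def)
  show "r *\<^sub>R (f + g) = r *\<^sub>R f + r *\<^sub>R g"
    by transfer (auto simp: l2_rel_def square_integrable_add square_integrable_cmult distrib_left)
  show "(r + s) *\<^sub>R f = r *\<^sub>R f + s *\<^sub>R f"
    by transfer (auto simp: l2_rel_def square_integrable_add square_integrable_cmult distrib_right)
  show "r *\<^sub>R s *\<^sub>R f = (r * s) *\<^sub>R f"
    by transfer (auto simp: l2_rel_def square_integrable_cmult mult.assoc)
  show "1 *\<^sub>R f = f" by transfer (auto simp: l2_rel_def)
  show "norm f = sqrt (f \<bullet> f)" by (rule norm_l2_def)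
  show "sgn f = inverse (norm f) *\<^sub>R f" by (rule sgn_l2_def)
  show "dist f g = norm (f - g)" by (rule dist_l2_def)
  show "uniformity = (INF e\<in>{0<..}. principal {(x, y :: 'a l2). dist x y < e})"
    by (rule uniformity_l2_def)
  show "open U = (\<forall>x\<in>U. \<forall>\<^sub>F (x', y) in uniformity. x' = x \<longrightarrow> y \<in> U)" for U :: "'a l2 set"
    by (rule open_l2_def)
  show "f \<bullet> g = g \<bullet> f"
    by transfer (rule integral_Re_cnj_mult_commute, auto simp: l2_rel_def)
  show "(f + g) \<bullet> h = f \<bullet> h + g \<bullet> h"
    by transfer (auto simp: l2_rel_def distrib_right integrable_cnj_mult)
  show "r *\<^sub>R f \<bullet> g = r * (f \<bullet> g)"
    by transfer (auto simp: l2_rel_def mult.assoc integrable_cnj_mult)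
  show "0 \<le> f \<bullet> f"
    by transfer (simp add: integral_cnj_mult_self)
  show "f \<bullet> f = 0 \<longleftrightarrow> f = 0"
  proof transfer
    fix f :: "'a \<Rightarrow> complex" assume "l2_rel f f"
    then have f: "square_integrable f" by (simp add: l2_rel_def)
    have "Re (LINT x|lborel. cnj (f x) * f x) = 0 \<longleftrightarrow> (LINT x|lborel. (cmod (f x))\<^sup>2) = 0"
      by (simp add: integral_cnj_mult_self)
    also have "\<dots> \<longleftrightarrow> (AE x in lborel. (cmod (f x))\<^sup>2 = 0)"
      using f by (intro integral_nonneg_eq_0_iff_AE) (auto simp: square_integrable_def)
    also have "\<dots> \<longleftrightarrow> l2_rel f (\<lambda>x. 0)"
      using f by (simp add: l2_rel_def square_integrable_zero)
    finally show "(Re (LINT x|lborel. cnj (f x) * f x) = 0) = l2_rel f (\<lambda>x. 0)" .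
  qed
qed

end

section \<open>Complex scaling and the complex inner product\<close>

lift_definition cscale :: "complex \<Rightarrow> 'a::euclidean_space l2 \<Rightarrow> 'a l2" is "\<lambda>c f x. c * f x"
  by (auto simp: l2_rel_def square_integrable_cmult elim: AE_mp)

lift_definition cinner :: "'a::euclidean_space l2 \<Rightarrow> 'a l2 \<Rightarrow> complex" is "\<lambda>f g. LINT x|lborel. cnj (f x) * g x"
  by (rule integral_cnj_mult_cong)

lemma Re_cinner: "Re (cinner x y) = x \<bullet> y"
  by transfer simp

lemma cinner_add_left: "cinner (x + y) z = cinner x z + cinner y z"
  by transfer (auto simp: l2_rel_def distrib_right integrable_cnj_mult)

lemma cinner_commute: "cinner x y = cnj (cinner y x)"
proof transfer
  fix f g :: "'a \<Rightarrow> complex"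
  show "(LINT x|lborel. cnj (f x) * g x) = cnj (LINT x|lborel. cnj (g x) * f x)"
    by (subst Bochner_Integration.integral_cnj[symmetric]) (simp add: mult.commute)
qed

lemma cinner_cscale_right: "cinner x (cscale c y) = c * cinner x y"
  by transfer (auto simp: l2_rel_def mult.left_commute integrable_cnj_mult)

lemma cinner_cscale_left: "cinner (cscale c x) y = cnj c * cinner x y"
  using cinner_commute[of "cscale c x" y] cinner_commute[of y x] by (simp add: cinner_cscale_right)

lemma cinner_add_right: "cinner x (y + z) = cinner x y + cinner x z"
  using cinner_commute[of x "y + z"] cinner_commute[of y x] cinner_commute[of z x] by (simp add: cinner_add_left)

lemma cinner_self: "cinner x x = of_real ((norm x)\<^sup>2)"
proof -
  have "Im (cinner x x) = 0" using cinner_commute[of x x] by (metis Im_complex_of_real cnj.simps(2) complex_cnj_complex_of_real complex_eqI equal_neg_zero)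
  then show ?thesis using Re_cinner[of x x] by (simp add: complex_eq_iff power2_norm_eq_inner del: dot_square_norm)
qed

lemma cscale_scaleR: "cscale (of_real r) x = r *\<^sub>R x"
  by transfer (auto simp: l2_rel_def square_integrable_cmult)

lemma cscale_cscale: "cscale a (cscale b x) = cscale (a * b) x"
  by transfer (auto simp: l2_rel_def square_integrable_cmult mult.assoc)

lemma cscale_add_left: "cscale (a + b) x = cscale a x + cscale b x"
  by transfer (auto simp: l2_rel_def square_integrable_cmult square_integrable_add distrib_right)

lemma cscale_add_right: "cscale a (x + y) = cscale a x + cscale a y"
  by transfer (auto simp: l2_rel_def square_integrable_cmult square_integrable_add distrib_left)

lemma norm_cscale: "norm (cscale c x) = cmod c * norm x"
proof -
  have "of_real ((norm (cscale c x))\<^sup>2) = (cnj c * c) * cinner x x"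
    by (simp add: cinner_self[symmetric] cinner_cscale_left cinner_cscale_right del: of_real_power)
  also have "\<dots> = of_real ((cmod c * norm x)\<^sup>2)"
    by (simp add: cinner_self power_mult_distrib complex_norm_square[symmetric] mult.commute[of "cnj c"])
  finally have "(norm (cscale c x))\<^sup>2 = (cmod c * norm x)\<^sup>2" by (simp only: of_real_eq_iff)
  then show ?thesis by simp
qed

text \<open>Rotating \<open>x\<close> by the phase of the inner product turns the modulus into a
  real inner product, to which the real Cauchy-Schwarz inequality applies.\<close>

lemma cmod_cinner_le: "cmod (cinner x y) \<le> norm x * norm y"
proof (cases "cinner x y = 0")
  case False
  define c where "c = sgn (cinner x y)"
  have c: "cmod c = 1" using False by (simp add: c_def norm_sgn)
  have "cnj c * cinner x y = of_real (cmod (cinner x y))"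
    unfolding c_def sgn_eq by (simp add: complex_norm_square[symmetric] power2_eq_square mult.commute)
  then have "cmod (cinner x y) = cscale c x \<bullet> y"
    unfolding Re_cinner[symmetric] cinner_cscale_left by simp
  also have "\<dots> \<le> norm (cscale c x) * norm y" by (rule norm_cauchy_schwarz)
  finally show ?thesis by (simp add: norm_cscale c)
qed simp

lemma bounded_bilinear_cscale: "bounded_bilinear cscale"
proof
  show "cscale (a + a') b = cscale a b + cscale a' b" for a a' and b :: "'a l2" by (rule cscale_add_left)
  show "cscale a (b + b') = cscale a b + cscale a b'" for a and b b' :: "'a l2" by (rule cscale_add_right)
  show "cscale (r *\<^sub>R a) b = r *\<^sub>R cscale a b" for r a and b :: "'a l2"
    by (simp add: cscale_scaleR[symmetric] cscale_cscale scaleR_conv_of_real)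
  show "cscale a (r *\<^sub>R b) = r *\<^sub>R cscale a b" for r a and b :: "'a l2"
    by (simp add: cscale_scaleR[symmetric] cscale_cscale mult.commute)
  show "\<exists>K. \<forall>a (b :: 'a l2). norm (cscale a b) \<le> norm a * norm b * K"
    by (intro exI[of _ 1]) (simp add: norm_cscale)
qed

lemma bounded_bilinear_cinner: "bounded_bilinear cinner"
proof
  show "cinner (a + a') b = cinner a b + cinner a' b" for a a' b :: "'a l2" by (rule cinner_add_left)
  show "cinner a (b + b') = cinner a b + cinner a b'" for a b b' :: "'a l2" by (rule cinner_add_right)
  show "cinner (r *\<^sub>R a) b = r *\<^sub>R cinner a b" for r and a b :: "'a l2"
    by (simp add: cscale_scaleR[symmetric] cinner_cscale_left scaleR_conv_of_real)
  show "cinner a (r *\<^sub>R b) = r *\<^sub>R cinner a b" for r and a b :: "'a l2"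
    by (simp add: cscale_scaleR[symmetric] cinner_cscale_right scaleR_conv_of_real)
  show "\<exists>K. \<forall>a b :: 'a l2. norm (cinner a b) \<le> norm a * norm b * K"
    by (intro exI[of _ 1]) (simp add: cmod_cinner_le)
qed

interpretation cscale: bounded_bilinear cscale by (rule bounded_bilinear_cscale)
interpretation cinner: bounded_bilinear cinner by (rule bounded_bilinear_cinner)

subsection \<open>Functions on a subset\<close>

definition square_integrable_on :: "'a::euclidean_space set \<Rightarrow> ('a \<Rightarrow> complex) \<Rightarrow> bool" where
  "square_integrable_on S u \<longleftrightarrow> u \<in> borel_measurable borel \<and> set_integrable lborel S (\<lambda>x. (cmod (u x))\<^sup>2)"

text \<open>Extension by zero: the L2 spaces of all subsets sit isometrically in one and the same
  type.\<close>

definition to_l2 :: "'a::euclidean_space set \<Rightarrow> ('a \<Rightarrow> complex) \<Rightarrow> 'a l2" where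
  "to_l2 S u = abs_l2 (\<lambda>x. indicat_real S x *\<^sub>R u x)"

lemma square_integrable_indicator:
  assumes "S \<in> sets borel" "square_integrable_on S u"
  shows "square_integrable (\<lambda>x. indicat_real S x *\<^sub>R u x)"
proof -
  have "(\<lambda>x. (cmod (indicat_real S x *\<^sub>R u x))\<^sup>2) = (\<lambda>x. indicat_real S x *\<^sub>R (cmod (u x))\<^sup>2)"
    by (auto simp: indicator_def)
  moreover have "(\<lambda>x. indicat_real S x *\<^sub>R u x) \<in> borel_measurable lborel"
    using assms unfolding square_integrable_on_def by (auto intro!: borel_measurable_scaleR borel_measurable_indicator)
  ultimately show ?thesis using assms
    unfolding square_integrable_def square_integrable_on_def set_integrable_def by simp
qed

context
  fixes S :: "'a::euclidean_space set"
  assumes S: "S \<in> sets borel"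
begin

lemma to_l2_eqI:
  assumes "square_integrable_on S u" "square_integrable_on S v" "AE x in lborel. x \<in> S \<longrightarrow> u x = v x"
  shows "to_l2 S u = to_l2 S v"
  unfolding to_l2_def
proof (rule Quotient_rel_abs[OF Quotient_l2])
  have "AE x in lborel. indicat_real S x *\<^sub>R u x = indicat_real S x *\<^sub>R v x"
    using assms(3) by eventually_elim (auto simp: indicator_def)
  then show "l2_rel (\<lambda>x. indicat_real S x *\<^sub>R u x) (\<lambda>x. indicat_real S x *\<^sub>R v x)"
    using square_integrable_indicator[OF S] assms by (simp add: l2_rel_def)
qed

lemma cinner_to_l2:
  assumes "square_integrable_on S u" "square_integrable_on S v"
  shows "cinner (to_l2 S u) (to_l2 S v) = (LINT x:S|lborel. cnj (u x) * v x)"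
proof -
  have "cinner (to_l2 S u) (to_l2 S v) =
      (LINT x|lborel. cnj (indicat_real S x *\<^sub>R u x) * (indicat_real S x *\<^sub>R v x))"
    unfolding to_l2_def using assms
    by (intro cinner.abs_eq) (simp_all add: l2_rel_def square_integrable_indicator[OF S])
  also have "\<dots> = (LINT x:S|lborel. cnj (u x) * v x)"
    unfolding set_lebesgue_integral_def by (rule arg_cong[where f = "integral\<^sup>L lborel"]) (auto simp: indicator_def)
  finally show ?thesis .
qed

lemma norm_to_l2:
  assumes "square_integrable_on S u"
  shows "norm (to_l2 S u) = sqrt (LINT x:S|lborel. (cmod (u x))\<^sup>2)"
proof -
  have "of_real ((norm (to_l2 S u))\<^sup>2) = (LINT x:S|lborel. cnj (u x) * u x)"
    using assms by (simp only: cinner_self[symmetric] cinner_to_l2)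
  also have "\<dots> = of_real (LINT x:S|lborel. (cmod (u x))\<^sup>2)"
    unfolding set_lebesgue_integral_def
    by (subst integral_complex_of_real[symmetric])
      (rule arg_cong[where f = "integral\<^sup>L lborel"], auto simp: indicator_def complex_norm_square mult.commute simp flip: of_real_power)
  finally have "(norm (to_l2 S u))\<^sup>2 = (LINT x:S|lborel. (cmod (u x))\<^sup>2)" by (simp only: of_real_eq_iff)
  then show ?thesis by (metis norm_ge_zero real_sqrt_unique)
qed

lemma square_integrable_on_add:
  "square_integrable_on S u \<Longrightarrow> square_integrable_on S v \<Longrightarrow> square_integrable_on S (\<lambda>x. u x + v x)"
  and square_integrable_on_bound:
  "square_integrable_on S u \<Longrightarrow> f \<in> borel_measurable borel \<Longrightarrow> (AE x in lborel. x \<in> S \<longrightarrow> cmod (f x) \<le> B * cmod (u x)) \<Longrightarrow>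
    square_integrable_on S f"
proof -
  have *: "square_integrable_on S u \<longleftrightarrow> u \<in> borel_measurable borel \<and> square_integrable (\<lambda>x. indicat_real S x *\<^sub>R u x)" for u
  proof -
    have "(\<lambda>x. (cmod (indicat_real S x *\<^sub>R u x))\<^sup>2) = (\<lambda>x. indicat_real S x *\<^sub>R (cmod (u x))\<^sup>2)"
      by (auto simp: indicator_def)
    then show ?thesis using square_integrable_indicator[OF S, of u]
      unfolding square_integrable_on_def square_integrable_def set_integrable_def by auto
  qed
  show "square_integrable_on S u \<Longrightarrow> square_integrable_on S v \<Longrightarrow> square_integrable_on S (\<lambda>x. u x + v x)"
    unfolding * using square_integrable_add[of "\<lambda>x. indicat_real S x *\<^sub>R u x" "\<lambda>x. indicat_real S x *\<^sub>R v x"]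
    by (auto simp: scaleR_add_right)
  assume u: "square_integrable_on S u" and f: "f \<in> borel_measurable borel" and le: "AE x in lborel. x \<in> S \<longrightarrow> cmod (f x) \<le> B * cmod (u x)"
  have "square_integrable (\<lambda>x. indicat_real S x *\<^sub>R f x)"
  proof (rule square_integrable_bound)
    show "square_integrable (\<lambda>x. indicat_real S x *\<^sub>R u x)" using u * by blast
    show "(\<lambda>x. indicat_real S x *\<^sub>R f x) \<in> borel_measurable borel"
      using f S by (intro borel_measurable_scaleR borel_measurable_indicator)
    show "AE x in lborel. cmod (indicat_real S x *\<^sub>R f x) \<le> B * cmod (indicat_real S x *\<^sub>R u x)"
      using le by eventually_elim (auto simp: indicator_def)
  qed
  then show "square_integrable_on S f" using * f by blast
qed

lemma square_integrable_on_cmult: "square_integrable_on S u \<Longrightarrow> square_integrable_on S (\<lambda>x. c * u x)"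
  by (rule square_integrable_on_bound[where B = "cmod c"]) (auto simp: norm_mult square_integrable_on_def)

lemma to_l2_add:
  assumes "square_integrable_on S u" "square_integrable_on S v"
  shows "to_l2 S (\<lambda>x. u x + v x) = to_l2 S u + to_l2 S v"
  unfolding to_l2_def using assms square_integrable_indicator[OF S]
  by (subst plus_l2.abs_eq) (auto simp: l2_rel_def scaleR_add_right)

lemma to_l2_cmult:
  assumes "square_integrable_on S u"
  shows "to_l2 S (\<lambda>x. c * u x) = cscale c (to_l2 S u)"
  unfolding to_l2_def using assms square_integrable_indicator[OF S]
  by (subst cscale.abs_eq) (auto simp: l2_rel_def)

lemma square_integrable_on_diff:
  "square_integrable_on S u \<Longrightarrow> square_integrable_on S v \<Longrightarrow> square_integrable_on S (\<lambda>x. u x - v x)"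
  using square_integrable_on_add[of u "\<lambda>x. -1 * v x"] square_integrable_on_cmult[of v "-1"] by simp

lemma to_l2_diff:
  assumes "square_integrable_on S u" "square_integrable_on S v"
  shows "to_l2 S (\<lambda>x. u x - v x) = to_l2 S u - to_l2 S v"
  using to_l2_add[OF assms(1) square_integrable_on_cmult[OF assms(2), of "-1"]] to_l2_cmult[OF assms(2), of "-1"]
    cscale_scaleR[of "-1" "to_l2 S v"] by simp

lemma square_integrable_on_sum:
  "(\<And>j. j \<in> J \<Longrightarrow> square_integrable_on S (u j)) \<Longrightarrow> square_integrable_on S (\<lambda>x. \<Sum>j\<in>J. u j x)"
proof (induction J rule: infinite_finite_induct)
  case (insert j J)
  then show ?case using square_integrable_on_add[of "u j" "\<lambda>x. \<Sum>j\<in>J. u j x"] by simp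
qed (auto simp: square_integrable_on_def set_integrable_def)

lemma to_l2_zero: "to_l2 S (\<lambda>x. 0) = 0"
  by (simp add: to_l2_def zero_l2_def)

lemma to_l2_sum:
  "(\<And>j. j \<in> J \<Longrightarrow> square_integrable_on S (u j)) \<Longrightarrow> to_l2 S (\<lambda>x. \<Sum>j\<in>J. u j x) = (\<Sum>j\<in>J. to_l2 S (u j))"
proof (induction J rule: infinite_finite_induct)
  case (insert j J)
  then show ?case using to_l2_add[of "u j" "\<lambda>x. \<Sum>j\<in>J. u j x"] square_integrable_on_sum[of J u] by simp
qed (auto simp: to_l2_zero)

lemma norm_to_l2_le:
  assumes "square_integrable_on S u" "f \<in> borel_measurable borel"
    and le: "AE x in lborel. x \<in> S \<longrightarrow> cmod (f x) \<le> B * cmod (u x)" and "0 \<le> B"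
  shows "norm (to_l2 S f) \<le> B * norm (to_l2 S u)"
proof -
  have f: "square_integrable_on S f" by (rule square_integrable_on_bound[OF assms(1,2) le])
  have "(LINT x:S|lborel. (cmod (f x))\<^sup>2) \<le> (LINT x:S|lborel. B\<^sup>2 * (cmod (u x))\<^sup>2)"
  proof (rule set_integral_mono_AE)
    show "set_integrable lborel S (\<lambda>x. (cmod (f x))\<^sup>2)" "set_integrable lborel S (\<lambda>x. B\<^sup>2 * (cmod (u x))\<^sup>2)"
      using f assms(1) by (auto simp: square_integrable_on_def)
    show "AE x\<in>S in lborel. (cmod (f x))\<^sup>2 \<le> B\<^sup>2 * (cmod (u x))\<^sup>2"
      using le
    proof eventually_elim
      case (elim x)
      then show ?case using power_mono[of "cmod (f x)" "B * cmod (u x)" 2] by (auto simp: power_mult_distrib)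
    qed
  qed
  then show ?thesis using \<open>0 \<le> B\<close>
    by (simp add: norm_to_l2[OF f] norm_to_l2[OF assms(1)] real_sqrt_mult[symmetric] real_le_lsqrt)
      (metis abs_of_nonneg real_sqrt_abs real_sqrt_le_mono real_sqrt_mult)
qed

end

section \<open>Orthogonal invariance of Lebesgue measure\<close>

lemma AE_lborel_transform:
  fixes T :: "'a::euclidean_space \<Rightarrow> 'a"
  assumes "distr lborel borel T = lborel" "T \<in> borel_measurable borel" "AE x in lborel. P x"
  shows "AE x in lborel. P (T x)"
proof (rule AE_distrD[where M' = borel and P = P and f = T])
  show "T \<in> measurable lborel borel" using assms(2) by simp
  show "AE x in distr lborel borel T. P x" by (subst assms(1)) (rule assms(3))
qed

lemma lborel_distr_diff: "distr lborel borel (\<lambda>x::'a::euclidean_space. t - x) = lborel"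
  by (subst lborel_affine[of "-1" t]) (auto simp: density_1 one_ennreal_def[symmetric])

text \<open>A translation-invariant measure is determined by its value on a single ball: integrate
  \<open>1\<^sub>A(f x) 1\<^sub>B(y + f x)\<close> over \<open>x\<close> and \<open>y\<close> in both orders.\<close>

lemma lborel_distr_orthogonal:
  fixes f :: "'a::euclidean_space \<Rightarrow> 'a"
  assumes f: "orthogonal_transformation f"
  shows "distr lborel borel f = lborel"
proof (rule measure_eqI)
  have lin: "linear f" using f by (rule orthogonal_transformation_linear)
  have [measurable]: "f \<in> borel_measurable borel"
    using lin by (intro borel_measurable_continuous_onI linear_continuous_on) (simp add: linear_conv_bounded_linear)
  \<comment> \<open>The unit ball is invariant under \<open>f\<close> and has finite positive
    measure, so its measure can be cancelled at the end.\<close>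
  define B :: "'a set" where "B = ball 0 1"
  have [measurable]: "B \<in> sets borel" by (simp add: B_def)
  have fB: "indicator B (f x) = (indicator B x :: ennreal)" for x
    using orthogonal_transformation_norm[OF f] by (simp add: B_def indicator_def)
  fix A assume "A \<in> sets (distr lborel borel f)"
  then have [measurable]: "A \<in> sets borel" by simp
  let ?\<nu> = "emeasure lborel :: 'a set \<Rightarrow> ennreal"
  have T: "(\<integral>\<^sup>+x. g (T x) \<partial>lborel) = (\<integral>\<^sup>+x. g x \<partial>lborel)"
    if "distr lborel borel T = lborel" "T \<in> borel_measurable borel" "g \<in> borel_measurable borel"
    for g :: "'a \<Rightarrow> ennreal" and T :: "'a \<Rightarrow> 'a"
    using nn_integral_distr[of T lborel borel g] that by simp
  have plus: "distr lborel borel (\<lambda>x::'a. x + c) = lborel" for c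
    using lborel_distr_plus[of c] by (simp add: add.commute[of _ c])
  have "emeasure (distr lborel borel f) A * ?\<nu> B = (\<integral>\<^sup>+x. indicator A (f x) \<partial>lborel) * ?\<nu> B"
  proof -
    have "emeasure (distr lborel borel f) A = (\<integral>\<^sup>+x. indicator A x \<partial>distr lborel borel f)" by simp
    also have "\<dots> = (\<integral>\<^sup>+x. indicator A (f x) \<partial>lborel)" by (subst nn_integral_distr) auto
    finally show ?thesis by simp
  qed
  also have "\<dots> = (\<integral>\<^sup>+x. indicator A (f x) * ?\<nu> B \<partial>lborel)"
    by (subst nn_integral_multc) auto
  also have "\<dots> = (\<integral>\<^sup>+x. indicator A (f x) * (\<integral>\<^sup>+y. indicator B (y + f x) \<partial>lborel) \<partial>lborel)"
    by (subst T[OF plus]) auto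
  also have "\<dots> = (\<integral>\<^sup>+x. \<integral>\<^sup>+y. indicator A (f x) * indicator B (y + f x) \<partial>lborel \<partial>lborel)"
    by (subst nn_integral_cmult) auto
  also have "\<dots> = (\<integral>\<^sup>+y. \<integral>\<^sup>+x. indicator A (f x) * indicator B (y + f x) \<partial>lborel \<partial>lborel)"
    by (rule lborel_pair.Fubini') (simp add: split_beta')
  \<comment> \<open>Shifting \<open>x\<close> by minus the preimage of \<open>y\<close> replaces
    \<open>f x\<close> by \<open>f x - y\<close>, which moves \<open>y\<close> from the second
    factor into the first.\<close>
  also have "\<dots> = (\<integral>\<^sup>+y. \<integral>\<^sup>+x. indicator A (f x - y) * indicator B (f x) \<partial>lborel \<partial>lborel)"
  proof (rule nn_integral_cong)
    fix y
    have f_inv: "f (inv_into UNIV f y) = y" using orthogonal_transformation_surj[OF f] by (simp add: surj_f_inv_f)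
    have "(\<integral>\<^sup>+x. indicator A (f x) * indicator B (y + f x) \<partial>lborel) =
        (\<integral>\<^sup>+x. indicator A (f (x + - inv_into UNIV f y)) * indicator B (y + f (x + - inv_into UNIV f y)) \<partial>lborel)"
      by (rule T[OF plus, symmetric]) auto
    also have "\<dots> = (\<integral>\<^sup>+x. indicator A (f x - y) * indicator B (f x) \<partial>lborel)"
      by (simp add: linear_diff[OF lin] f_inv)
    finally show "(\<integral>\<^sup>+x. indicator A (f x) * indicator B (y + f x) \<partial>lborel) =
        (\<integral>\<^sup>+x. indicator A (f x - y) * indicator B (f x) \<partial>lborel)" .
  qed
  also have "\<dots> = (\<integral>\<^sup>+x. \<integral>\<^sup>+y. indicator A (f x - y) * indicator B (f x) \<partial>lborel \<partial>lborel)"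
    by (rule lborel_pair.Fubini') (simp add: split_beta')
  also have "\<dots> = (\<integral>\<^sup>+x. (\<integral>\<^sup>+y. indicator A (f x - y) \<partial>lborel) * indicator B (f x) \<partial>lborel)"
    by (subst nn_integral_multc) auto
  also have "\<dots> = (\<integral>\<^sup>+x. ?\<nu> A * indicator B (f x) \<partial>lborel)"
    by (subst T[OF lborel_distr_diff]) auto
  also have "\<dots> = ?\<nu> A * ?\<nu> B"
    by (simp add: fB nn_integral_cmult)
  finally have "emeasure (distr lborel borel f) A * ?\<nu> B = ?\<nu> A * ?\<nu> B" .
  moreover have "?\<nu> B \<noteq> 0"
    using content_ball_pos[of 1 "0::'a"] by (auto simp: B_def measure_def)
  moreover have "?\<nu> B \<noteq> \<infinity>" unfolding B_def using emeasure_lborel_ball_finite by (metis less_irrefl)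
  ultimately show "emeasure (distr lborel borel f) A = ?\<nu> A"
    using mult_divide_eq_ennreal by (metis infinity_ennreal_def)
qed simp

lemma lborel_distr_orthogonal_affine:
  fixes f :: "'a::euclidean_space \<Rightarrow> 'a"
  assumes f: "orthogonal_transformation f"
  shows "distr lborel borel (\<lambda>x. f x + c) = lborel" "(\<lambda>x. f x + c) \<in> borel_measurable borel"
proof -
  have m: "f \<in> borel_measurable borel"
    using orthogonal_transformation_linear[OF f]
    by (intro borel_measurable_continuous_onI linear_continuous_on) (simp add: linear_conv_bounded_linear)
  then show "(\<lambda>x. f x + c) \<in> borel_measurable borel" by simp
  have "distr lborel borel (\<lambda>x. f x + c) = distr (distr lborel borel f) borel ((+) c)"
    using m by (subst distr_distr) (auto simp: o_def add.commute)
  also have "\<dots> = lborel" by (simp add: lborel_distr_orthogonal[OF f] lborel_distr_plus)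
  finally show "distr lborel borel (\<lambda>x. f x + c) = lborel" .
qed

section \<open>Lattices and their unit cells\<close>

text \<open>The same choice term as inside \<open>unit_cell\<close>, so that cell and coordinates
  refer to one basis.\<close>

definition lattice_basis :: "(real^'n) set \<Rightarrow> real^'n^'n" where
  "lattice_basis L = (SOME A. invertible A \<and> L = lattice_of A)"

definition cell_rep :: "(real^'n) set \<Rightarrow> real^'n \<Rightarrow> real^'n" where
  "cell_rep L r = lattice_basis L *v (\<chi> i. frac ((matrix_inv (lattice_basis L) *v r) $ i))"

context
  fixes L :: "(real^'n) set"
  assumes L: "full_rank_lattice L"
begin

lemma lattice_basis: "invertible (lattice_basis L)" "L = lattice_of (lattice_basis L)"
proof -
  have "invertible (lattice_basis L) \<and> L = lattice_of (lattice_basis L)"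
    unfolding lattice_basis_def using L unfolding full_rank_lattice_def by (rule someI_ex)
  then show "invertible (lattice_basis L)" "L = lattice_of (lattice_basis L)" by auto
qed

lemma lattice_basis_inv:
  "lattice_basis L *v (matrix_inv (lattice_basis L) *v r) = r"
  "matrix_inv (lattice_basis L) *v (lattice_basis L *v r) = r"
proof -
  have "\<exists>A'. lattice_basis L ** A' = mat 1 \<and> A' ** lattice_basis L = mat 1"
    using lattice_basis(1) unfolding invertible_def .
  then have "lattice_basis L ** matrix_inv (lattice_basis L) = mat 1 \<and> matrix_inv (lattice_basis L) ** lattice_basis L = mat 1"
    unfolding matrix_inv_def by (rule someI_ex)
  then show "lattice_basis L *v (matrix_inv (lattice_basis L) *v r) = r"
    "matrix_inv (lattice_basis L) *v (lattice_basis L *v r) = r"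
    by (simp_all add: matrix_vector_mul_assoc)
qed

lemma mem_lattice_iff: "R \<in> L \<longleftrightarrow> (\<forall>i. (matrix_inv (lattice_basis L) *v R) $ i \<in> \<int>)"
proof
  assume "R \<in> L"
  then obtain x where "R = lattice_basis L *v x" "\<forall>i. x $ i \<in> \<int>"
    using lattice_basis(2) unfolding lattice_of_def by auto
  then show "\<forall>i. (matrix_inv (lattice_basis L) *v R) $ i \<in> \<int>" by (simp add: lattice_basis_inv)
next
  assume "\<forall>i. (matrix_inv (lattice_basis L) *v R) $ i \<in> \<int>"
  then have "R \<in> lattice_of (lattice_basis L)"
    unfolding lattice_of_def by (intro CollectI exI[of _ "matrix_inv (lattice_basis L) *v R"]) (simp add: lattice_basis_inv)
  then show "R \<in> L" using lattice_basis(2) by simp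
qed

lemma mem_unit_cell_iff:
  "r \<in> unit_cell L \<longleftrightarrow> (\<forall>i. 0 \<le> (matrix_inv (lattice_basis L) *v r) $ i \<and> (matrix_inv (lattice_basis L) *v r) $ i < 1)"
proof
  assume "r \<in> unit_cell L"
  then obtain x where "r = lattice_basis L *v x" "\<forall>i. 0 \<le> x $ i \<and> x $ i < 1"
    unfolding unit_cell_def lattice_basis_def[symmetric] Let_def by auto
  then show "\<forall>i. 0 \<le> (matrix_inv (lattice_basis L) *v r) $ i \<and> (matrix_inv (lattice_basis L) *v r) $ i < 1"
    by (simp add: lattice_basis_inv)
next
  assume "\<forall>i. 0 \<le> (matrix_inv (lattice_basis L) *v r) $ i \<and> (matrix_inv (lattice_basis L) *v r) $ i < 1"
  then show "r \<in> unit_cell L"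
    unfolding unit_cell_def lattice_basis_def[symmetric] Let_def
    by (intro CollectI exI[of _ "matrix_inv (lattice_basis L) *v r"]) (simp add: lattice_basis_inv)
qed

lemma lattice_zero: "0 \<in> L"
  and lattice_add: "R \<in> L \<Longrightarrow> R' \<in> L \<Longrightarrow> R + R' \<in> L"
  and lattice_uminus: "R \<in> L \<Longrightarrow> - R \<in> L"
  using lattice_basis(2) lattice_of_zero lattice_of_add lattice_of_uminus by metis+

lemma lattice_diff: "R \<in> L \<Longrightarrow> R' \<in> L \<Longrightarrow> R - R' \<in> L"
  using lattice_add[of R "- R'"] lattice_uminus[of R'] by simp

lemma cell_rep_mem: "cell_rep L r \<in> unit_cell L"
  unfolding mem_unit_cell_iff cell_rep_def by (simp add: lattice_basis_inv frac_lt_1)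

lemma diff_cell_rep_mem: "r - cell_rep L r \<in> L"
  unfolding mem_lattice_iff cell_rep_def matrix_vector_mult_diff_distrib lattice_basis_inv
  by (simp add: frac_def)

lemma cell_rep_eq: "r \<in> unit_cell L \<Longrightarrow> cell_rep L r = r"
  unfolding mem_unit_cell_iff
proof -
  assume "\<forall>i. 0 \<le> (matrix_inv (lattice_basis L) *v r) $ i \<and> (matrix_inv (lattice_basis L) *v r) $ i < 1"
  then have "(\<chi> i. frac ((matrix_inv (lattice_basis L) *v r) $ i)) = matrix_inv (lattice_basis L) *v r"
    by (simp add: vec_eq_iff frac_eq)
  then show "cell_rep L r = r" by (simp add: cell_rep_def lattice_basis_inv)
qed

lemma cell_rep_add: "R \<in> L \<Longrightarrow> cell_rep L (r + R) = cell_rep L r"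
proof -
  assume "R \<in> L"
  then have "frac ((matrix_inv (lattice_basis L) *v (r + R)) $ i) = frac ((matrix_inv (lattice_basis L) *v r) $ i)" for i
    unfolding mem_lattice_iff matrix_vector_right_distrib
    by (metis Ints_cases frac_add_of_int_right vector_add_component)
  then show ?thesis by (simp add: cell_rep_def)
qed

lemma cell_rep_measurable [measurable]: "cell_rep L \<in> borel_measurable borel"
proof -
  have m: "(\<lambda>r. A *v r) \<in> borel_measurable borel" for A :: "real^'n^'n"
    by (intro borel_measurable_continuous_onI matrix_vector_mult_linear_continuous_on)
  have "(\<lambda>r. \<chi> i. frac ((matrix_inv (lattice_basis L) *v r) $ i)) \<in> borel_measurable borel"
  proof (subst borel_measurable_euclidean_space, intro ballI)
    fix b :: "real^'n" assume "b \<in> Basis"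
    then obtain i where b: "b = axis i 1" by (auto simp: Basis_vec_def)
    have "(\<lambda>r. (matrix_inv (lattice_basis L) *v r) $ i) \<in> borel_measurable borel"
      by (rule measurable_compose[OF m]) (intro borel_measurable_continuous_onI continuous_intros)
    then show "(\<lambda>r. (\<chi> i. frac ((matrix_inv (lattice_basis L) *v r) $ i)) \<bullet> b) \<in> borel_measurable borel"
      by (simp add: b inner_axis frac_def)
  qed
  from measurable_compose[OF this m] show ?thesis unfolding cell_rep_def .
qed

lemma unit_cell_borel [measurable]: "unit_cell L \<in> sets borel"
proof -
  have "unit_cell L = {r \<in> space borel. cell_rep L r = r}"
  proof (intro Set.set_eqI iffI)
    fix r assume "r \<in> {r \<in> space borel. cell_rep L r = r}"
    then show "r \<in> unit_cell L" using cell_rep_mem[of r] by simp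
  qed (simp add: cell_rep_eq)
  also have "\<dots> \<in> sets borel" by measurable
  finally show ?thesis .
qed

lemma bounded_unit_cell: "bounded (unit_cell L)"
proof -
  have "unit_cell L \<subseteq> (\<lambda>x. lattice_basis L *v x) ` cbox 0 (\<chi> i. 1)"
  proof
    fix r assume "r \<in> unit_cell L"
    then show "r \<in> (\<lambda>x. lattice_basis L *v x) ` cbox 0 (\<chi> i. 1)"
      unfolding mem_unit_cell_iff
      by (intro image_eqI[of _ _ "matrix_inv (lattice_basis L) *v r"]) (auto simp: lattice_basis_inv mem_box_cart less_imp_le)
  qed
  moreover have "bounded ((\<lambda>x. lattice_basis L *v x) ` cbox 0 (\<chi> i. 1))"
    by (intro bounded_linear_image bounded_cbox) auto
  ultimately show ?thesis by (rule bounded_subset[rotated])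
qed

lemma finite_lattice_bounded:
  assumes "bounded S"
  shows "finite (L \<inter> S)"
proof -
  let ?B = "matrix_inv (lattice_basis L)"
  have "bounded ((\<lambda>x. ?B *v x) ` S)" using assms by (intro bounded_linear_image) auto
  then obtain M where M: "\<And>x. x \<in> S \<Longrightarrow> norm (?B *v x) \<le> M" unfolding bounded_iff by auto
  define F where "F = (\<lambda>g. lattice_basis L *v (\<chi> i. of_int (g i))) ` (PiE UNIV (\<lambda>i::'n. {-\<lceil>M\<rceil>..\<lceil>M\<rceil>}))"
  have "L \<inter> S \<subseteq> F"
  proof
    fix R assume R: "R \<in> L \<inter> S"
    define g where "g i = \<lfloor>(?B *v R) $ i\<rfloor>" for i
    have int: "of_int (g i) = (?B *v R) $ i" for i
      using R mem_lattice_iff unfolding g_def by (auto elim!: Ints_cases)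
    have "\<bar>(?B *v R) $ i\<bar> \<le> M" for i
      using M[of R] R component_le_norm_cart[of "?B *v R" i] by (auto intro: order_trans)
    then have "- \<lceil>M\<rceil> \<le> g i \<and> g i \<le> \<lceil>M\<rceil>" for i
      unfolding int[symmetric] abs_le_iff by (smt (verit) le_of_int_ceiling of_int_le_iff of_int_minus)
    then have "g \<in> PiE UNIV (\<lambda>i. {-\<lceil>M\<rceil>..\<lceil>M\<rceil>})" by auto
    moreover have "R = lattice_basis L *v (\<chi> i. of_int (g i))"
      using lattice_basis_inv(1)[of R] by (simp add: int)
    ultimately show "R \<in> F" unfolding F_def by blast
  qed
  moreover have "finite F" unfolding F_def by (intro finite_imageI finite_PiE) auto
  ultimately show ?thesis by (rule finite_subset)
qed

lemma countable_lattice: "countable L"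
proof -
  have "L = (\<Union>n::nat. L \<inter> ball 0 (real n))"
  proof (intro Set.set_eqI iffI)
    fix R assume R: "R \<in> L"
    obtain n :: nat where "norm R < real n" using reals_Archimedean2 by blast
    then show "R \<in> (\<Union>n::nat. L \<inter> ball 0 (real n))" using R by auto
  qed auto
  moreover have "countable (\<Union>n::nat. L \<inter> ball 0 (real n))"
    by (rule countable_UN) (auto intro: countable_finite finite_lattice_bounded)
  ultimately show ?thesis by (rule ssubst)
qed

text \<open>Both sides of the claim are integrals over \<open>\<real>\<^sup>d/L\<close>, with two different fundamental domains.\<close>

lemma emeasure_cell_transform:
  fixes f :: "real^'n \<Rightarrow> real^'n"
  assumes f: "orthogonal_transformation f" and fL: "f ` L = L" and B: "B \<in> sets borel"
  shows "emeasure lborel {r \<in> unit_cell L. cell_rep L (f r + v) \<in> B} = emeasure lborel (unit_cell L \<inter> B)"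
proof -
  note [measurable] = B
  let ?C = "unit_cell L"
  define T where "T R r = f r + v - R" for R r
  have T_eq: "T R = (\<lambda>r. f r + (v - R))" for R by (auto simp: T_def)
  have T_meas [measurable]: "T R \<in> borel_measurable borel" for R
    unfolding T_eq by (rule lborel_distr_orthogonal_affine(2)[OF f])
  have T_distr: "distr lborel borel (T R) = lborel" for R
    unfolding T_eq by (rule lborel_distr_orthogonal_affine(1)[OF f])
  define g where "g = inv_into UNIV f"
  have gf: "g (f x) = x" and fg: "f (g x) = x" for x
    using orthogonal_transformation_inj[OF f] orthogonal_transformation_surj[OF f]
    by (simp_all add: g_def surj_f_inv_f)
  have g: "orthogonal_transformation g" unfolding g_def by (rule orthogonal_transformation_inv[OF f])
  define S where "S R s = g s - g (v - R)" for R s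
  have S_eq: "S R = (\<lambda>r. g r + - g (v - R))" for R by (auto simp: S_def)
  have S_meas [measurable]: "S R \<in> borel_measurable borel" for R
    unfolding S_eq by (rule lborel_distr_orthogonal_affine(2)[OF g])
  have ST: "S R (T R r) = r" for R r
    by (simp add: S_def T_def gf linear_add[OF orthogonal_transformation_linear[OF g]] linear_diff[OF orthogonal_transformation_linear[OF g]])
  have shift: "S R s = S 0 s + g R" for R s
    by (simp add: S_def linear_diff[OF orthogonal_transformation_linear[OF g]])
  have gL: "g R \<in> L \<longleftrightarrow> R \<in> L" for R
  proof
    assume "g R \<in> L"
    then have "f (g R) \<in> f ` L" by (rule imageI)
    then show "R \<in> L" by (simp add: fL fg)
  next
    assume "R \<in> L"
    then obtain R' where "R' \<in> L" "R = f R'" using fL by blast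
    then show "g R \<in> L" by (simp add: gf)
  qed
  \<comment> \<open>\<open>?X R\<close> is the part of the cell whose image must be moved back by
    \<open>R\<close>. The map \<open>T R\<close> carries it to \<open>?Y R\<close>, and while the
    sets \<open>?X R\<close> partition the left-hand set, the sets \<open>?Y R\<close> partition the
    right-hand one.\<close>
  let ?X = "\<lambda>R. {r. r \<in> ?C \<and> T R r \<in> ?C \<inter> B}" and ?Y = "\<lambda>R. {s. s \<in> ?C \<inter> B \<and> S R s \<in> ?C}"
  have unique: "R = R'" if "R \<in> L" "R' \<in> L" "x + R \<in> ?C" "x + R' \<in> ?C" for x R R'
  proof -
    have "cell_rep L (x + R) = cell_rep L (x + R')" using cell_rep_add that by metis
    then show ?thesis using cell_rep_eq that by simp
  qed
  have "{r \<in> ?C. cell_rep L (f r + v) \<in> B} = (\<Union>R\<in>L. ?X R)"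
  proof (intro Set.set_eqI iffI)
    fix r assume r: "r \<in> {r \<in> ?C. cell_rep L (f r + v) \<in> B}"
    have "T (f r + v - cell_rep L (f r + v)) r = cell_rep L (f r + v)" by (simp add: T_def)
    then have "r \<in> ?X (f r + v - cell_rep L (f r + v))" using r cell_rep_mem by simp
    then show "r \<in> (\<Union>R\<in>L. ?X R)" using diff_cell_rep_mem by blast
  next
    fix r assume "r \<in> (\<Union>R\<in>L. ?X R)"
    then obtain R where R: "R \<in> L" "r \<in> ?C" "T R r \<in> ?C" "T R r \<in> B" by auto
    have "cell_rep L (T R r + R) = T R r" using R cell_rep_add cell_rep_eq by simp
    then show "r \<in> {r \<in> ?C. cell_rep L (f r + v) \<in> B}" using R by (simp add: T_def)
  qed
  then have "emeasure lborel {r \<in> ?C. cell_rep L (f r + v) \<in> B} = (\<integral>\<^sup>+R. emeasure lborel (?X R) \<partial>count_space L)"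
  proof (simp only:, intro emeasure_UN_countable countable_lattice)
    show "?X R \<in> sets lborel" for R by measurable
    show "disjoint_family_on ?X L"
      unfolding disjoint_family_on_def
    proof (intro ballI impI)
      fix R R' assume R: "R \<in> L" "R' \<in> L" "R \<noteq> R'"
      show "?X R \<inter> ?X R' = {}"
        using unique[of "- R" "- R'" "f _ + v"] R lattice_uminus by (auto simp: T_def)
    qed
  qed
  also have "\<dots> = (\<integral>\<^sup>+R. emeasure lborel (?Y R) \<partial>count_space L)"
  proof (rule nn_integral_cong)
    fix R
    have "emeasure lborel (?Y R) = emeasure (distr lborel borel (T R)) (?Y R)" by (simp add: T_distr)
    also have "\<dots> = emeasure lborel (T R -` ?Y R)"
      by (subst emeasure_distr) (auto intro!: arg_cong[where f = "emeasure lborel"])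
    also have "T R -` ?Y R = ?X R" by (auto simp: ST)
    finally show "emeasure lborel (?X R) = emeasure lborel (?Y R)" by simp
  qed
  also have "\<dots> = emeasure lborel (\<Union>R\<in>L. ?Y R)"
  proof (rule emeasure_UN_countable[OF _ countable_lattice, symmetric])
    show "?Y R \<in> sets lborel" for R by measurable
    show "disjoint_family_on ?Y L"
      unfolding disjoint_family_on_def
    proof (intro ballI impI)
      fix R R' assume R: "R \<in> L" "R' \<in> L" "R \<noteq> R'"
      have False if "S R s \<in> ?C" "S R' s \<in> ?C" for s
      proof -
        have "g R = g R'" using unique[of "g R" "g R'" "S 0 s"] that R gL shift by metis
        then show False using R fg by metis
      qed
      then show "?Y R \<inter> ?Y R' = {}" by auto
    qed
  qed
  also have "(\<Union>R\<in>L. ?Y R) = ?C \<inter> B"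
  proof (intro Set.set_eqI iffI)
    fix s assume s: "s \<in> ?C \<inter> B"
    define R where "R = f (cell_rep L (S 0 s) - S 0 s)"
    have "cell_rep L (S 0 s) - S 0 s \<in> L"
      using lattice_uminus[OF diff_cell_rep_mem[of "S 0 s"]] by simp
    then have "R \<in> L" using fL by (auto simp: R_def)
    moreover have "S R s = cell_rep L (S 0 s)" using shift[of R s] by (simp add: R_def gf)
    ultimately show "s \<in> (\<Union>R\<in>L. ?Y R)" using s cell_rep_mem[of "S 0 s"] by (intro UN_I[of R]) simp_all
  qed auto
  finally show ?thesis .
qed

lemma AE_lattice_shifts:
  assumes "\<And>R. R \<in> L \<Longrightarrow> AE r in lborel. P R r"
  shows "AE r in lborel. \<forall>R\<in>L. P R r"
  using assms countable_lattice by (simp add: AE_ball_countable)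

text \<open>By \<open>emeasure_cell_transform\<close> the map followed by reduction into the cell
  preserves the measure of the cell. Since \<open>h\<close> is periodic only almost everywhere, the
  exceptional sets of all lattice shifts are first merged, which countability of the lattice
  allows.\<close>

lemma cell_integral_transform:
  fixes f :: "real^'n \<Rightarrow> real^'n" and h :: "real^'n \<Rightarrow> 'b::{banach, second_countable_topology}"
  assumes f: "orthogonal_transformation f" and fL: "f ` L = L"
    and h [measurable]: "h \<in> borel_measurable borel" and per: "\<And>R. R \<in> L \<Longrightarrow> AE r in lborel. h (r + R) = h r"
  shows "(LINT r:unit_cell L|lborel. h (f r + v)) = (LINT r:unit_cell L|lborel. h r)"
proof -
  let ?C = "unit_cell L" and ?M = "restrict_space lborel (unit_cell L)"
  note T = lborel_distr_orthogonal_affine[OF f, of v]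
  note [measurable] = T(2)
  let ?\<pi> = "\<lambda>r. cell_rep L (f r + v)"
  have C: "?C \<inter> space lborel \<in> sets lborel" by simp
  have meas: "g \<in> borel_measurable ?M" if "g \<in> borel_measurable borel" for g :: "real^'n \<Rightarrow> real^'n"
    using that by (intro measurable_restrict_space1) simp
  have \<pi> [measurable]: "?\<pi> \<in> borel_measurable borel" by measurable
  have eq: "distr ?M borel ?\<pi> = distr ?M borel (\<lambda>r. r)"
  proof (rule measure_eqI)
    fix B assume "B \<in> sets (distr ?M borel ?\<pi>)"
    then have B [measurable]: "B \<in> sets borel" by simp
    have "emeasure (distr ?M borel ?\<pi>) B = emeasure ?M (?\<pi> -` B \<inter> space ?M)"
      using meas[OF \<pi>] B by (rule emeasure_distr)
    also have "\<dots> = emeasure lborel (?\<pi> -` B \<inter> space ?M)"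
      by (rule emeasure_restrict_space[OF C]) (auto simp: space_restrict_space)
    also have "?\<pi> -` B \<inter> space ?M = {r \<in> ?C. ?\<pi> r \<in> B}" by (auto simp: space_restrict_space)
    also have "emeasure lborel \<dots> = emeasure lborel (?C \<inter> B)" by (rule emeasure_cell_transform[OF f fL B])
    also have "?C \<inter> B = (\<lambda>r. r) -` B \<inter> space ?M" by (auto simp: space_restrict_space)
    also have "emeasure lborel \<dots> = emeasure ?M \<dots>"
      by (rule emeasure_restrict_space[OF C, symmetric]) (auto simp: space_restrict_space)
    also have "\<dots> = emeasure (distr ?M borel (\<lambda>r. r)) B"
      by (rule emeasure_distr[OF meas B, symmetric]) simp
    finally show "emeasure (distr ?M borel ?\<pi>) B = emeasure (distr ?M borel (\<lambda>r. r)) B" .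
  qed simp
  have res: "(LINT r:?C|lborel. g r) = integral\<^sup>L ?M g" for g :: "real^'n \<Rightarrow> 'b"
    unfolding set_lebesgue_integral_def by (rule integral_restrict_space[OF C, symmetric])
  have "AE r in lborel. \<forall>R\<in>L. h (r + R) = h r" by (rule AE_lattice_shifts[OF per])
  then have "AE r in lborel. \<forall>R\<in>L. h (f r + v + R) = h (f r + v)"
    by (rule AE_lborel_transform[OF T])
  then have "AE r in lborel. h (f r + v) = h (?\<pi> r)"
  proof eventually_elim
    case (elim r)
    have "- (f r + v - ?\<pi> r) \<in> L" by (rule lattice_uminus[OF diff_cell_rep_mem])
    then have "h (f r + v + - (f r + v - ?\<pi> r)) = h (f r + v)" using elim by blast
    then show ?case by simp
  qed
  then have "(LINT r:?C|lborel. h (f r + v)) = (LINT r:?C|lborel. h (?\<pi> r))"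
    unfolding set_lebesgue_integral_def
  proof (intro integral_cong_AE)
    show "(\<lambda>r. indicat_real ?C r *\<^sub>R h (f r + v)) \<in> borel_measurable lborel"
      and "(\<lambda>r. indicat_real ?C r *\<^sub>R h (?\<pi> r)) \<in> borel_measurable lborel"
      by measurable
  qed (elim AE_mp, simp)
  also have "\<dots> = integral\<^sup>L (distr ?M borel ?\<pi>) h"
    unfolding res by (rule integral_distr[symmetric, OF meas[OF \<pi>] h])
  also have "\<dots> = integral\<^sup>L ?M h"
    unfolding eq by (rule integral_distr[OF meas h]) simp
  finally show ?thesis by (simp only: res)
qed

end

text \<open>The rows of the inverse basis matrix, times 2 pi, lie in the reciprocal lattice; pairing
  with them reads off the coordinates of a vector and shows that they are integers.\<close>

lemma reciprocal_reciprocal_lattice: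
  fixes BL :: "(real^'n) set"
  assumes "full_rank_lattice BL"
  shows "reciprocal_lattice (reciprocal_lattice BL) = BL"
proof
  show "BL \<subseteq> reciprocal_lattice (reciprocal_lattice BL)"
    unfolding reciprocal_lattice_def by (auto simp: inner_commute)
  let ?A = "lattice_basis BL" and ?B = "matrix_inv (lattice_basis BL)"
  show "reciprocal_lattice (reciprocal_lattice BL) \<subseteq> BL"
  proof
    fix x assume x: "x \<in> reciprocal_lattice (reciprocal_lattice BL)"
    have "(?B *v x) $ i \<in> \<int>" for i
    proof -
      define K where "K = (2 * pi) *\<^sub>R row i ?B"
      have row: "row i ?B \<bullet> y = (?B *v y) $ i" for y
        by (simp add: matrix_vector_mult_def row_def inner_vec_def)
      have "K \<in> reciprocal_lattice BL"
        unfolding reciprocal_lattice_def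
      proof (intro CollectI ballI)
        fix R assume "R \<in> BL"
        then have "(?B *v R) $ i \<in> \<int>" using mem_lattice_iff[OF assms] by blast
        then show "\<exists>m. K \<bullet> R = 2 * pi * of_int m" by (auto simp: K_def row elim!: Ints_cases)
      qed
      then obtain m :: int where "x \<bullet> K = 2 * pi * of_int m"
        using x unfolding reciprocal_lattice_def by blast
      then have "(?B *v x) $ i = of_int m" by (simp add: K_def row inner_commute[of x])
      then show ?thesis by simp
    qed
    then show "x \<in> BL" using mem_lattice_iff[OF assms] by blast
  qed
qed

section \<open>Bloch functions as elements of a Hilbert space\<close>

text \<open>The guard makes the lift total, since cutting off by a non-measurable set would destroy
  measurability. The map serves as a projection onto the functions supported in the cell.\<close>

lift_definition restrict_l2 :: "'a::euclidean_space set \<Rightarrow> 'a l2 \<Rightarrow> 'a l2" is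
  "\<lambda>S f x. indicat_real (if S \<in> sets borel then S else {}) x *\<^sub>R f x"
proof -
  fix S :: "'a set" and f g :: "'a \<Rightarrow> complex"
  assume rel: "l2_rel f g"
  let ?S = "if S \<in> sets borel then S else {}"
  have S: "?S \<in> sets borel" by simp
  have sq: "square_integrable (\<lambda>x. indicat_real ?S x *\<^sub>R h x)" if h: "square_integrable h" for h
  proof (rule square_integrable_bound[OF h, where B = 1])
    show "(\<lambda>x. indicat_real ?S x *\<^sub>R h x) \<in> borel_measurable borel"
      using square_integrable_measurable[OF h] S by (intro borel_measurable_scaleR borel_measurable_indicator)
  qed (auto simp: indicator_def)
  have "AE x in lborel. f x = g x" using rel by (simp add: l2_rel_def)
  then have "AE x in lborel. indicat_real ?S x *\<^sub>R f x = indicat_real ?S x *\<^sub>R g x"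
    by eventually_elim simp
  then show "l2_rel (\<lambda>x. indicat_real ?S x *\<^sub>R f x) (\<lambda>x. indicat_real ?S x *\<^sub>R g x)"
    using rel sq unfolding l2_rel_def by blast
qed

lemma l2_exists_rep: "\<exists>f. square_integrable f \<and> x = abs_l2 f"
proof -
  have "l2_rel (rep_l2 x) (rep_l2 x)" "abs_l2 (rep_l2 x) = x"
    by (rule Quotient_rep_reflp[OF Quotient_l2], rule Quotient_abs_rep[OF Quotient_l2])
  then show ?thesis unfolding l2_rel_def by metis
qed

lemma restrict_l2_abs:
  assumes "S \<in> sets borel" "square_integrable f"
  shows "restrict_l2 S (abs_l2 f) = to_l2 S f"
  using assms by (subst restrict_l2.abs_eq) (auto simp: l2_rel_def to_l2_def)

lemma square_integrable_imp_on: "S \<in> sets borel \<Longrightarrow> square_integrable f \<Longrightarrow> square_integrable_on S f"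
  unfolding square_integrable_def square_integrable_on_def
  by (simp add: set_integrable_def integrable_mult_indicator del: real_scaleR_def)

lemma to_l2_indicator: "to_l2 S (\<lambda>x. indicat_real S x *\<^sub>R u x) = to_l2 S u"
  unfolding to_l2_def by (rule arg_cong[where f = abs_l2]) (auto simp: indicator_def)

lemma restrict_l2_to_l2:
  assumes S: "S \<in> sets borel" and u: "square_integrable_on S u"
  shows "restrict_l2 S (to_l2 S u) = to_l2 S u"
proof -
  have "restrict_l2 S (to_l2 S u) = to_l2 S (\<lambda>x. indicat_real S x *\<^sub>R u x)"
    unfolding to_l2_def[of S u] by (rule restrict_l2_abs[OF S square_integrable_indicator[OF S u]])
  then show ?thesis by (simp add: to_l2_indicator)
qed

lemma bounded_linear_restrict_l2:
  assumes S: "S \<in> sets borel"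
  shows "bounded_linear (restrict_l2 S)"
proof (rule bounded_linear_intro[where K = 1])
  fix x y :: "'a l2" and r :: real
  obtain f where f: "square_integrable f" "x = abs_l2 f" using l2_exists_rep by blast
  obtain g where g: "square_integrable g" "y = abs_l2 g" using l2_exists_rep by blast
  have xy: "x + y = abs_l2 (\<lambda>x. f x + g x)"
    unfolding f g by (rule plus_l2.abs_eq) (simp_all add: l2_rel_def f g)
  have rx: "r *\<^sub>R x = abs_l2 (\<lambda>x. of_real r * f x)"
    unfolding f by (rule scaleR_l2.abs_eq) (simp add: l2_rel_def f)
  show "restrict_l2 S (x + y) = restrict_l2 S x + restrict_l2 S y"
    unfolding xy unfolding f(2) g(2)
    by (simp add: restrict_l2_abs[OF S] square_integrable_add f(1) g(1) to_l2_add[OF S] square_integrable_imp_on[OF S])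
  show "restrict_l2 S (r *\<^sub>R x) = r *\<^sub>R restrict_l2 S x"
    unfolding rx unfolding f(2)
    by (simp add: restrict_l2_abs[OF S] square_integrable_cmult f(1) to_l2_cmult[OF S] square_integrable_imp_on[OF S] cscale_scaleR)
  have "norm (restrict_l2 S x) = norm (to_l2 S f)" by (simp add: f restrict_l2_abs[OF S])
  also have "\<dots> = norm (to_l2 UNIV (\<lambda>x. indicat_real S x *\<^sub>R f x))" by (simp add: to_l2_def)
  also have "\<dots> \<le> 1 * norm (to_l2 UNIV f)"
    using f(1) S by (intro norm_to_l2_le) (auto simp: square_integrable_imp_on indicator_def
      intro!: borel_measurable_scaleR borel_measurable_indicator dest: square_integrable_measurable)
  also have "to_l2 UNIV f = x" by (simp add: to_l2_def f)
  finally show "norm (restrict_l2 S x) \<le> norm x * 1" by simp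
qed

section \<open>Plane waves and Bloch functions\<close>

lemma plane_wave_measurable [measurable]: "plane_wave k \<in> borel_measurable borel"
  unfolding plane_wave_def
  by (intro borel_measurable_continuous_onI continuous_intros)

lemma cmod_plane_wave [simp]: "cmod (plane_wave k r) = 1"
  unfolding plane_wave_def by (simp add: norm_exp_i_times)

lemma plane_wave_add_left: "plane_wave (k + k') r = plane_wave k r * plane_wave k' r"
  and plane_wave_add_right: "plane_wave k (r + r') = plane_wave k r * plane_wave k r'"
  unfolding plane_wave_def by (simp_all add: inner_add_left inner_add_right distrib_left exp_add)

lemma plane_wave_zero [simp]: "plane_wave 0 r = 1" "plane_wave k 0 = 1"
  by (simp_all add: plane_wave_def)

lemma cnj_plane_wave: "cnj (plane_wave k r) = plane_wave (- k) r"
  unfolding plane_wave_def by (simp add: exp_cnj)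

lemma plane_wave_uminus_right: "plane_wave k (- r) = plane_wave (- k) r"
  by (simp add: plane_wave_def)

lemma plane_wave_cancel [simp]: "plane_wave (- k) r * plane_wave k r = 1" "plane_wave k r * plane_wave (- k) r = 1"
  using plane_wave_add_left[of k "- k" r] by (simp_all add: mult.commute)

lemma plane_wave_reciprocal:
  assumes "K \<in> reciprocal_lattice BL" "R \<in> BL"
  shows "plane_wave K R = 1"
proof -
  obtain m :: int where "K \<bullet> R = 2 * pi * of_int m" using assms unfolding reciprocal_lattice_def by blast
  then have "plane_wave K R = exp (2 * of_int m * pi * \<i>)" by (simp add: plane_wave_def ac_simps)
  also have "\<dots> = 1" by (subst exp_eq_1) auto
  finally show ?thesis .
qed

lemma lborel_distr_plus_right: "distr lborel borel (\<lambda>r. r + c) = (lborel :: 'a::euclidean_space measure)"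
  using lborel_distr_plus[of c] by (simp add: add.commute[of _ c])

lemma bloch_functions_0: "bloch_functions BL 0 = L2_torus BL"
  by (simp add: bloch_functions_def L2_torus_def)

lemma locally_square_integrable_mult_bounded:
  assumes "locally_square_integrable f" "m \<in> borel_measurable borel" "\<And>r. cmod (m r) \<le> B"
  shows "locally_square_integrable (\<lambda>r. m r * f r)"
  unfolding locally_square_integrable_def
proof (intro conjI allI impI)
  have f: "f \<in> borel_measurable borel" using assms(1) by (simp add: locally_square_integrable_def)
  then show mf: "(\<lambda>r. m r * f r) \<in> borel_measurable lborel" using assms(2) by simp
  fix C :: "(real^'a) set" assume C: "compact C"
  then have "set_integrable lborel C (\<lambda>r. (cmod (f r))\<^sup>2)"
    using assms(1) by (simp add: locally_square_integrable_def)
  then have "set_integrable lborel C (\<lambda>r. B\<^sup>2 * (cmod (f r))\<^sup>2)" by (rule set_integrable_mult_right[rotated]) 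
  then show "set_integrable lborel C (\<lambda>r. (cmod (m r * f r))\<^sup>2)"
  proof (rule set_integrable_bound)
    show "set_borel_measurable lborel C (\<lambda>r. (cmod (m r * f r))\<^sup>2)"
      unfolding set_borel_measurable_def using mf compact_imp_closed[OF C]
      by (intro borel_measurable_scaleR borel_measurable_indicator borel_measurable_power borel_measurable_norm) auto
    have "(cmod (m r * f r))\<^sup>2 \<le> B\<^sup>2 * (cmod (f r))\<^sup>2" for r
      using power_mono[OF assms(3)[of r], of 2] by (simp add: norm_mult power_mult_distrib mult_right_mono)
    then show "AE r in lborel. r \<in> C \<longrightarrow> norm ((cmod (m r * f r))\<^sup>2) \<le> norm (B\<^sup>2 * (cmod (f r))\<^sup>2)"
      by simp
  qed
qed

lemma bloch_functions_mult:
  assumes f: "f \<in> bloch_functions BL k" and m: "m \<in> borel_measurable borel" "\<And>r. cmod (m r) \<le> B"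
    and per: "\<And>R r. R \<in> BL \<Longrightarrow> m (r + R) = plane_wave q R * m r"
  shows "(\<lambda>r. m r * f r) \<in> bloch_functions BL (k + q)"
  unfolding bloch_functions_def
proof (intro CollectI conjI ballI)
  show "locally_square_integrable (\<lambda>r. m r * f r)"
    using f m by (intro locally_square_integrable_mult_bounded) (auto simp: bloch_functions_def)
  fix R assume R: "R \<in> BL"
  then have "AE r in lborel. f (r + R) = plane_wave k R * f r" using f by (auto simp: bloch_functions_def)
  then show "AE r in lborel. m (r + R) * f (r + R) = plane_wave (k + q) R * (m r * f r)"
    by eventually_elim (simp add: per[OF R] plane_wave_add_left ac_simps)
qed

lemma bloch_functions_plane_wave:
  "f \<in> bloch_functions BL k \<Longrightarrow> (\<lambda>r. plane_wave q r * f r) \<in> bloch_functions BL (k + q)"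
  by (rule bloch_functions_mult[where B = 1]) (auto simp: plane_wave_add_right mult.commute)

lemma bloch_functions_cmult:
  "f \<in> bloch_functions BL k \<Longrightarrow> (\<lambda>r. c * f r) \<in> bloch_functions BL k"
  using bloch_functions_mult[where m = "\<lambda>r. c" and q = 0 and B = "cmod c" and k = k] by simp

lemma bloch_functions_L2_torus:
  "f \<in> bloch_functions BL k \<Longrightarrow> (\<lambda>r. plane_wave (- k) r * f r) \<in> L2_torus BL"
  using bloch_functions_plane_wave[of f BL k "- k"] by (simp add: bloch_functions_0)

lemma has_sum_iff_norm: "(f has_sum (s::'b::real_normed_vector)) UNIV \<longleftrightarrow> ((\<lambda>F. norm (s - sum f F)) \<longlongrightarrow> 0) (finite_subsets_at_top UNIV)"
proof -
  have "(f has_sum s) UNIV \<longleftrightarrow> ((\<lambda>F. norm (sum f F - s)) \<longlongrightarrow> 0) (finite_subsets_at_top UNIV)"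
    unfolding has_sum_def tendsto_norm_zero_iff LIM_zero_iff ..
  then show ?thesis by (simp add: norm_minus_commute)
qed

section \<open>Embedding Bloch functions into the Hilbert space through the unit cell\<close>

context
  fixes BL :: "(real^'n) set"
  assumes BL: "full_rank_lattice BL"
begin

abbreviation emb :: "(real^'n \<Rightarrow> complex) \<Rightarrow> (real^'n) l2" where
  "emb u \<equiv> to_l2 (unit_cell BL) u"

lemmas cell_borel = unit_cell_borel[OF BL]

lemma bloch_square_integrable_on:
  assumes "f \<in> bloch_functions BL k"
  shows "square_integrable_on (unit_cell BL) f"
proof -
  obtain a where a: "unit_cell BL \<subseteq> cbox (-a) a"
    using bounded_unit_cell[OF BL] bounded_subset_cbox_symmetric by blast
  have "locally_square_integrable f" using assms by (simp add: bloch_functions_def)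
  then have "f \<in> borel_measurable borel" "set_integrable lborel (cbox (-a) a) (\<lambda>r. (cmod (f r))\<^sup>2)"
    by (simp_all add: locally_square_integrable_def)
  then show ?thesis
    unfolding square_integrable_on_def using cell_borel a by (auto intro: set_integrable_subset)
qed

lemma L2_torus_square_integrable_on: "u \<in> L2_torus BL \<Longrightarrow> square_integrable_on (unit_cell BL) u"
  using bloch_square_integrable_on[of u 0] by (simp add: bloch_functions_0)

lemma cell_norm_eq: "square_integrable_on (unit_cell BL) u \<Longrightarrow> cell_norm BL u = norm (emb u)"
  unfolding cell_norm_def by (simp add: norm_to_l2[OF cell_borel])

lemma cell_inner_eq:
  "square_integrable_on (unit_cell BL) u \<Longrightarrow> square_integrable_on (unit_cell BL) v \<Longrightarrow> cell_inner BL u v = cinner (emb u) (emb v)"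
  unfolding cell_inner_def by (simp add: cinner_to_l2[OF cell_borel])

lemma bloch_AE_shifts:
  assumes "f \<in> bloch_functions BL k"
  shows "AE r in lborel. \<forall>R\<in>BL. f (r + R) = plane_wave k R * f r"
  using assms by (intro AE_lattice_shifts[OF BL]) (auto simp: bloch_functions_def)

lemma AE_translate:
  assumes "AE r in lborel. P r"
  shows "AE r in lborel. P (r + R :: real^'n)"
proof (rule AE_lborel_transform[OF _ _ assms])
  show "distr lborel borel (\<lambda>r. r + R) = (lborel :: (real^'n) measure)"
    by (rule lborel_distr_plus_right)
qed simp

lemma bloch_AE_eqI:
  assumes f: "f \<in> bloch_functions BL k" and g: "g \<in> bloch_functions BL k"
    and eq: "AE r in lborel. r \<in> unit_cell BL \<longrightarrow> f r = g r"
  shows "AE r in lborel. f r = g r"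
proof -
  have "AE r in lborel. \<forall>R\<in>BL. r + R \<in> unit_cell BL \<longrightarrow> f (r + R) = g (r + R)"
    by (intro AE_lattice_shifts[OF BL] AE_translate[OF eq])
  with bloch_AE_shifts[OF f] bloch_AE_shifts[OF g] show ?thesis
  proof eventually_elim
    case (elim r)
    let ?R = "- (r - cell_rep BL r)"
    have R: "?R \<in> BL" by (intro lattice_uminus[OF BL] diff_cell_rep_mem[OF BL])
    have "r + ?R \<in> unit_cell BL" using cell_rep_mem[OF BL] by simp
    then have "f (r + ?R) = g (r + ?R)" using elim(3) R by blast
    then have "plane_wave k ?R * f r = plane_wave k ?R * g r"
      using bspec[OF elim(1) R] bspec[OF elim(2) R] by simp
    moreover have "plane_wave k ?R \<noteq> 0" using cmod_plane_wave[of k ?R] by (metis norm_zero zero_neq_one)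
    ultimately show ?case by simp
  qed
qed

lemma bloch_emb_eq_iff:
  assumes f: "f \<in> bloch_functions BL k" and g: "g \<in> bloch_functions BL k"
  shows "emb f = emb g \<longleftrightarrow> (AE r in lborel. f r = g r)"
proof
  note sf = bloch_square_integrable_on[OF f] and sg = bloch_square_integrable_on[OF g]
  assume "AE r in lborel. f r = g r"
  then have "AE r in lborel. r \<in> unit_cell BL \<longrightarrow> f r = g r" by eventually_elim simp
  then show "emb f = emb g" by (rule to_l2_eqI[OF cell_borel sf sg])
next
  note sf = bloch_square_integrable_on[OF f] and sg = bloch_square_integrable_on[OF g]
  let ?f = "\<lambda>x. indicat_real (unit_cell BL) x *\<^sub>R f x" and ?g = "\<lambda>x. indicat_real (unit_cell BL) x *\<^sub>R g x"
  assume "emb f = emb g"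
  then have "abs_l2 ?f = abs_l2 ?g" unfolding to_l2_def .
  then have "l2_rel ?f ?f \<and> l2_rel ?g ?g \<and> abs_l2 ?f = abs_l2 ?g"
    using square_integrable_indicator[OF cell_borel sf] square_integrable_indicator[OF cell_borel sg]
    by (simp add: l2_rel_def)
  then have "l2_rel ?f ?g" by (rule iffD1[OF Quotient_rel[OF Quotient_l2]])
  then have "AE r in lborel. indicat_real (unit_cell BL) r *\<^sub>R f r = indicat_real (unit_cell BL) r *\<^sub>R g r"
    by (simp add: l2_rel_def)
  then have "AE r in lborel. r \<in> unit_cell BL \<longrightarrow> f r = g r"
    by eventually_elim (auto simp: indicator_def)
  then show "AE r in lborel. f r = g r" by (rule bloch_AE_eqI[OF f g])
qed

text \<open>Values on the cell extend by the Bloch condition. Local square-integrability is the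
  point to check: a compact set is covered by finitely many lattice translates of the cell, and on
  each translate the modulus is a shifted copy of that of \<open>u\<close>.\<close>

lemma bloch_extension:
  assumes u: "square_integrable_on (unit_cell BL) u"
  shows "(\<lambda>r. plane_wave k (r - cell_rep BL r) * u (cell_rep BL r)) \<in> bloch_functions BL k" (is "?f \<in> _")
    and "emb (\<lambda>r. plane_wave k (r - cell_rep BL r) * u (cell_rep BL r)) = emb u"
proof -
  note [measurable] = cell_rep_measurable[OF BL] cell_borel
  have um [measurable]: "u \<in> borel_measurable borel" using u by (simp add: square_integrable_on_def)
  have "(\<lambda>r. r - cell_rep BL r) \<in> borel_measurable borel" by (intro borel_measurable_diff) simp_all
  from measurable_compose[OF this plane_wave_measurable[of k]] measurable_compose[OF cell_rep_measurable[OF BL] um]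
  have fm [measurable]: "?f \<in> borel_measurable borel" by (rule borel_measurable_times)
  have f_add: "?f (r + R) = plane_wave k R * ?f r" if "R \<in> BL" for r R
  proof -
    have "r + R - cell_rep BL (r + R) = R + (r - cell_rep BL r)" using that by (simp add: cell_rep_add[OF BL])
    then show ?thesis using that by (simp only: plane_wave_add_right cell_rep_add[OF BL] mult.assoc)
  qed
  have "set_integrable lborel S (\<lambda>r. (cmod (?f r))\<^sup>2)" if S: "compact S" for S
  proof -
    let ?C = "unit_cell BL"
    \<comment> \<open>These are the lattice vectors whose translate of the cell meets
      \<open>S\<close>.\<close>
    define F where "F = BL \<inter> (\<lambda>(x, y). x - y) ` (S \<times> ?C)"
    have fin: "finite F" unfolding F_def
      by (rule finite_lattice_bounded[OF BL bounded_minus[OF compact_imp_bounded[OF S] bounded_unit_cell[OF BL]]])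
    have gm: "(\<lambda>r. indicat_real ?C r *\<^sub>R (cmod (u r))\<^sup>2) \<in> borel_measurable borel"
      by (intro borel_measurable_scaleR borel_measurable_indicator borel_measurable_power borel_measurable_norm um cell_borel) simp
    have int: "set_integrable lborel ((\<lambda>r. r + R) ` ?C) (\<lambda>r. (cmod (?f r))\<^sup>2)" if R: "R \<in> F" for R
    proof -
      have "integrable lborel (\<lambda>r. indicat_real ?C r *\<^sub>R (cmod (u r))\<^sup>2)"
        using u by (simp add: square_integrable_on_def set_integrable_def)
      then have "integrable (distr lborel borel (\<lambda>r. r + - R)) (\<lambda>r. indicat_real ?C r *\<^sub>R (cmod (u r))\<^sup>2)"
        unfolding lborel_distr_plus_right .
      then have "integrable lborel (\<lambda>r. indicat_real ?C (r + - R) *\<^sub>R (cmod (u (r + - R)))\<^sup>2)"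
        by (rule iffD1[OF integrable_distr_eq[OF _ gm], rotated]) simp
      moreover have "indicat_real ?C (r + - R) *\<^sub>R (cmod (u (r + - R)))\<^sup>2 =
          indicat_real ((\<lambda>r. r + R) ` ?C) r *\<^sub>R (cmod (?f r))\<^sup>2" for r
      proof (cases "r - R \<in> ?C")
        case True
        have "cell_rep BL r = r - R"
          using R cell_rep_add[OF BL, of R "r - R"] cell_rep_eq[OF BL True] by (simp add: F_def)
        moreover have "r \<in> (\<lambda>r. r + R) ` ?C" using True by (intro image_eqI[of _ _ "r - R"]) auto
        ultimately show ?thesis using True by (simp add: norm_mult)
      next
        case False
        then have "r \<notin> (\<lambda>r. r + R) ` ?C" by auto
        then show ?thesis using False by simp
      qed
      ultimately show ?thesis unfolding set_integrable_def by simp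
    qed
    have meas: "(\<lambda>r. r + R) ` ?C \<in> sets borel" for R
    proof -
      have "(\<lambda>r. r + R) ` ?C = (\<lambda>r. r - R) -` ?C \<inter> space borel"
      proof (intro Set.set_eqI iffI)
        fix r assume "r \<in> (\<lambda>r. r - R) -` ?C \<inter> space borel"
        then show "r \<in> (\<lambda>r. r + R) ` ?C" by (intro image_eqI[of _ _ "r - R"]) auto
      qed auto
      also have "\<dots> \<in> sets borel" by (rule measurable_sets[OF _ cell_borel]) simp
      finally show ?thesis .
    qed
    have un: "set_integrable lborel (\<Union>R\<in>F. (\<lambda>r. r + R) ` ?C) (\<lambda>r. (cmod (?f r))\<^sup>2)"
      using fin int meas by (intro set_integrable_UN) auto
    have sub: "S \<subseteq> (\<Union>R\<in>F. (\<lambda>r. r + R) ` ?C)"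
    proof
      fix r assume r: "r \<in> S"
      have "r - cell_rep BL r \<in> F" using r diff_cell_rep_mem[OF BL, of r] cell_rep_mem[OF BL, of r]
        unfolding F_def by (intro IntI image_eqI[of _ _ "(r, cell_rep BL r)"]) simp_all
      moreover have "r \<in> (\<lambda>x. x + (r - cell_rep BL r)) ` ?C"
        using cell_rep_mem[OF BL, of r] by (intro image_eqI[of _ _ "cell_rep BL r"]) simp_all
      ultimately show "r \<in> (\<Union>R\<in>F. (\<lambda>r. r + R) ` ?C)" by blast
    qed
    show ?thesis
      by (rule set_integrable_subset[OF un _ sub]) (simp add: compact_imp_closed[OF S] borel_closed)
  qed
  then show f: "?f \<in> bloch_functions BL k"
    unfolding bloch_functions_def locally_square_integrable_def using f_add fm by simp
  show "emb ?f = emb u"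
    by (rule to_l2_eqI[OF cell_borel bloch_square_integrable_on[OF f] u]) (auto simp: cell_rep_eq[OF BL])
qed

lemma restrict_l2_torus: "\<exists>u\<in>L2_torus BL. emb u = restrict_l2 (unit_cell BL) x"
proof -
  obtain f where f: "square_integrable f" "x = abs_l2 f" using l2_exists_rep by blast
  have "square_integrable_on (unit_cell BL) f" by (rule square_integrable_imp_on[OF cell_borel f(1)])
  from bloch_extension[OF this, of 0] show ?thesis
    unfolding f(2) restrict_l2_abs[OF cell_borel f(1)] bloch_functions_0 by blast
qed

lemma L2_continuous_iff:
  assumes "\<And>k. u k \<in> L2_torus BL"
  shows "L2_continuous BL u \<longleftrightarrow> (\<forall>k0. isCont (\<lambda>k. emb (u k)) k0)"
proof -
  note s = L2_torus_square_integrable_on[OF assms]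
  have "cell_norm BL (\<lambda>r. u k r - u k0 r) = norm (emb (u k) - emb (u k0))" for k k0
    by (simp add: cell_norm_eq square_integrable_on_diff[OF cell_borel] s to_l2_diff[OF cell_borel])
  then show ?thesis unfolding L2_continuous_def isCont_def by (simp only: tendsto_norm_zero_iff LIM_zero_iff)
qed

lemma cell_norm_partial_sum:
  assumes "u \<in> L2_torus BL" "\<And>\<alpha>. a \<alpha> \<in> L2_torus BL"
  shows "cell_norm BL (\<lambda>r. u r - (\<Sum>\<alpha>\<in>F. of_real (m \<alpha>) * a \<alpha> r)) = norm (emb u - (\<Sum>\<alpha>\<in>F. m \<alpha> *\<^sub>R emb (a \<alpha>)))"
proof -
  note s = L2_torus_square_integrable_on[OF assms(1)] L2_torus_square_integrable_on[OF assms(2)]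
  have c: "square_integrable_on (unit_cell BL) (\<lambda>r. of_real (m \<alpha>) * a \<alpha> r)" for \<alpha>
    by (intro square_integrable_on_cmult[OF cell_borel] s)
  show ?thesis
    by (simp add: cell_norm_eq square_integrable_on_diff[OF cell_borel] s c square_integrable_on_sum[OF cell_borel]
        to_l2_diff[OF cell_borel] to_l2_sum[OF cell_borel] to_l2_cmult[OF cell_borel] cscale_scaleR)
qed

text \<open>For the backward direction the coefficients are arbitrary elements of \<open>l2\<close>,
  whereas the definition asks for periodic functions. Restriction to the cell is bounded and linear,
  hence commutes with the sum, and it fixes the embedded values; the restricted coefficients then
  come from periodic functions by \<open>restrict_l2_torus\<close>.\<close>

lemma L2_analytic_iff:
  assumes u: "\<And>k. u k \<in> L2_torus BL"
  shows "L2_analytic BL u \<longleftrightarrow> (\<forall>k0. real_analytic_at (\<lambda>k. emb (u k)) k0)"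
proof
  assume an: "L2_analytic BL u"
  show "\<forall>k0. real_analytic_at (\<lambda>k. emb (u k)) k0"
  proof
    fix k0 :: "real^'n"
    obtain e a where e: "e > 0" "\<And>\<alpha>. a \<alpha> \<in> L2_torus BL" and lim: "\<And>k. k \<in> ball k0 e \<Longrightarrow>
        ((\<lambda>F. cell_norm BL (\<lambda>r. u k r - (\<Sum>\<alpha>\<in>F. of_real (monomial (k - k0) \<alpha>) * a \<alpha> r))) \<longlongrightarrow> 0) (finite_subsets_at_top UNIV)"
      using an[unfolded L2_analytic_def, rule_format, of k0] by blast
    have "\<exists>r. has_power_series (\<lambda>k. emb (u k)) k0 r (\<lambda>\<alpha>. emb (a \<alpha>))"
    proof (rule real_analytic_atI[OF e(1)])
      fix k assume "k \<in> ball k0 e"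
      from lim[OF this] show "((\<lambda>\<alpha>. monomial (k - k0) \<alpha> *\<^sub>R emb (a \<alpha>)) has_sum emb (u k)) UNIV"
        unfolding has_sum_iff_norm cell_norm_partial_sum[OF u e(2)] .
    qed
    then show "real_analytic_at (\<lambda>k. emb (u k)) k0" unfolding real_analytic_at_def by blast
  qed
next
  assume an: "\<forall>k0. real_analytic_at (\<lambda>k. emb (u k)) k0"
  show "L2_analytic BL u"
    unfolding L2_analytic_def
  proof
    fix k0 :: "real^'n"
    obtain e a where e: "e > 0"
      and sum: "\<And>k. k \<in> ball k0 e \<Longrightarrow> ((\<lambda>\<alpha>. monomial (k - k0) \<alpha> *\<^sub>R a \<alpha>) has_sum emb (u k)) UNIV"
      using real_analytic_at_ball[OF an[rule_format, of k0]] by blast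
    note rl = bounded_linear_restrict_l2[OF cell_borel]
    have "\<forall>\<alpha>. \<exists>b\<in>L2_torus BL. emb b = restrict_l2 (unit_cell BL) (a \<alpha>)"
      using restrict_l2_torus by blast
    then have "\<forall>\<alpha>. \<exists>b. b \<in> L2_torus BL \<and> emb b = restrict_l2 (unit_cell BL) (a \<alpha>)" unfolding Bex_def .
    from choice[OF this] obtain b where b: "\<And>\<alpha>. b \<alpha> \<in> L2_torus BL" "\<And>\<alpha>. emb (b \<alpha>) = restrict_l2 (unit_cell BL) (a \<alpha>)"
      by blast
    have "((\<lambda>F. cell_norm BL (\<lambda>r. u k r - (\<Sum>\<alpha>\<in>F. of_real (monomial (k - k0) \<alpha>) * b \<alpha> r))) \<longlongrightarrow> 0) (finite_subsets_at_top UNIV)"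
      if k: "k \<in> ball k0 e" for k
    proof -
      have "((\<lambda>\<alpha>. restrict_l2 (unit_cell BL) (monomial (k - k0) \<alpha> *\<^sub>R a \<alpha>)) has_sum restrict_l2 (unit_cell BL) (emb (u k))) UNIV"
        by (rule has_sum_bounded_linear[OF rl sum[OF k], unfolded o_def])
      then have "((\<lambda>\<alpha>. monomial (k - k0) \<alpha> *\<^sub>R emb (b \<alpha>)) has_sum emb (u k)) UNIV"
        by (simp add: restrict_l2_to_l2[OF cell_borel L2_torus_square_integrable_on[OF u]] b
            linear_scale[OF bounded_linear.linear[OF rl]])
      then show ?thesis unfolding has_sum_iff_norm cell_norm_partial_sum[OF u b(1)] .
    qed
    then show "\<exists>\<epsilon>>0. \<exists>a. (\<forall>\<alpha>. a \<alpha> \<in> L2_torus BL) \<and> (\<forall>k\<in>ball k0 \<epsilon>.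
        ((\<lambda>F. cell_norm BL (\<lambda>r. u k r - (\<Sum>\<alpha>\<in>F. of_real (monomial (k - k0) \<alpha>) * a \<alpha> r))) \<longlongrightarrow> 0) (finite_subsets_at_top UNIV))"
      using e b(1) by blast
  qed
qed

text \<open>Convergence in operator norm gives convergence on the fixed vector \<open>u\<close>,
  with the coefficient operators applied to \<open>u\<close> as new coefficients.\<close>

lemma operator_analytic_apply:
  assumes an: "operator_analytic BL Q" and u: "u \<in> L2_torus BL" and Q: "\<And>k. Q k u \<in> L2_torus BL"
  shows "real_analytic_at (\<lambda>k. emb (Q k u)) k0"
proof -
  obtain e A where e: "e > 0" "\<And>\<alpha>. L2_bounded_operator BL (A \<alpha>)"
    and ev: "\<And>k \<delta>. k \<in> ball k0 e \<Longrightarrow> \<delta> > 0 \<Longrightarrow> \<forall>\<^sub>F F in finite_subsets_at_top UNIV. \<forall>u\<in>L2_torus BL.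
      cell_norm BL (\<lambda>r. Q k u r - (\<Sum>\<alpha>\<in>F. of_real (monomial (k - k0) \<alpha>) * A \<alpha> u r)) \<le> \<delta> * cell_norm BL u"
    using an[unfolded operator_analytic_def, rule_format, of k0] by blast
  have Au: "A \<alpha> u \<in> L2_torus BL" for \<alpha> using e(2) u unfolding L2_bounded_operator_def by blast
  \<comment> \<open>Adding 1 keeps the divisor positive even if \<open>u\<close> has norm
    zero.\<close>
  define c where "c = cell_norm BL u + 1"
  have c: "c > 0" "cell_norm BL u < c"
    using norm_ge_zero[of "emb u"] by (auto simp: c_def cell_norm_eq[OF L2_torus_square_integrable_on[OF u]] intro: add_nonneg_pos)
  have "\<exists>r. has_power_series (\<lambda>k. emb (Q k u)) k0 r (\<lambda>\<alpha>. emb (A \<alpha> u))"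
  proof (rule real_analytic_atI[OF e(1)])
    fix k assume k: "k \<in> ball k0 e"
    show "((\<lambda>\<alpha>. monomial (k - k0) \<alpha> *\<^sub>R emb (A \<alpha> u)) has_sum emb (Q k u)) UNIV"
      unfolding has_sum_iff_norm tendsto_iff
    proof (intro allI impI)
      fix \<delta> :: real assume \<delta>: "\<delta> > 0"
      then have "\<delta> / c > 0" using c by simp
      from ev[OF k this] show "\<forall>\<^sub>F F in finite_subsets_at_top UNIV.
          dist (norm (emb (Q k u) - (\<Sum>\<alpha>\<in>F. monomial (k - k0) \<alpha> *\<^sub>R emb (A \<alpha> u)))) 0 < \<delta>"
      proof eventually_elim
        case (elim F)
        have "norm (emb (Q k u) - (\<Sum>\<alpha>\<in>F. monomial (k - k0) \<alpha> *\<^sub>R emb (A \<alpha> u))) \<le> \<delta> / c * cell_norm BL u"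
          using bspec[OF elim u] unfolding cell_norm_partial_sum[OF Q Au] .
        also have "\<dots> < \<delta> / c * c" using c \<delta> by (intro mult_strict_left_mono) auto
        finally show ?case using c by simp
      qed
    qed
  qed
  then show ?thesis unfolding real_analytic_at_def by blast
qed

end

section \<open>Analyticity of plane wave factors\<close>

text \<open>The Taylor coefficients at 0 of \<open>plane_wave\<close> as a function of its
  wavevector.\<close>

definition exp_coeff :: "real^'n \<Rightarrow> ('n \<Rightarrow> nat) \<Rightarrow> complex" where
  "exp_coeff y \<alpha> = (\<Prod>i\<in>UNIV. (\<i> * of_real (y $ i)) ^ \<alpha> i / fact (\<alpha> i))"

lemma monomial_exp_coeff:
  "monomial x \<alpha> *\<^sub>R exp_coeff y \<alpha> = (\<Prod>i\<in>UNIV. (\<i> * of_real (x $ i * y $ i)) ^ \<alpha> i / fact (\<alpha> i))"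
  unfolding monomial_def exp_coeff_def scaleR_conv_of_real of_real_prod prod.distrib[symmetric]
  by (rule prod.cong) (simp_all add: power_mult_distrib)

lemma norm_monomial_exp_coeff:
  "norm (monomial x \<alpha> *\<^sub>R exp_coeff y \<alpha>) = (\<Prod>i\<in>UNIV. \<bar>x $ i * y $ i\<bar> ^ \<alpha> i / fact (\<alpha> i))"
  unfolding monomial_exp_coeff by (simp add: prod_norm[symmetric] norm_divide norm_power norm_mult abs_mult)

lemma summable_on_exp_prod: "(\<lambda>\<alpha>::'n::finite \<Rightarrow> nat. \<Prod>i\<in>UNIV. \<bar>c i\<bar> ^ \<alpha> i / fact (\<alpha> i) :: real) summable_on UNIV"
proof (rule summable_on_prod_UNIV)
  show "(\<lambda>n. \<bar>c i\<bar> ^ n / fact n) summable_on UNIV" for i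
    using summable_exp[of "\<bar>c i\<bar>"] by (subst summable_on_UNIV_nonneg_real_iff) (auto simp: field_simps)
qed simp

lemma has_sum_plane_wave: "((\<lambda>\<alpha>. monomial x \<alpha> *\<^sub>R exp_coeff y \<alpha>) has_sum plane_wave x y) UNIV"
proof -
  define z where "z i = \<i> * of_real (x $ i * y $ i)" for i
  have exp: "((\<lambda>n. z i ^ n / fact n) has_sum exp (z i)) UNIV" for i
  proof (rule norm_summable_imp_has_sum)
    show "(\<lambda>n. z i ^ n / fact n) sums exp (z i)"
      using exp_converges[of "z i"] by (simp add: scaleR_conv_of_real divide_inverse mult.commute)
    show "summable (\<lambda>n. norm (z i ^ n / fact n))"
      using summable_norm_exp[of "z i"] by (simp add: scaleR_conv_of_real divide_inverse mult.commute)
  qed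
  have abs: "(\<lambda>n. norm (z i ^ n / fact n)) summable_on UNIV" for i
    using summable_norm_exp[of "z i"]
    by (subst summable_on_UNIV_nonneg_real_iff) (auto simp: scaleR_conv_of_real divide_inverse mult.commute)
  have "(\<Sum>\<^sub>\<infinity>\<alpha>\<in>PiE UNIV (\<lambda>_. UNIV). \<Prod>i\<in>UNIV. z i ^ \<alpha> i / fact (\<alpha> i)) = (\<Prod>i\<in>UNIV. \<Sum>\<^sub>\<infinity>n. z i ^ n / fact n)"
    by (rule infsum_prod_PiE_abs[OF finite_class.finite_UNIV abs])
  also have "\<dots> = (\<Prod>i\<in>UNIV. exp (z i))"
    by (rule prod.cong[OF refl]) (rule infsumI[OF exp])
  also have "\<dots> = plane_wave x y"
    by (simp add: z_def plane_wave_def inner_vec_def exp_sum sum_distrib_left)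
  finally have val: "(\<Sum>\<^sub>\<infinity>\<alpha>. monomial x \<alpha> *\<^sub>R exp_coeff y \<alpha>) = plane_wave x y"
    by (simp add: monomial_exp_coeff z_def)
  have "(\<lambda>\<alpha>. norm (monomial x \<alpha> *\<^sub>R exp_coeff y \<alpha>)) summable_on UNIV"
    unfolding norm_monomial_exp_coeff by (rule summable_on_exp_prod)
  from has_sum_infsum[OF abs_summable_summable[OF this]] show ?thesis unfolding val .
qed

lemma real_analytic_at_plane_wave: "real_analytic_at (\<lambda>k. plane_wave k v) k0"
proof -
  have "\<exists>r. has_power_series (\<lambda>k. plane_wave (k - k0) v) k0 r (exp_coeff v)"
    by (rule real_analytic_atI[of 1]) (auto intro: has_sum_plane_wave)
  then have "real_analytic_at (\<lambda>k. plane_wave (k - k0) v) k0" unfolding real_analytic_at_def by blast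
  from real_analytic_at_bounded_linear[OF bounded_linear_mult_right[of "plane_wave k0 v"] this]
  show ?thesis by (simp add: plane_wave_add_left[symmetric])
qed

text \<open>The bound depends on \<open>y\<close> only through \<open>B\<close>. It therefore
  controls a multiplication operator in L2 and not just values at single points.\<close>

lemma plane_wave_minus_sum_le:
  fixes x y :: "real^'n"
  assumes x: "\<And>i. \<bar>x $ i\<bar> \<le> r" and y: "\<And>i. \<bar>y $ i\<bar> \<le> B" and "finite F"
  shows "norm (plane_wave x y - (\<Sum>\<alpha>\<in>F. monomial x \<alpha> *\<^sub>R exp_coeff y \<alpha>)) \<le>
    (\<Sum>\<^sub>\<infinity>\<alpha>\<in>-F. \<Prod>i\<in>UNIV. \<bar>r * B\<bar> ^ \<alpha> i / fact (\<alpha> i))"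
proof -
  let ?w = "\<lambda>\<alpha>::'n \<Rightarrow> nat. \<Prod>i\<in>UNIV. \<bar>r * B\<bar> ^ \<alpha> i / fact (\<alpha> i)" and ?t = "\<lambda>\<alpha>. monomial x \<alpha> *\<^sub>R exp_coeff y \<alpha>"
  have w: "?w summable_on UNIV" by (rule summable_on_exp_prod[of "\<lambda>_. r * B"])
  have le: "norm (?t \<alpha>) \<le> ?w \<alpha>" for \<alpha>
    unfolding norm_monomial_exp_coeff
  proof (intro prod_mono conjI divide_right_mono power_mono)
    show "\<bar>x $ i * y $ i\<bar> \<le> \<bar>r * B\<bar>" for i
      using mult_mono[OF x[of i] y[of i]] x[of i] y[of i] by (simp add: abs_mult)
  qed auto
  have wF: "?w summable_on - F" by (rule summable_on_subset_banach[OF w]) simp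
  have nF: "(\<lambda>\<alpha>. norm (?t \<alpha>)) summable_on - F"
    by (rule summable_on_comparison_test[OF wF le]) simp
  have s: "(?t has_sum plane_wave x y - sum ?t F) (UNIV - F)"
    using \<open>finite F\<close> by (intro has_sum_Diff has_sum_plane_wave) auto
  have "norm (plane_wave x y - sum ?t F) \<le> (\<Sum>\<^sub>\<infinity>\<alpha>\<in>-F. norm (?t \<alpha>))"
    using norm_has_sum_bound[OF has_sum_infsum[OF nF]] s by (simp add: Compl_eq_Diff_UNIV)
  also have "\<dots> \<le> infsum ?w (- F)" by (rule infsum_mono[OF nF wF le])
  finally show ?thesis .
qed

lemma tendsto_infsum_Compl:
  fixes w :: "'i \<Rightarrow> real"
  assumes "w summable_on UNIV"
  shows "((\<lambda>F. infsum w (- F)) \<longlongrightarrow> 0) (finite_subsets_at_top UNIV)"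
proof -
  have "(sum w \<longlongrightarrow> infsum w UNIV) (finite_subsets_at_top UNIV)"
    using has_sum_infsum[OF assms] unfolding has_sum_def .
  then have "((\<lambda>F. infsum w UNIV - sum w F) \<longlongrightarrow> infsum w UNIV - infsum w UNIV) (finite_subsets_at_top UNIV)"
    by (intro tendsto_diff tendsto_const)
  moreover have "\<forall>\<^sub>F F in finite_subsets_at_top UNIV. infsum w UNIV - sum w F = infsum w (- F)"
  proof (rule eventually_mono[OF eventually_finite_subsets_at_top_weakI])
    show "finite F" if "finite F" for F :: "'i set" by fact
    show "infsum w UNIV - sum w F = infsum w (- F)" if "finite F" for F
      using infsum_Diff[OF assms, of F] that by (simp add: Compl_eq_Diff_UNIV)
  qed
  ultimately show ?thesis by (simp cong: filterlim_cong)
qed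

text \<open>Because the field \<open>N\<close> is bounded, the tails of the exponential series are
  small uniformly in position, so the expansion of the plane wave converges in L2 after
  multiplication with \<open>f\<close>. The coefficients are those of the exponential, evaluated at
  \<open>N r\<close>, times the function at \<open>k0\<close>.\<close>

lemma real_analytic_at_plane_wave_mult:
  fixes f :: "real^'n \<Rightarrow> complex" and N :: "real^'n \<Rightarrow> real^'n"
  assumes S: "S \<in> sets borel" and f: "square_integrable_on S f" and N [measurable]: "N \<in> borel_measurable borel"
    and bound: "\<And>r. norm (N r) \<le> B"
  shows "real_analytic_at (\<lambda>k. to_l2 S (\<lambda>r. plane_wave k (N r) * f r)) k0"
proof -
  have fm: "f \<in> borel_measurable borel" using f by (simp add: square_integrable_on_def)
  define g where "g r = plane_wave k0 (N r) * f r" for r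
  have pw: "(\<lambda>r. plane_wave k (N r)) \<in> borel_measurable borel" for k
  proof (rule measurable_compose[OF N])
    show "plane_wave k \<in> borel_measurable borel" by measurable
  qed
  have gm: "g \<in> borel_measurable borel" unfolding g_def by (intro borel_measurable_times pw fm)
  have g: "square_integrable_on S g"
    by (rule square_integrable_on_bound[OF S f gm, where B = 1]) (simp add: g_def norm_mult)
  have Bi: "\<bar>N r $ i\<bar> \<le> B" for r i
    using component_le_norm_cart[of "N r" i] bound[of r] by linarith
  have em: "(\<lambda>r. exp_coeff (N r) \<alpha>) \<in> borel_measurable borel" for \<alpha>
  proof -
    have "exp_coeff y \<alpha> = exp_coeff (\<chi> i. y $ i) \<alpha>" for y :: "real^'n" by simp
    have "continuous_on UNIV (\<lambda>y::real^'n. exp_coeff y \<alpha>)"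
      unfolding exp_coeff_def by (intro continuous_intros) auto
    from measurable_compose[OF N borel_measurable_continuous_onI[OF this]] show ?thesis .
  qed
  define a where "a \<alpha> r = exp_coeff (N r) \<alpha> * g r" for \<alpha> r
  have am: "a \<alpha> \<in> borel_measurable borel" for \<alpha> unfolding a_def by (intro borel_measurable_times em gm)
  have a: "square_integrable_on S (a \<alpha>)" for \<alpha>
  proof (rule square_integrable_on_bound[OF S g am])
    have "cmod (exp_coeff (N r) \<alpha>) \<le> (\<Prod>i\<in>UNIV. \<bar>1 * B\<bar> ^ \<alpha> i / fact (\<alpha> i))" for r
    proof -
      have "cmod (exp_coeff (N r) \<alpha>) = (\<Prod>i\<in>UNIV. \<bar>N r $ i\<bar> ^ \<alpha> i / fact (\<alpha> i))"
        by (simp add: exp_coeff_def prod_norm[symmetric] norm_divide norm_power norm_mult)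
      also have "\<dots> \<le> (\<Prod>i\<in>UNIV. \<bar>1 * B\<bar> ^ \<alpha> i / fact (\<alpha> i))"
        using Bi[of r] by (intro prod_mono conjI divide_right_mono power_mono) (auto intro: order_trans[OF Bi abs_ge_self])
      finally show ?thesis .
    qed
    then show "AE r in lborel. r \<in> S \<longrightarrow> cmod (a \<alpha> r) \<le> (\<Prod>i\<in>UNIV. \<bar>1 * B\<bar> ^ \<alpha> i / fact (\<alpha> i)) * cmod (g r)"
      by (simp add: a_def norm_mult mult_right_mono)
  qed
  let ?w = "\<lambda>\<alpha>::'n \<Rightarrow> nat. \<Prod>i\<in>UNIV. \<bar>1 * B\<bar> ^ \<alpha> i / fact (\<alpha> i)"
  have w: "?w summable_on UNIV" by (rule summable_on_exp_prod[of "\<lambda>_. 1 * B"])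
  have "\<exists>r. has_power_series (\<lambda>k. to_l2 S (\<lambda>r. plane_wave k (N r) * f r)) k0 r (\<lambda>\<alpha>. to_l2 S (a \<alpha>))"
  proof (rule real_analytic_atI)
    show "(1::real) > 0" by simp
    fix k assume "k \<in> ball k0 1"
    then have k: "\<bar>(k - k0) $ i\<bar> \<le> 1" for i
      using component_le_norm_cart[of "k - k0" i] by (simp add: dist_norm norm_minus_commute)
    let ?X = "\<lambda>r. plane_wave k (N r) * f r"
    have X: "square_integrable_on S ?X"
      by (rule square_integrable_on_bound[OF S f _, where B = 1]) (auto simp: norm_mult intro!: borel_measurable_times pw fm)
    have "norm (to_l2 S ?X - (\<Sum>\<alpha>\<in>F. monomial (k - k0) \<alpha> *\<^sub>R to_l2 S (a \<alpha>))) \<le> infsum ?w (- F) * norm (to_l2 S g)"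
      if F: "finite F" for F
    proof -
      define s where "s r = (\<Sum>\<alpha>\<in>F. of_real (monomial (k - k0) \<alpha>) * a \<alpha> r)" for r
      have ss: "square_integrable_on S s" unfolding s_def
        by (intro square_integrable_on_sum[OF S] square_integrable_on_cmult[OF S] a)
      have "(\<Sum>\<alpha>\<in>F. monomial (k - k0) \<alpha> *\<^sub>R to_l2 S (a \<alpha>)) = to_l2 S s"
        unfolding s_def by (subst to_l2_sum[OF S])
          (simp_all add: square_integrable_on_cmult[OF S] a to_l2_cmult[OF S] cscale_scaleR)
      then have "to_l2 S ?X - (\<Sum>\<alpha>\<in>F. monomial (k - k0) \<alpha> *\<^sub>R to_l2 S (a \<alpha>)) = to_l2 S (\<lambda>r. ?X r - s r)"
        by (simp add: to_l2_diff[OF S X ss])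
      also have "norm \<dots> \<le> infsum ?w (- F) * norm (to_l2 S g)"
      proof (rule norm_to_l2_le[OF S g])
        show "(\<lambda>r. ?X r - s r) \<in> borel_measurable borel"
          using square_integrable_on_diff[OF S X ss] by (simp add: square_integrable_on_def)
        have "cmod (?X r - s r) \<le> infsum ?w (- F) * cmod (g r)" for r
        proof -
          have "plane_wave k (N r) = plane_wave (k - k0) (N r) * plane_wave k0 (N r)"
            by (simp add: plane_wave_add_left[symmetric])
          then have "?X r - s r = (plane_wave (k - k0) (N r) - (\<Sum>\<alpha>\<in>F. monomial (k - k0) \<alpha> *\<^sub>R exp_coeff (N r) \<alpha>)) * g r"
            by (simp add: g_def s_def a_def left_diff_distrib sum_distrib_right scaleR_conv_of_real mult.assoc)
          then show ?thesis
            using plane_wave_minus_sum_le[of "k - k0" 1 "N r" B F, OF k Bi F] by (simp add: norm_mult mult_right_mono)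
        qed
        then show "AE r in lborel. r \<in> S \<longrightarrow> cmod (?X r - s r) \<le> infsum ?w (- F) * cmod (g r)" by simp
        show "0 \<le> infsum ?w (- F)" by (intro infsum_nonneg prod_nonneg) simp
      qed
      finally show ?thesis .
    qed
    note bound = this
    show "((\<lambda>\<alpha>. monomial (k - k0) \<alpha> *\<^sub>R to_l2 S (a \<alpha>)) has_sum to_l2 S ?X) UNIV"
      unfolding has_sum_iff_norm
    proof (rule Lim_null_comparison)
      show "((\<lambda>F. infsum ?w (- F) * norm (to_l2 S g)) \<longlongrightarrow> 0) (finite_subsets_at_top UNIV)"
        by (rule tendsto_mult_left_zero[OF tendsto_infsum_Compl[OF w]])
      show "\<forall>\<^sub>F F in finite_subsets_at_top UNIV. norm (norm (to_l2 S ?X - (\<Sum>\<alpha>\<in>F. monomial (k - k0) \<alpha> *\<^sub>R to_l2 S (a \<alpha>))))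
          \<le> infsum ?w (- F) * norm (to_l2 S g)"
        by (rule eventually_finite_subsets_at_top_weakI) (unfold real_norm_def abs_norm_cancel, rule bound)
    qed
  qed
  then show ?thesis unfolding real_analytic_at_def by blast
qed

section \<open>Jointly measurable representatives\<close>

lemma norm_abs_l2_diff:
  assumes "square_integrable f" "square_integrable g"
  shows "(norm (abs_l2 f - abs_l2 g))\<^sup>2 = (LINT x|lborel. (cmod (f x - g x))\<^sup>2)"
    and "integrable lborel (\<lambda>x. (cmod (f x - g x))\<^sup>2)"
proof -
  have U: "UNIV \<in> sets (borel :: 'a measure)" by simp
  note s = square_integrable_imp_on[OF U assms(1)] square_integrable_imp_on[OF U assms(2)]
  have abs: "abs_l2 h = to_l2 UNIV h" for h :: "'a \<Rightarrow> complex" by (simp add: to_l2_def)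
  have nonneg: "0 \<le> (LINT x|lborel. (cmod (f x - g x))\<^sup>2)" by simp
  show "(norm (abs_l2 f - abs_l2 g))\<^sup>2 = (LINT x|lborel. (cmod (f x - g x))\<^sup>2)"
    unfolding abs to_l2_diff[OF U s, symmetric] norm_to_l2[OF U square_integrable_on_diff[OF U s]]
    using nonneg by (simp add: set_lebesgue_integral_def)
  show "integrable lborel (\<lambda>x. (cmod (f x - g x))\<^sup>2)"
    using square_integrable_on_diff[OF U s] by (simp add: square_integrable_on_def set_integrable_def)
qed

text \<open>The squared distances are at most \<open>(1/4) ^ j\<close>, so the sum over
  \<open>j\<close> of the squared pointwise differences has a finite integral. It is finite almost
  everywhere, and there its terms tend to zero.\<close>

lemma AE_lim_of_summable_l2:
  assumes f: "square_integrable f" and g: "\<And>j. square_integrable (g j)"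
    and le: "\<And>j::nat. norm (abs_l2 f - abs_l2 (g j)) \<le> (1/2) ^ j"
  shows "AE x in lborel. lim (\<lambda>j. g j x) = f x"
proof -
  let ?a = "\<lambda>j x. (cmod (f x - g j x))\<^sup>2"
  have am: "(\<lambda>x. ennreal (?a j x)) \<in> borel_measurable lborel" for j
    using square_integrable_measurable[OF f] square_integrable_measurable[OF g] by simp
  have int: "(\<integral>\<^sup>+x. ennreal (?a j x) \<partial>lborel) \<le> ennreal ((1/4) ^ j)" for j
  proof -
    have "(\<integral>\<^sup>+x. ennreal (?a j x) \<partial>lborel) = ennreal ((norm (abs_l2 f - abs_l2 (g j)))\<^sup>2)"
      unfolding norm_abs_l2_diff(1)[OF f g] by (rule nn_integral_eq_integral[OF norm_abs_l2_diff(2)[OF f g]]) simp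
    also have "\<dots> \<le> ennreal (((1/2) ^ j)\<^sup>2)" by (intro ennreal_leI power_mono le) simp
    also have "((1/2) ^ j)\<^sup>2 = ((1/4) ^ j :: real)" by (simp add: power2_eq_square power_mult_distrib[symmetric])
    finally show ?thesis .
  qed
  have "(\<integral>\<^sup>+x. (\<Sum>j. ennreal (?a j x)) \<partial>lborel) = (\<Sum>j. \<integral>\<^sup>+x. ennreal (?a j x) \<partial>lborel)"
    by (rule nn_integral_suminf) (rule am)
  also have "\<dots> \<le> (\<Sum>j. ennreal ((1/4) ^ j))" by (intro suminf_le int) auto
  also have "\<dots> = ennreal (\<Sum>j. (1/4) ^ j)" by (rule suminf_ennreal2) auto
  finally have "(\<integral>\<^sup>+x. (\<Sum>j. ennreal (?a j x)) \<partial>lborel) \<noteq> \<infinity>"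
    by (metis ennreal_less_top infinity_ennreal_def not_le)
  then have "AE x in lborel. (\<Sum>j. ennreal (?a j x)) \<noteq> \<infinity>"
    by (rule nn_integral_noteq_infinite[rotated]) (intro borel_measurable_suminf_order am)
  then show ?thesis
  proof eventually_elim
    case (elim x)
    have "summable (\<lambda>j. ?a j x)" by (rule summable_suminf_not_top) (use elim in auto)
    then have "(\<lambda>j. ?a j x) \<longlonglongrightarrow> 0" by (rule summable_LIMSEQ_zero)
    then have "(\<lambda>j. sqrt (?a j x)) \<longlonglongrightarrow> sqrt 0" by (rule tendsto_real_sqrt)
    then have "(\<lambda>j. cmod (g j x - f x)) \<longlonglongrightarrow> 0" by (simp add: norm_minus_commute)
    then have "(\<lambda>j. g j x) \<longlonglongrightarrow> f x" unfolding tendsto_norm_zero_iff by (simp add: LIM_zero_iff)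
    then show "lim (\<lambda>j. g j x) = f x" by (rule limI)
  qed
qed

text \<open>Approximate \<open>Z k\<close> by its values on a countable dense set, with an index depending
  measurably on \<open>k\<close>, and pass to the limit pointwise almost everywhere.\<close>

lemma jointly_measurable_representative:
  fixes Z :: "'a::euclidean_space \<Rightarrow> 'b::euclidean_space l2"
  assumes cont: "continuous_on UNIV Z"
  shows "\<exists>\<zeta>. (\<lambda>(k, r). \<zeta> k r) \<in> borel_measurable (borel \<Otimes>\<^sub>M borel) \<and>
    (\<forall>k. square_integrable (\<zeta> k) \<and> abs_l2 (\<zeta> k) = Z k)"
proof -
  have "\<forall>x::'b l2. \<exists>f. square_integrable f \<and> x = abs_l2 f" using l2_exists_rep by blast
  from choice[OF this] obtain F :: "'b l2 \<Rightarrow> 'b \<Rightarrow> complex"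
    where F: "\<And>x. square_integrable (F x)" "\<And>x. abs_l2 (F x) = x" by metis
  obtain D :: "'a set" where D: "countable D" "\<And>X. open X \<Longrightarrow> X \<noteq> {} \<Longrightarrow> \<exists>d\<in>D. d \<in> X"
    by (rule countable_dense_setE) blast
  define q where "q = from_nat_into D"
  define P where "P j i k \<longleftrightarrow> norm (Z k - Z (q i)) < (1/2) ^ j" for j i :: nat and k
  have ex: "\<exists>i. P j i k" for j k
  proof -
    let ?X = "{k'. norm (Z k - Z k') < (1/2) ^ j}"
    have "open ?X" by (intro open_Collect_less continuous_intros cont)
    moreover have "k \<in> ?X" by simp
    ultimately obtain d where "d \<in> D" "d \<in> ?X" using D(2) by blast
    then show ?thesis using from_nat_into_surj[OF D(1)] unfolding P_def q_def by blast
  qed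
  \<comment> \<open>The conditions \<open>P j i\<close> are open in \<open>k\<close>, and the least
    index satisfying one of them is measurable; an arbitrary choice of index would not be.\<close>
  define n where "n j k = (LEAST i. P j i k)" for j k
  have n: "P j (n j k) k" for j k unfolding n_def by (rule LeastI_ex[OF ex])
  have n_meas: "n j \<in> measurable borel (count_space UNIV)" for j
    unfolding n_def
  proof (rule measurable_Least)
    fix i
    have "{k. P j i k} \<in> sets borel"
      unfolding P_def by (intro borel_open open_Collect_less continuous_intros cont)
    then show "(\<lambda>k. P j i k) \<in> measurable borel (count_space UNIV)" by (simp add: pred_def)
  qed
  define \<Psi> where "\<Psi> j k r = F (Z (q (n j k))) r" for j k r
  have \<Psi>_meas: "(\<lambda>p. \<Psi> j (fst p) (snd p)) \<in> borel_measurable (borel \<Otimes>\<^sub>M borel)" for j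
    unfolding \<Psi>_def
  proof (rule measurable_compose_countable)
    show "(\<lambda>p. F (Z (q i)) (snd p)) \<in> borel_measurable (borel \<Otimes>\<^sub>M borel)" for i
      by (rule measurable_compose[OF measurable_snd square_integrable_measurable[OF F(1)]])
    show "(\<lambda>p. n j (fst p)) \<in> measurable (borel \<Otimes>\<^sub>M borel) (count_space UNIV)"
      by (rule measurable_compose[OF measurable_fst n_meas])
  qed
  \<comment> \<open>Since \<open>lim\<close> is total, this is jointly measurable everywhere. For
    each \<open>k\<close> the sequence can diverge only on a null set of \<open>r\<close>, where the
    value does not matter.\<close>
  define \<zeta> where "\<zeta> k r = lim (\<lambda>j. \<Psi> j k r)" for k r
  have "(\<lambda>p. \<zeta> (fst p) (snd p)) \<in> borel_measurable (borel \<Otimes>\<^sub>M borel)"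
    unfolding \<zeta>_def by (rule borel_measurable_lim_metric) (rule \<Psi>_meas)
  then have joint: "(\<lambda>(k, r). \<zeta> k r) \<in> borel_measurable (borel \<Otimes>\<^sub>M borel)" by (simp add: case_prod_unfold)
  have "square_integrable (\<zeta> k) \<and> abs_l2 (\<zeta> k) = Z k" for k
  proof -
    have ae: "AE r in lborel. \<zeta> k r = F (Z k) r"
      unfolding \<zeta>_def
    proof (rule AE_lim_of_summable_l2[OF F(1)])
      show "square_integrable (\<Psi> j k)" for j unfolding \<Psi>_def by (rule F(1))
      show "norm (abs_l2 (F (Z k)) - abs_l2 (\<Psi> j k)) \<le> (1/2) ^ j" for j
        using n[of j k] unfolding \<Psi>_def P_def F(2) by simp
    qed
    have m: "\<zeta> k \<in> borel_measurable borel"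
      using measurable_compose[OF measurable_Pair1'[of k borel borel] joint] by simp
    have s: "square_integrable (\<zeta> k)"
      by (rule square_integrable_bound[OF F(1)[of "Z k"] m, where B = 1]) (use ae in \<open>eventually_elim, simp\<close>)
    have "abs_l2 (\<zeta> k) = abs_l2 (F (Z k))"
      by (rule Quotient_rel_abs[OF Quotient_l2]) (simp add: l2_rel_def s F(1) ae)
    then show ?thesis using s F(2) by simp
  qed
  then show ?thesis using joint by blast
qed

section \<open>Symmetry operations on Bloch functions\<close>

lemma tr_conj_mult: "tr_conj s (a * b) = tr_conj s a * tr_conj s b"
  and tr_conj_diff: "tr_conj s (a - b) = tr_conj s a - tr_conj s b"
  and cmod_tr_conj [simp]: "cmod (tr_conj s a) = cmod a"
  and tr_conj_of_real [simp]: "tr_conj s (of_real x) = of_real x"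
  and Re_tr_conj [simp]: "Re (tr_conj s a) = Re a"
  by (simp_all add: tr_conj_def)

lemma tr_conj_sum: "tr_conj s (\<Sum>j\<in>J. f j) = (\<Sum>j\<in>J. tr_conj s (f j))"
  by (simp add: tr_conj_def)

lemma tr_conj_tr_conj: "s \<in> {1, -1} \<Longrightarrow> t \<in> {1, -1} \<Longrightarrow> tr_conj t (tr_conj s a) = tr_conj (t * s) a"
  by (auto simp: tr_conj_def)

lemma tr_conj_exp:
  assumes "s \<in> {1, -1}"
  shows "tr_conj s (exp (\<i> * of_real x)) = exp (\<i> * of_real (of_int s * x))"
  using assms by (auto simp: tr_conj_def exp_cnj)

lemma tr_conj_plane_wave: "s \<in> {1, -1} \<Longrightarrow> tr_conj s (plane_wave k r) = plane_wave (of_int s *\<^sub>R k) r"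
  unfolding plane_wave_def by (subst tr_conj_exp) simp_all

lemma tr_conj_measurable: "f \<in> borel_measurable M \<Longrightarrow> (\<lambda>r. tr_conj s (f r)) \<in> borel_measurable M"
  by (cases "s = -1") (simp_all add: tr_conj_def borel_measurable_cnj)

lemma integral_tr_conj: "(LINT x|M. tr_conj s (f x)) = tr_conj s (LINT x|M. f x)"
  by (cases "s = -1") (simp_all add: tr_conj_def)

text \<open>The operator of a space group element with its inverse written out, detached from the
  group structure; \<open>sg_op_eq_sym_op\<close> makes the connection.\<close>

definition sym_op :: "real^'n^'n \<Rightarrow> int \<Rightarrow> real^'n \<Rightarrow> (real^'n \<Rightarrow> complex) \<Rightarrow> real^'n \<Rightarrow> complex" where
  "sym_op p s R f r = tr_conj s (f (transpose p *v (r - R)))"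

lemma inner_matrix_transpose: "(p *v x) \<bullet> y = x \<bullet> (transpose p *v y)"
  for p :: "real^'n^'n"
  by (metis dot_lmul_matrix transpose_matrix_vector transpose_transpose)

lemma orthogonal_transformation_transpose:
  "orthogonal_matrix p \<Longrightarrow> orthogonal_transformation (\<lambda>r. transpose p *v r)" for p :: "real^'n^'n"
  by (simp add: orthogonal_transformation_matrix orthogonal_matrix_transpose del: transpose_matrix_vector)

lemma orthogonal_matrix_vector_cancel:
  fixes p :: "real^'n^'n"
  assumes "orthogonal_matrix p"
  shows "transpose p *v (p *v r) = r" "p *v (transpose p *v r) = r"
  using assms unfolding orthogonal_matrix_def by (simp_all add: matrix_vector_mul_assoc del: transpose_matrix_vector)

lemma distr_transpose_affine:
  fixes p :: "real^'n^'n"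
  assumes "orthogonal_matrix p"
  shows "distr lborel borel (\<lambda>r. transpose p *v (r - R)) = lborel"
    and "(\<lambda>r. transpose p *v (r - R)) \<in> borel_measurable borel"
  using lborel_distr_orthogonal_affine[OF orthogonal_transformation_transpose[OF assms], of "- (transpose p *v R)"]
  by (simp_all add: matrix_vector_mult_diff_distrib del: transpose_matrix_vector)

lemma AE_transpose_affine:
  fixes p :: "real^'n^'n"
  assumes "orthogonal_matrix p" "AE r in lborel. Q r"
  shows "AE r in lborel. Q (transpose p *v (r - R))"
  by (rule AE_lborel_transform[OF distr_transpose_affine[OF assms(1)] assms(2)])

lemma sym_op_AE_cong:
  fixes p :: "real^'n^'n"
  assumes "orthogonal_matrix p" "AE r in lborel. f r = g r"
  shows "AE r in lborel. sym_op p s R f r = sym_op p s R g r"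
  using AE_transpose_affine[OF assms, of R] by eventually_elim (simp add: sym_op_def)

lemma sym_op_measurable:
  fixes p :: "real^'n^'n"
  assumes "orthogonal_matrix p" "f \<in> borel_measurable borel"
  shows "sym_op p s R f \<in> borel_measurable borel"
  unfolding sym_op_def[abs_def]
  by (intro tr_conj_measurable measurable_compose[OF distr_transpose_affine(2)[OF assms(1)] assms(2)])

lemma sym_op_locally_square_integrable:
  fixes p :: "real^'n^'n"
  assumes p: "orthogonal_matrix p" and f: "locally_square_integrable f"
  shows "locally_square_integrable (sym_op p s R f)"
  unfolding locally_square_integrable_def
proof (intro conjI allI impI)
  have fm: "f \<in> borel_measurable borel" using f by (simp add: locally_square_integrable_def)
  then show "sym_op p s R f \<in> borel_measurable lborel" using sym_op_measurable[OF p] by simp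
  fix C :: "(real^'n) set" assume C: "compact C"
  let ?T = "\<lambda>r. transpose p *v (r - R)"
  have inj: "r = r'" if "?T r = ?T r'" for r r'
    using arg_cong[OF that, of "\<lambda>x. p *v x"] by (simp add: orthogonal_matrix_vector_cancel[OF p] del: transpose_matrix_vector)
  have TC: "compact (?T ` C)"
    unfolding matrix_vector_mult_diff_distrib
    by (intro compact_continuous_image[OF _ C] continuous_on_diff matrix_vector_mult_linear_continuous_on continuous_on_const)
  let ?h = "\<lambda>x. indicat_real (?T ` C) x *\<^sub>R (cmod (f x))\<^sup>2"
  have "integrable lborel ?h"
    using f TC by (simp add: locally_square_integrable_def set_integrable_def)
  then have "integrable (distr lborel borel ?T) ?h" unfolding distr_transpose_affine(1)[OF p] .
  then have "integrable lborel (\<lambda>r. ?h (?T r))"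
  proof (rule iffD1[OF integrable_distr_eq, rotated 2])
    show "?T \<in> measurable lborel borel" using distr_transpose_affine(2)[OF p] by simp
    have cm: "(\<lambda>x. cmod (f x)) \<in> borel_measurable borel" using fm by simp
    have "?T ` C \<in> sets borel" using compact_imp_closed[OF TC] by (rule borel_closed)
    then show "?h \<in> borel_measurable borel"
      by (intro borel_measurable_scaleR borel_measurable_indicator borel_measurable_power cm) simp
  qed
  moreover have "?h (?T r) = indicat_real C r *\<^sub>R (cmod (sym_op p s R f r))\<^sup>2" for r
  proof -
    have "?T r \<in> ?T ` C \<longleftrightarrow> r \<in> C" using inj by blast
    then show ?thesis by (simp add: indicator_def sym_op_def)
  qed
  ultimately show "set_integrable lborel C (\<lambda>r. (cmod (sym_op p s R f r))\<^sup>2)"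
    unfolding set_integrable_def by simp
qed

locale magnetic_lattice =
  fixes BL :: "(real^'n) set" and P :: "'n point_op set"
  assumes BL: "full_rank_lattice BL" and P: "point_group BL P"
begin

abbreviation RL :: "(real^'n) set" where "RL \<equiv> reciprocal_lattice BL"
abbreviation cell_emb :: "(real^'n \<Rightarrow> complex) \<Rightarrow> (real^'n) l2" where "cell_emb \<equiv> to_l2 (unit_cell BL)"

lemma RL: "full_rank_lattice RL" by (rule full_rank_reciprocal_lattice[OF BL])

lemma PD:
  assumes "(p, s) \<in> P"
  shows "orthogonal_matrix p" "s \<in> {1, -1}" "(transpose p, s) \<in> P" "R \<in> BL \<Longrightarrow> p *v R \<in> BL"
    "(\<lambda>R. p *v R) ` BL = BL"
proof -
  have "orthogonal_matrix p \<and> s \<in> {1, -1} \<and> (\<lambda>R. p *v R) ` BL = BL"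
    using P assms unfolding point_group_def by fast
  then show "orthogonal_matrix p" "s \<in> {1, -1}" "(\<lambda>R. p *v R) ` BL = BL" by auto
qed (rule point_groupD[OF P assms], assumption?)+

lemma finite_P: "finite P" using P unfolding point_group_def by blast

lemma P_one: "(mat 1, 1) \<in> P" using P unfolding point_group_def by blast

lemma P_mult: "(q, t) \<in> P \<Longrightarrow> (p, s) \<in> P \<Longrightarrow> (q ** p, t * s) \<in> P"
  using P unfolding point_group_def by fast

lemma P_sign: "(p, s) \<in> P \<Longrightarrow> of_int s * of_int s = (1 :: real)"
  using PD(2) by fastforce

lemma RL_image:
  assumes ps: "(p, s) \<in> P" and K: "K \<in> RL"
  shows "of_int s *\<^sub>R (p *v K) \<in> RL"
  unfolding reciprocal_lattice_def
proof (intro CollectI ballI)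
  fix R assume "R \<in> BL"
  then have "transpose p *v R \<in> BL" by (rule PD(4)[OF PD(3)[OF ps]])
  then obtain m :: int where "K \<bullet> (transpose p *v R) = 2 * pi * of_int m"
    using K unfolding reciprocal_lattice_def by blast
  then show "\<exists>m::int. of_int s *\<^sub>R (p *v K) \<bullet> R = 2 * pi * of_int m"
    by (intro exI[of _ "s * m"]) (simp add: inner_matrix_transpose del: transpose_matrix_vector)
qed

lemma sum_P_right_mult:
  assumes ps: "(p, s) \<in> P"
  shows "(\<Sum>(q, t)\<in>P. F (q ** p, t * s)) = (\<Sum>x\<in>P. F x)"
proof -
  note o = PD(1)[OF ps, unfolded orthogonal_matrix_def]
  have ss: "s * s = 1" using PD(2)[OF ps] by auto
  have "(\<Sum>x\<in>P. F (case x of (q, t) \<Rightarrow> (q ** p, t * s))) = (\<Sum>x\<in>P. F x)"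
  proof (rule sum.reindex_bij_witness[of _ "\<lambda>(q, t). (q ** transpose p, t * s)" "\<lambda>(q, t). (q ** p, t * s)"])
    fix a assume a: "a \<in> P"
    obtain q t where a_eq: "a = (q, t)" by (cases a)
    show "(case case a of (q, t) \<Rightarrow> (q ** p, t * s) of (q, t) \<Rightarrow> (q ** transpose p, t * s)) = a"
      using o ss by (simp add: a_eq matrix_mul_assoc[symmetric] mult.assoc)
    show "(case a of (q, t) \<Rightarrow> (q ** p, t * s)) \<in> P" using a P_mult[OF _ ps] by (simp add: a_eq)
  next
    fix b assume b: "b \<in> P"
    obtain q t where b_eq: "b = (q, t)" by (cases b)
    show "(case case b of (q, t) \<Rightarrow> (q ** transpose p, t * s) of (q, t) \<Rightarrow> (q ** p, t * s)) = b"
      using o ss by (simp add: b_eq matrix_mul_assoc[symmetric] mult.assoc)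
    show "(case b of (q, t) \<Rightarrow> (q ** transpose p, t * s)) \<in> P" using b P_mult[OF _ PD(3)[OF ps]] by (simp add: b_eq)
  qed simp
  then show ?thesis by (simp add: case_prod_unfold)
qed

lemma sym_op_bloch:
  assumes ps: "(p, s) \<in> P" and f: "f \<in> bloch_functions BL k"
  shows "sym_op p s R f \<in> bloch_functions BL (of_int s *\<^sub>R (p *v k))"
  unfolding bloch_functions_def
proof (intro CollectI conjI ballI)
  note p = PD(1)[OF ps]
  show "locally_square_integrable (sym_op p s R f)"
    using f by (intro sym_op_locally_square_integrable p) (simp add: bloch_functions_def)
  fix R' assume "R' \<in> BL"
  then have "transpose p *v R' \<in> BL" by (rule PD(4)[OF PD(3)[OF ps]])
  then have "AE r in lborel. f (r + transpose p *v R') = plane_wave k (transpose p *v R') * f r"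
    using f by (simp add: bloch_functions_def del: transpose_matrix_vector)
  then have "AE r in lborel. f (transpose p *v (r - R) + transpose p *v R') =
      plane_wave k (transpose p *v R') * f (transpose p *v (r - R))"
    by (rule AE_transpose_affine[OF p])
  then show "AE r in lborel. sym_op p s R f (r + R') = plane_wave (of_int s *\<^sub>R (p *v k)) R' * sym_op p s R f r"
  proof eventually_elim
    case (elim r)
    have "r + R' - R = (r - R) + R'" by simp
    then have "transpose p *v (r + R' - R) = transpose p *v (r - R) + transpose p *v R'"
      by (simp only: matrix_vector_right_distrib)
    moreover have "tr_conj s (plane_wave k (transpose p *v R')) = plane_wave (of_int s *\<^sub>R (p *v k)) R'"
      using PD(2)[OF ps] by (subst tr_conj_plane_wave) (simp_all add: plane_wave_def inner_matrix_transpose del: transpose_matrix_vector)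
    ultimately show ?case using elim by (simp add: sym_op_def tr_conj_mult del: transpose_matrix_vector)
  qed
qed

text \<open>The squared modulus of a Bloch function is lattice-periodic, so its integral over the
  cell is invariant under the operation.\<close>

lemma norm_emb_sym_op:
  assumes ps: "(p, s) \<in> P" and f: "f \<in> bloch_functions BL k"
  shows "norm (cell_emb (sym_op p s R f)) = norm (cell_emb f)"
proof -
  have fm: "f \<in> borel_measurable borel" using f by (simp add: bloch_functions_def locally_square_integrable_def)
  have "(LINT r:unit_cell BL|lborel. (cmod (f (transpose p *v r + - (transpose p *v R))))\<^sup>2) = (LINT r:unit_cell BL|lborel. (cmod (f r))\<^sup>2)"
  proof (rule cell_integral_transform[OF BL orthogonal_transformation_transpose[OF PD(1)[OF ps]] PD(5)[OF PD(3)[OF ps]]])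
    show "(\<lambda>r. (cmod (f r))\<^sup>2) \<in> borel_measurable borel" using fm by simp
    fix R assume "R \<in> BL"
    then have "AE r in lborel. f (r + R) = plane_wave k R * f r" using f by (simp add: bloch_functions_def)
    then show "AE r in lborel. (cmod (f (r + R)))\<^sup>2 = (cmod (f r))\<^sup>2"
      by eventually_elim (simp add: norm_mult)
  qed
  then have "(LINT r:unit_cell BL|lborel. (cmod (sym_op p s R f r))\<^sup>2) = (LINT r:unit_cell BL|lborel. (cmod (f r))\<^sup>2)"
    by (simp add: sym_op_def matrix_vector_mult_diff_distrib del: transpose_matrix_vector)
  then show ?thesis
    by (simp add: norm_to_l2[OF unit_cell_borel[OF BL]] bloch_square_integrable_on[OF BL f]
        bloch_square_integrable_on[OF BL sym_op_bloch[OF ps f]])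
qed

end

lemma cscale_cancel:
  assumes "cscale a x = cscale b x" "norm x = 1"
  shows "a = b"
proof -
  have "cscale (a - b) x = 0" using assms(1) by (simp add: cscale.diff_left)
  then have "cmod (a - b) * norm x = 0" using norm_cscale[of "a - b" x] by simp
  then show ?thesis using assms(2) by simp
qed

section \<open>The symmetric gauge\<close>

locale continuous_band = magnetic_lattice BL P
  for BL :: "(real^'n) set" and P +
  fixes \<phi> :: "real^'n \<Rightarrow> real^'n \<Rightarrow> complex"
  assumes bloch: "\<phi> k \<in> bloch_functions BL k"
    and norm_\<phi>: "norm (cell_emb (\<phi> k)) = 1"
    and periodic: "K \<in> RL \<Longrightarrow> AE r in lborel. \<phi> (k + K) r = \<phi> k r"
    and continuous: "isCont (\<lambda>k. cell_emb (\<lambda>r. plane_wave (- k) r * \<phi> k r)) k"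
begin

definition u :: "real^'n \<Rightarrow> real^'n \<Rightarrow> complex" where "u k r = plane_wave (- k) r * \<phi> k r"
definition X :: "real^'n \<Rightarrow> (real^'n) l2" where "X k = cell_emb (u k)"

lemmas C_borel = unit_cell_borel[OF BL]

lemma u_torus: "u k \<in> L2_torus BL"
  using bloch_functions_L2_torus[OF bloch] unfolding u_def[abs_def] .

lemma u_sq: "square_integrable_on (unit_cell BL) (u k)"
  by (rule L2_torus_square_integrable_on[OF BL u_torus])

lemma \<phi>_sq: "square_integrable_on (unit_cell BL) (\<phi> k)"
  by (rule bloch_square_integrable_on[OF BL bloch])

lemma \<phi>_meas: "\<phi> k \<in> borel_measurable borel"
  using \<phi>_sq by (simp add: square_integrable_on_def)

lemma norm_X: "norm (X k) = 1"
proof -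
  have "norm (X k) = norm (cell_emb (\<phi> k))"
    unfolding X_def norm_to_l2[OF C_borel u_sq] norm_to_l2[OF C_borel \<phi>_sq]
    by (simp add: u_def norm_mult)
  then show ?thesis by (simp add: norm_\<phi>)
qed

lemma isCont_X: "isCont X k"
  using continuous[of k] unfolding X_def[abs_def] u_def[abs_def] .

end

locale band_gauge = continuous_band BL P \<phi>
  for BL :: "(real^'n) set" and P \<phi> +
  assumes symmetric: "(p, s) \<in> P \<Longrightarrow> \<exists>\<rho>. cmod \<rho> = 1 \<and>
      (AE r in lborel. sym_op p s 0 (\<phi> k) r = \<rho> * \<phi> (of_int s *\<^sub>R (p *v k)) r)"
begin

lemma bloch_cscale_eq:
  assumes "AE r in lborel. a * \<phi> k r = b * \<phi> k r"
  shows "a = b"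
proof -
  have "cell_emb (\<lambda>r. a * \<phi> k r) = cell_emb (\<lambda>r. b * \<phi> k r)"
    using bloch_emb_eq_iff[OF BL bloch_functions_cmult[OF bloch] bloch_functions_cmult[OF bloch]] assms by blast
  then have "cscale a (cell_emb (\<phi> k)) = cscale b (cell_emb (\<phi> k))"
    by (simp add: to_l2_cmult[OF unit_cell_borel[OF BL] \<phi>_sq])
  then show ?thesis using norm_\<phi> by (rule cscale_cancel)
qed

text \<open>Only elements with translation part 0 are recorded: lattice translations act on Bloch
  functions by explicit plane waves. The chosen phase is unique by
  \<open>bloch_cscale_eq\<close>.\<close>

definition \<rho> :: "'n point_op \<Rightarrow> real^'n \<Rightarrow> complex" where
  "\<rho> x k = (SOME c. cmod c = 1 \<and>
     (AE r in lborel. sym_op (fst x) (snd x) 0 (\<phi> k) r = c * \<phi> (of_int (snd x) *\<^sub>R (fst x *v k)) r))"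

lemma \<rho>:
  assumes "(p, s) \<in> P"
  shows "cmod (\<rho> (p, s) k) = 1"
    "AE r in lborel. sym_op p s 0 (\<phi> k) r = \<rho> (p, s) k * \<phi> (of_int s *\<^sub>R (p *v k)) r"
  using someI_ex[OF symmetric[OF assms, of k]] unfolding \<rho>_def by simp_all

text \<open>Acting by \<open>p\<close> and then by \<open>q\<close> is compared with acting by the
  product. The inner phase is conjugated when \<open>t = -1\<close> because the outer operation is
  then antilinear.\<close>

lemma \<rho>_cocycle:
  assumes qt: "(q, t) \<in> P" and ps: "(p, s) \<in> P"
  shows "\<rho> (q ** p, t * s) k = tr_conj t (\<rho> (p, s) k) * \<rho> (q, t) (of_int s *\<^sub>R (p *v k))"
proof -
  let ?k = "of_int s *\<^sub>R (p *v k)"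
  have act: "of_int (t * s) *\<^sub>R ((q ** p) *v k) = of_int t *\<^sub>R (q *v ?k)"
    by (simp add: matrix_vector_mul_assoc[symmetric] matrix_vector_mult_scaleR)
  have "AE r in lborel. sym_op q t 0 (sym_op p s 0 (\<phi> k)) r = sym_op q t 0 (\<lambda>r. \<rho> (p, s) k * \<phi> ?k r) r"
    by (rule sym_op_AE_cong[OF PD(1)[OF qt] \<rho>(2)[OF ps]])
  moreover have "sym_op q t 0 (sym_op p s 0 f) r = sym_op (q ** p) (t * s) 0 f r" for f r
    using PD(2)[OF qt] PD(2)[OF ps]
    by (simp add: sym_op_def tr_conj_tr_conj matrix_transpose_mul matrix_vector_mul_assoc del: transpose_matrix_vector)
  ultimately have "AE r in lborel. sym_op (q ** p) (t * s) 0 (\<phi> k) r = tr_conj t (\<rho> (p, s) k) * sym_op q t 0 (\<phi> ?k) r"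
    by (simp add: sym_op_def tr_conj_mult del: transpose_matrix_vector)
  with \<rho>(2)[OF P_mult[OF qt ps], of k, unfolded act] \<rho>(2)[OF qt, of ?k]
  have "AE r in lborel. \<rho> (q ** p, t * s) k * \<phi> (of_int t *\<^sub>R (q *v ?k)) r =
      (tr_conj t (\<rho> (p, s) k) * \<rho> (q, t) ?k) * \<phi> (of_int t *\<^sub>R (q *v ?k)) r"
    by eventually_elim (metis mult.assoc)
  then show ?thesis by (rule bloch_cscale_eq)
qed

lemma \<rho>_periodic:
  assumes ps: "(p, s) \<in> P" and K: "K \<in> RL"
  shows "\<rho> (p, s) (k + K) = \<rho> (p, s) k"
proof -
  let ?k = "of_int s *\<^sub>R (p *v k)"
  have act: "of_int s *\<^sub>R (p *v (k + K)) = ?k + of_int s *\<^sub>R (p *v K)"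
    by (simp add: matrix_vector_right_distrib scaleR_add_right)
  have "AE r in lborel. sym_op p s 0 (\<phi> (k + K)) r = sym_op p s 0 (\<phi> k) r"
    by (rule sym_op_AE_cong[OF PD(1)[OF ps] periodic[OF K]])
  with \<rho>(2)[OF ps, of k] \<rho>(2)[OF ps, of "k + K", unfolded act] periodic[OF RL_image[OF ps K], of ?k]
  have "AE r in lborel. \<rho> (p, s) (k + K) * \<phi> ?k r = \<rho> (p, s) k * \<phi> ?k r"
    by eventually_elim metis
  then show ?thesis by (rule bloch_cscale_eq)
qed

lemma sym_op_u:
  assumes ps: "(p, s) \<in> P"
  shows "AE r in lborel. sym_op p s 0 (u k) r = \<rho> (p, s) k * u (of_int s *\<^sub>R (p *v k)) r"
  using \<rho>(2)[OF ps, of k]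
proof eventually_elim
  case (elim r)
  have "tr_conj s (plane_wave (- k) (transpose p *v r)) = plane_wave (- (of_int s *\<^sub>R (p *v k))) r"
    using PD(2)[OF ps] by (subst tr_conj_plane_wave) (simp_all add: plane_wave_def inner_matrix_transpose del: transpose_matrix_vector)
  then show ?case using elim by (simp add: sym_op_def u_def tr_conj_mult del: transpose_matrix_vector)
qed

text \<open>The phases are chosen pointwise, so continuity has to come from the vectors. The
  operation acts isometrically on the envelopes, hence the product of phase and transformed envelope
  is continuous, and the envelope itself is continuous with norm 1; the triangle inequality isolates
  the phase.\<close>

lemma isCont_\<rho>:
  assumes ps: "(p, s) \<in> P"
  shows "isCont (\<rho> (p, s)) k0"
proof -
  let ?g = "\<lambda>k. of_int s *\<^sub>R (p *v k)"
  note B = unit_cell_borel[OF BL]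
  have sq: "square_integrable_on (unit_cell BL) (sym_op p s 0 (u k))" for k
    by (rule bloch_square_integrable_on[OF BL sym_op_bloch[OF ps u_torus[folded bloch_functions_0]]])
  have emb: "cell_emb (sym_op p s 0 (u k)) = cscale (\<rho> (p, s) k) (X (?g k))" for k
  proof -
    have "cell_emb (sym_op p s 0 (u k)) = cell_emb (\<lambda>r. \<rho> (p, s) k * u (?g k) r)"
    proof (rule to_l2_eqI[OF B sq square_integrable_on_cmult[OF B u_sq]])
      show "AE r in lborel. r \<in> unit_cell BL \<longrightarrow> sym_op p s 0 (u k) r = \<rho> (p, s) k * u (?g k) r"
        using sym_op_u[OF ps, of k] by eventually_elim simp
    qed
    then show ?thesis by (simp add: to_l2_cmult[OF B u_sq] X_def)
  qed
  have iso: "norm (cscale (\<rho> (p, s) k) (X (?g k)) - cscale (\<rho> (p, s) k0) (X (?g k0))) = norm (X k - X k0)" for k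
  proof -
    \<comment> \<open>Envelopes all have wavevector 0, so their difference is again a function to
      which the isometry applies. For the Bloch functions themselves this would fail.\<close>
    have d: "(\<lambda>r. u k r - u k0 r) \<in> bloch_functions BL 0"
    proof -
      have "locally_square_integrable (\<lambda>r. u k r - u k0 r)"
        unfolding locally_square_integrable_def
      proof (intro conjI allI impI)
        have um: "u k \<in> borel_measurable borel" "u k0 \<in> borel_measurable borel"
          using u_sq unfolding square_integrable_on_def by auto
        then show "(\<lambda>r. u k r - u k0 r) \<in> borel_measurable lborel" by simp
        fix C :: "(real^'n) set" assume "compact C"
        then have C: "C \<in> sets borel" by (intro borel_closed compact_imp_closed)
        have "square_integrable_on C (u k)" "square_integrable_on C (u k0)"
          using u_torus[of k] u_torus[of k0] \<open>compact C\<close>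
          unfolding L2_torus_def locally_square_integrable_def square_integrable_on_def by simp_all
        from square_integrable_on_diff[OF C this] show "set_integrable lborel C (\<lambda>r. (cmod (u k r - u k0 r))\<^sup>2)"
          by (simp add: square_integrable_on_def)
      qed
      moreover have "AE r in lborel. u k (r + R) - u k0 (r + R) = plane_wave 0 R * (u k r - u k0 r)" if R: "R \<in> BL" for R
      proof -
        have "AE r in lborel. u k (r + R) = u k r" "AE r in lborel. u k0 (r + R) = u k0 r"
          using u_torus R unfolding L2_torus_def by auto
        then show ?thesis by eventually_elim simp
      qed
      ultimately show ?thesis unfolding bloch_functions_def by blast
    qed
    have "cscale (\<rho> (p, s) k) (X (?g k)) - cscale (\<rho> (p, s) k0) (X (?g k0)) = cell_emb (\<lambda>r. sym_op p s 0 (u k) r - sym_op p s 0 (u k0) r)"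
      by (simp add: emb[symmetric] to_l2_diff[OF B sq sq])
    also have "(\<lambda>r. sym_op p s 0 (u k) r - sym_op p s 0 (u k0) r) = sym_op p s 0 (\<lambda>r. u k r - u k0 r)"
      by (rule ext) (simp add: sym_op_def tr_conj_diff)
    also have "norm (cell_emb \<dots>) = norm (cell_emb (\<lambda>r. u k r - u k0 r))" by (rule norm_emb_sym_op[OF ps d])
    also have "\<dots> = norm (X k - X k0)" by (simp add: X_def to_l2_diff[OF B u_sq u_sq])
    finally show ?thesis .
  qed
  have le: "norm (\<rho> (p, s) k - \<rho> (p, s) k0) \<le> norm (X (?g k) - X (?g k0)) + norm (X k - X k0)" for k
  proof -
    have "norm (\<rho> (p, s) k - \<rho> (p, s) k0) = norm (cscale (\<rho> (p, s) k - \<rho> (p, s) k0) (X (?g k0)))"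
      by (simp add: norm_cscale norm_X)
    also have "cscale (\<rho> (p, s) k - \<rho> (p, s) k0) (X (?g k0)) =
        - cscale (\<rho> (p, s) k) (X (?g k) - X (?g k0)) + (cscale (\<rho> (p, s) k) (X (?g k)) - cscale (\<rho> (p, s) k0) (X (?g k0)))"
      by (simp add: cscale.diff_left cscale.diff_right)
    also have "norm \<dots> \<le> norm (cscale (\<rho> (p, s) k) (X (?g k) - X (?g k0))) + norm (X k - X k0)"
      unfolding iso[of k, symmetric]
      using norm_triangle_ineq[of "- cscale (\<rho> (p, s) k) (X (?g k) - X (?g k0))"] by (simp only: norm_minus_cancel)
    finally show ?thesis by (simp add: norm_cscale \<rho>(1)[OF ps])
  qed
  have "continuous_on UNIV ?g"
    by (intro continuous_on_scaleR continuous_on_const matrix_vector_mult_linear_continuous_on)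
  then have g: "isCont ?g k0" by (simp add: continuous_on_eq_continuous_at)
  have "((\<lambda>k. norm (X (?g k) - X (?g k0)) + norm (X k - X k0)) \<longlongrightarrow> 0 + 0) (at k0)"
  proof (intro tendsto_add)
    have "isCont (\<lambda>k. X (?g k)) k0" by (rule isCont_o2[OF g isCont_X])
    then show "((\<lambda>k. norm (X (?g k) - X (?g k0))) \<longlongrightarrow> 0) (at k0)"
      unfolding isCont_def by (simp only: tendsto_norm_zero_iff LIM_zero_iff)
    show "((\<lambda>k. norm (X k - X k0)) \<longlongrightarrow> 0) (at k0)"
      using isCont_X[of k0] unfolding isCont_def by (simp only: tendsto_norm_zero_iff LIM_zero_iff)
  qed
  then have "((\<lambda>k. norm (X (?g k) - X (?g k0)) + norm (X k - X k0)) \<longlongrightarrow> 0) (at k0)" by simp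
  then have "((\<lambda>k. \<rho> (p, s) k - \<rho> (p, s) k0) \<longlongrightarrow> 0) (at k0)"
    by (rule Lim_null_comparison[rotated]) (intro always_eventually allI le)
  then show ?thesis unfolding isCont_def by (simp only: LIM_zero_iff)
qed

end

section \<open>Lifting phases to real functions and linear extension from a lattice\<close>

lemma exp_i_eq_one_imp_constant:
  fixes e :: "real^'n \<Rightarrow> real"
  assumes cont: "continuous_on UNIV e" and one: "\<And>k. exp (\<i> * of_real (e k)) = 1"
  shows "e k = e 0"
proof -
  have int: "\<exists>m::int. e k = 2 * pi * of_int m" for k
  proof -
    have "\<exists>m::int. Im (\<i> * of_real (e k)) = of_int (2 * m) * pi" using one[of k] unfolding exp_eq_1 by blast
    then show ?thesis by (auto simp: ac_simps)
  qed
  \<comment> \<open>Distinct values in 2 pi times the integers are at least 2 pi apart, and a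
    continuous function on a connected space with such a range is constant.\<close>
  have "e constant_on UNIV"
  proof (rule continuous_discrete_range_constant[OF connected_UNIV cont])
    fix x :: "real^'n"
    have "2 * pi \<le> norm (e y - e x)" if ne: "e y \<noteq> e x" for y
    proof -
      obtain m :: int where m1: "e y = 2 * pi * of_int m" using int by blast
      obtain m' :: int where m2: "e x = 2 * pi * of_int m'" using int by blast
      note m = m1 m2
      then have "m \<noteq> m'" using ne by auto
      then have "1 \<le> \<bar>m - m'\<bar>" by linarith
      then have "(1 :: real) \<le> \<bar>of_int m - of_int m'\<bar>" by linarith
      then have "2 * pi * 1 \<le> 2 * pi * \<bar>of_int m - of_int m'\<bar>" by (intro mult_left_mono) auto
      also have "\<dots> = norm (e y - e x)" by (simp add: m abs_mult right_diff_distrib[symmetric])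
      finally show ?thesis by simp
    qed
    then show "\<exists>d>0. \<forall>y. y \<in> UNIV \<and> e y \<noteq> e x \<longrightarrow> d \<le> norm (e y - e x)"
      by (intro exI[of _ "2 * pi"]) simp
  qed
  then show ?thesis unfolding constant_on_def by auto
qed

text \<open>A nowhere vanishing function on a contractible space has a continuous logarithm. The
  lift lives on the covering space of the torus and need not be periodic.\<close>

lemma continuous_phase:
  fixes f :: "real^'n \<Rightarrow> complex"
  assumes "continuous_on UNIV f" "\<And>k. cmod (f k) = 1"
  shows "\<exists>h. continuous_on UNIV h \<and> (\<forall>k. f k = exp (\<i> * of_real (h k)))"
proof -
  have nz: "f k \<noteq> 0" for k using assms(2)[of k] by auto
  obtain g where g: "continuous_on UNIV g" "\<And>k. k \<in> UNIV \<Longrightarrow> f k = exp (g k)"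
    using continuous_logarithm_on_contractible[OF assms(1) convex_imp_contractible[OF convex_UNIV]] nz by blast
  have "Re (g k) = 0" for k
    using assms(2)[of k] g(2)[of k] by (simp add: norm_exp_eq_Re)
  then have "g k = \<i> * of_real (Im (g k))" for k by (simp add: complex_eq_iff)
  moreover have "continuous_on UNIV (\<lambda>k. Im (g k))" by (intro continuous_on_Im g)
  ultimately show ?thesis using g(2) by (intro exI[of _ "\<lambda>k. Im (g k)"]) simp
qed

text \<open>Additivity passes to integer combinations, so the values on a basis decide. The rows of
  the inverse basis matrix form the dual basis, and \<open>w\<close> is the combination of them with
  these values.\<close>

lemma additive_on_lattice:
  fixes L :: "(real^'n) set" and \<eta> :: "real^'n \<Rightarrow> real"
  assumes L: "full_rank_lattice L" and add: "\<And>x y. x \<in> L \<Longrightarrow> y \<in> L \<Longrightarrow> \<eta> (x + y) = \<eta> x + \<eta> y"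
  shows "\<exists>w. \<forall>x\<in>L. \<eta> x = w \<bullet> x"
proof -
  let ?A = "lattice_basis L" and ?B = "matrix_inv (lattice_basis L)"
  define b where "b i = ?A *v axis i 1" for i
  have bL: "b i \<in> L" for i
    unfolding mem_lattice_iff[OF L] b_def lattice_basis_inv[OF L] by (simp add: axis_def)
  have zero: "\<eta> 0 = 0" using add[of 0 0] lattice_zero[OF L] by simp
  have nat: "real n *\<^sub>R x \<in> L \<and> \<eta> (real n *\<^sub>R x) = real n * \<eta> x" if x: "x \<in> L" for n x
  proof (induction n)
    case (Suc n)
    then have "real n *\<^sub>R x + x \<in> L" "\<eta> (real n *\<^sub>R x + x) = real n * \<eta> x + \<eta> x"
      using x lattice_add[OF L] add by auto
    then show ?case by (simp add: algebra_simps)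
  qed (simp add: zero lattice_zero[OF L])
  have \<eta>_neg: "\<eta> (- x) = - \<eta> x" if "x \<in> L" for x
    using add[of x "- x"] that lattice_uminus[OF L] zero by simp
  have int: "of_int m *\<^sub>R x \<in> L \<and> \<eta> (of_int m *\<^sub>R x) = of_int m * \<eta> x" if x: "x \<in> L" for m :: int and x
  proof (cases m)
    case (nonneg n)
    then show ?thesis using nat[OF x, of n] by simp
  next
    case (neg n)
    have m: "(of_int m :: real) = - real (Suc n)" by (simp add: neg)
    show ?thesis using nat[OF x, of "Suc n"] \<eta>_neg[of "real (Suc n) *\<^sub>R x"] lattice_uminus[OF L, of "real (Suc n) *\<^sub>R x"]
      unfolding m scaleR_minus_left mult_minus_left by simp
  qed
  have sum: "(\<Sum>i\<in>I. of_int (m i) *\<^sub>R b i) \<in> L \<and> \<eta> (\<Sum>i\<in>I. of_int (m i) *\<^sub>R b i) = (\<Sum>i\<in>I. of_int (m i) * \<eta> (b i))"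
    if "finite I" for I :: "'n set" and m :: "'n \<Rightarrow> int"
    using that
  proof (induction I rule: finite_induct)
    case (insert i I)
    then show ?case using int[OF bL, of "m i" i] lattice_add[OF L] add by simp
  qed (simp add: zero lattice_zero[OF L])
  define w where "w = (\<Sum>i\<in>UNIV. \<eta> (b i) *\<^sub>R row i ?B)"
  have "\<eta> x = w \<bullet> x" if x: "x \<in> L" for x
  proof -
    have "\<forall>i. \<exists>m::int. (?B *v x) $ i = of_int m" using x unfolding mem_lattice_iff[OF L] Ints_def by blast
    from choice[OF this] obtain m :: "'n \<Rightarrow> int" where m: "\<And>i. (?B *v x) $ i = of_int (m i)" by blast
    have "x = ?A *v (?B *v x)" by (simp add: lattice_basis_inv[OF L])
    also have "?B *v x = (\<Sum>i\<in>UNIV. of_int (m i) *\<^sub>R axis i 1)"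
      unfolding m[symmetric] using basis_expansion[of "?B *v x"] by (simp add: scalar_mult_eq_scaleR)
    also have "?A *v \<dots> = (\<Sum>i\<in>UNIV. of_int (m i) *\<^sub>R b i)"
      by (simp add: b_def matrix_vector_mult_scaleR linear_sum[OF matrix_vector_mul_linear])
    finally have "x = (\<Sum>i\<in>UNIV. of_int (m i) *\<^sub>R b i)" .
    then have "\<eta> x = (\<Sum>i\<in>UNIV. of_int (m i) * \<eta> (b i))" using sum[of UNIV m] by simp
    also have "\<dots> = w \<bullet> x"
    proof -
      have "row i ?B \<bullet> x = of_int (m i)" for i
        unfolding m[symmetric] by (simp add: matrix_vector_mult_def row_def inner_vec_def)
      then show ?thesis by (simp add: w_def inner_sum_left mult.commute)
    qed
    finally show ?thesis .
  qed
  then show ?thesis by blast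
qed

section \<open>Averaging the lifted phases over the point group\<close>

context band_gauge
begin

definition h :: "'n point_op \<Rightarrow> real^'n \<Rightarrow> real" where
  "h x = (SOME h. continuous_on UNIV h \<and> (\<forall>k. \<rho> x k = exp (\<i> * of_real (h k))))"

lemma h:
  assumes "x \<in> P"
  shows "continuous_on UNIV (h x)" "\<rho> x k = exp (\<i> * of_real (h x k))"
proof -
  obtain p s where x: "x = (p, s)" by (cases x)
  have "continuous_on UNIV (\<rho> x)"
    using isCont_\<rho> assms unfolding x by (simp add: continuous_on_eq_continuous_at)
  moreover have "cmod (\<rho> x k) = 1" for k using \<rho>(1) assms unfolding x by blast
  ultimately have "\<exists>h. continuous_on UNIV h \<and> (\<forall>k. \<rho> x k = exp (\<i> * of_real (h k)))"
    by (rule continuous_phase)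
  from someI_ex[OF this] show "continuous_on UNIV (h x)" "\<rho> x k = exp (\<i> * of_real (h x k))"
    unfolding h_def by blast+
qed

text \<open>The weight \<open>t\<close> matches the sign with which complex conjugation acts on real
  phases; in the averaged cocycle condition it meets a second factor \<open>t\<close>, and the two
  cancel.\<close>

definition H :: "real^'n \<Rightarrow> real" where
  "H k = (\<Sum>(q, t)\<in>P. of_int t * h (q, t) k) / real (card P)"

lemma card_P: "real (card P) > 0"
  using finite_P P_one by (auto simp: card_gt_0_iff)

lemma continuous_H: "continuous_on UNIV H"
  unfolding H_def case_prod_unfold
  by (intro continuous_on_divide continuous_on_sum continuous_on_mult continuous_on_const)
    (use h(1) card_P in simp_all)

text \<open>Averaging the cocycle condition over the group exhibits the phase as a coboundary, up to a constant.\<close>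

lemma h_coboundary:
  assumes ps: "(p, s) \<in> P"
  shows "\<exists>d. \<forall>k. h (p, s) k = of_int s * H k - H (of_int s *\<^sub>R (p *v k)) + d"
proof -
  let ?g = "\<lambda>k. of_int s *\<^sub>R (p *v k)"
  have gc: "continuous_on UNIV ?g"
    by (intro continuous_on_scaleR continuous_on_const matrix_vector_mult_linear_continuous_on)
  \<comment> \<open>The defect of the cocycle condition for the lifts. Its exponential is 1 by
    \<open>\<rho>_cocycle\<close>, so it does not depend on \<open>k\<close>.\<close>
  define e where "e x k = h (fst x ** p, snd x * s) k - of_int (snd x) * h (p, s) k - h x (?g k)" for x k
  have e: "e x k = e x 0" if x: "x \<in> P" for x k
  proof -
    obtain q t where x_eq: "x = (q, t)" by (cases x)
    have qt: "(q, t) \<in> P" using x x_eq by simp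
    show ?thesis
    proof (rule exp_i_eq_one_imp_constant)
      show "continuous_on UNIV (e x)"
        unfolding e_def x_eq fst_conv snd_conv
        using h(1)[OF P_mult[OF qt ps]] h(1)[OF ps] continuous_on_compose2[OF h(1)[OF qt] gc]
        by (intro continuous_on_diff continuous_on_mult continuous_on_const) simp_all
      fix k
      have "exp (\<i> * of_real (h (q ** p, t * s) k)) =
          exp (\<i> * of_real (of_int t * h (p, s) k)) * exp (\<i> * of_real (h (q, t) (?g k)))"
        using \<rho>_cocycle[OF qt ps, of k] tr_conj_exp[OF PD(2)[OF qt], of "h (p, s) k"]
        by (simp only: h(2)[OF P_mult[OF qt ps]] h(2)[OF qt] h(2)[OF ps])
      then show "exp (\<i> * of_real (e x k)) = 1"
        by (simp add: e_def x_eq right_diff_distrib exp_diff)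
    qed
  qed
  define d where "d = - (\<Sum>x\<in>P. of_int (snd x) * e x 0) / real (card P)"
  have "h (p, s) k = of_int s * H k - H (?g k) + d" for k
  proof -
    have sq: "of_int t * of_int t = (1::real)" if "(q, t) \<in> P" for q t using P_sign[OF that] .
    have "(\<Sum>x\<in>P. of_int (snd x) * e x 0) = (\<Sum>x\<in>P. of_int (snd x) * e x k)"
      by (rule sum.cong[OF refl]) (simp add: e[of _ k])
    \<comment> \<open>Writing \<open>t\<close> as \<open>s * (t * s)\<close> puts the first summand
      into a form that can be reindexed by right multiplication with \<open>(p, s)\<close>, which
      turns it into a multiple of \<open>H k\<close>.\<close>
    also have "\<dots> = (\<Sum>(q, t)\<in>P. of_int s * (of_int (t * s) * h (q ** p, t * s) k) - h (p, s) k - of_int t * h (q, t) (?g k))"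
    proof (rule sum.cong[OF refl])
      fix x assume x: "x \<in> P"
      obtain q t where x_eq: "x = (q, t)" by (cases x)
      have "of_int s * (of_int (t * s) * h (q ** p, t * s) k) = (of_int s * of_int s) * (of_int t * h (q ** p, t * s) k)"
        by (simp add: ac_simps)
      then have c1: "of_int s * (of_int (t * s) * h (q ** p, t * s) k) = of_int t * h (q ** p, t * s) k"
        by (simp only: P_sign[OF ps] mult_1_left)
      have "(q, t) \<in> P" using x x_eq by simp
      from P_sign[OF this] have c2: "of_int t * (of_int t * h (p, s) k) = h (p, s) k"
        by (simp only: mult.assoc[symmetric] mult_1_left)
      show "of_int (snd x) * e x k = (case x of (q, t) \<Rightarrow>
          of_int s * (of_int (t * s) * h (q ** p, t * s) k) - h (p, s) k - of_int t * h (q, t) (?g k))"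
        unfolding x_eq e_def prod.case fst_conv snd_conv right_diff_distrib by (simp only: c1 c2)
    qed
    also have "\<dots> = of_int s * (\<Sum>(q, t)\<in>P. of_int (t * s) * h (q ** p, t * s) k) - real (card P) * h (p, s) k
        - (\<Sum>(q, t)\<in>P. of_int t * h (q, t) (?g k))"
      by (simp add: case_prod_unfold sum_subtractf sum_distrib_left)
    also have "(\<Sum>(q, t)\<in>P. of_int (t * s) * h (q ** p, t * s) k) = (\<Sum>x\<in>P. (case x of (q, t) \<Rightarrow> of_int t * h (q, t) k))"
      using sum_P_right_mult[OF ps, of "\<lambda>x. case x of (q, t) \<Rightarrow> of_int t * h (q, t) k"] by simp
    also have "\<dots> = real (card P) * H k" using card_P by (simp add: H_def)
    also have "(\<Sum>(q, t)\<in>P. of_int t * h (q, t) (?g k)) = real (card P) * H (?g k)" using card_P by (simp add: H_def)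
    finally have "real (card P) * - d = real (card P) * (of_int s * H k - h (p, s) k - H (?g k))"
      using card_P by (simp add: d_def algebra_simps)
    then have "- d = of_int s * H k - h (p, s) k - H (?g k)"
      using card_P unfolding mult_cancel_left by simp
    then show ?thesis by linarith
  qed
  then show ?thesis by blast
qed

text \<open>The phase itself is periodic, so the increment of its lift is continuous with values in
  2 pi times the integers: these are winding numbers around the torus.\<close>

lemma h_winding:
  assumes x: "x \<in> P" and K: "K \<in> RL"
  shows "h x (k + K) - h x k = h x K - h x 0" "\<exists>m::int. h x K - h x 0 = 2 * pi * of_int m"
proof -
  obtain p s where x_eq: "x = (p, s)" by (cases x)
  have one: "exp (\<i> * of_real (h x (k + K) - h x k)) = 1" for k
    using \<rho>_periodic[of p s K k] x K unfolding x_eq[symmetric] h(2)[OF x] by (simp add: right_diff_distrib exp_diff)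
  have "continuous_on UNIV (\<lambda>k. h x (k + K) - h x k)"
    by (intro continuous_on_diff h(1)[OF x] continuous_on_compose2[OF h(1)[OF x]] continuous_intros) auto
  from exp_i_eq_one_imp_constant[OF this one, of k] show "h x (k + K) - h x k = h x K - h x 0" by simp
  have "\<exists>m::int. Im (\<i> * of_real (h x (0 + K) - h x 0)) = of_int (2 * m) * pi"
    using one[of 0] unfolding exp_eq_1 by blast
  then show "\<exists>m::int. h x K - h x 0 = 2 * pi * of_int m" by (auto simp: ac_simps)
qed

text \<open>Independence of \<open>k\<close> survives the averaging. Integrality need not, because
  of the division by the group order; this is what permits a centre away from the lattice
  points.\<close>

lemma H_winding:
  assumes K: "K \<in> RL"
  shows "H (k + K) - H k = H K - H 0"
proof -
  have "(\<Sum>(q, t)\<in>P. of_int t * h (q, t) (k + K)) - (\<Sum>(q, t)\<in>P. of_int t * h (q, t) k) =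
      (\<Sum>(q, t)\<in>P. of_int t * h (q, t) K) - (\<Sum>(q, t)\<in>P. of_int t * h (q, t) 0)"
    unfolding sum_subtractf[symmetric]
  proof (rule sum.cong[OF refl])
    fix x assume x: "x \<in> P"
    obtain q t where x_eq: "x = (q, t)" by (cases x)
    have "h (q, t) (k + K) - h (q, t) k = h (q, t) K - h (q, t) 0" using h_winding(1)[OF x K] x_eq by simp
    then have "of_int t * (h (q, t) (k + K) - h (q, t) k) = of_int t * (h (q, t) K - h (q, t) 0)" by simp
    then show "(case x of (q, t) \<Rightarrow> of_int t * h (q, t) (k + K)) - (case x of (q, t) \<Rightarrow> of_int t * h (q, t) k) =
        (case x of (q, t) \<Rightarrow> of_int t * h (q, t) K) - (case x of (q, t) \<Rightarrow> of_int t * h (q, t) 0)"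
      by (simp add: x_eq right_diff_distrib)
  qed
  then show ?thesis unfolding H_def diff_divide_distrib[symmetric] by simp
qed

text \<open>Increments that do not depend on \<open>k\<close> are additive, so on \<open>RL\<close>
  they come from a vector \<open>w\<close>. For K in \<open>RL\<close> the pairing of the transposed
  \<open>p\<close> applied to \<open>w\<close>, minus \<open>w\<close>, with K is up to sign an
  increment of \<open>h (p, s)\<close>, hence in 2 pi times the integers; double duality puts the
  difference into \<open>BL\<close>.\<close>

lemma symmetric_gauge:
  "\<exists>\<mu> w. continuous_on UNIV \<mu> \<and> (\<forall>k. \<forall>K\<in>RL. \<mu> (k + K) = \<mu> k) \<and>
     (\<forall>(p, s)\<in>P. p *v w - w \<in> BL \<and> (\<exists>c. cmod c = 1 \<and> (\<forall>k. AE r in lborel.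
        sym_op p s (w - p *v w) (\<lambda>r. exp (\<i> * of_real (\<mu> k)) * \<phi> k r) r =
        c * (exp (\<i> * of_real (\<mu> (of_int s *\<^sub>R (p *v k)))) * \<phi> (of_int s *\<^sub>R (p *v k)) r))))"
proof -
  have "\<exists>w. \<forall>K\<in>RL. H 0 - H K = w \<bullet> K"
  proof (rule additive_on_lattice[OF RL])
    show "H 0 - H (x + y) = (H 0 - H x) + (H 0 - H y)" if "x \<in> RL" "y \<in> RL" for x y
      using H_winding[OF that(2), of x] by simp
  qed
  then obtain w where w': "\<And>K. K \<in> RL \<Longrightarrow> H 0 - H K = w \<bullet> K" by blast
  have w: "H K - H 0 = - (w \<bullet> K)" if "K \<in> RL" for K using w'[OF that] by linarith
  \<comment> \<open>The term \<open>- H k\<close> cancels the coboundary, and the linear term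
    compensates the increments of \<open>H\<close>, so the sum is periodic.\<close>
  define \<mu> where "\<mu> k = - H k - w \<bullet> k" for k
  have cont: "continuous_on UNIV \<mu>" unfolding \<mu>_def by (intro continuous_intros continuous_H)
  have per: "\<mu> (k + K) = \<mu> k" if "K \<in> RL" for k K
    using H_winding[OF that, of k] w[OF that] by (simp add: \<mu>_def inner_add_right)
  have unit: "transpose p *v w - w \<in> BL" if ps: "(p, s) \<in> P" for p s
  proof -
    obtain d where d: "\<And>k. h (p, s) k = of_int s * H k - H (of_int s *\<^sub>R (p *v k)) + d"
      using h_coboundary[OF ps] by blast
    have "transpose p *v w - w \<in> reciprocal_lattice RL"
      unfolding reciprocal_lattice_def[of RL]
    proof (intro CollectI ballI)
      fix K assume K: "K \<in> RL"
      obtain m :: int where m: "h (p, s) K - h (p, s) 0 = 2 * pi * of_int m" using h_winding(2)[OF ps K] by blast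
      have "h (p, s) K - h (p, s) 0 = of_int s * (H K - H 0) - (H (of_int s *\<^sub>R (p *v K)) - H 0)"
        by (simp add: d right_diff_distrib)
      also have "\<dots> = of_int s * ((transpose p *v w - w) \<bullet> K)"
      proof -
        have "w \<bullet> (p *v K) = (transpose p *v w) \<bullet> K"
          using inner_matrix_transpose[of p K w] by (simp add: inner_commute del: transpose_matrix_vector)
        then show ?thesis
          using w[OF K] w[OF RL_image[OF ps K]] by (simp add: inner_diff_left right_diff_distrib del: transpose_matrix_vector)
      qed
      finally have "of_int s * (of_int s * ((transpose p *v w - w) \<bullet> K)) = of_int s * (2 * pi * of_int m)" using m by simp
      then have "(of_int s * of_int s) * ((transpose p *v w - w) \<bullet> K) = 2 * pi * of_int (s * m)"
        by (simp only: mult.assoc of_int_mult mult.left_commute)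
      then have "(transpose p *v w - w) \<bullet> K = 2 * pi * of_int (s * m)"
        by (simp only: P_sign[OF ps] mult_1_left)
      then show "\<exists>m::int. (transpose p *v w - w) \<bullet> K = 2 * pi * of_int m" by blast
    qed
    then show ?thesis by (simp only: reciprocal_reciprocal_lattice[OF BL])
  qed
  have unit': "p *v w - w \<in> BL" if ps: "(p, s) \<in> P" for p s
    using unit[OF PD(3)[OF ps]] by (simp only: transpose_transpose)
  have "\<exists>c. cmod c = 1 \<and> (\<forall>k. AE r in lborel.
        sym_op p s (w - p *v w) (\<lambda>r. exp (\<i> * of_real (\<mu> k)) * \<phi> k r) r =
        c * (exp (\<i> * of_real (\<mu> (of_int s *\<^sub>R (p *v k)))) * \<phi> (of_int s *\<^sub>R (p *v k)) r))" if ps: "(p, s) \<in> P" for p s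
  proof -
    obtain d where d: "\<And>k. h (p, s) k = of_int s * H k - H (of_int s *\<^sub>R (p *v k)) + d"
      using h_coboundary[OF ps] by blast
    let ?R = "w - p *v w"
    have R: "- ?R \<in> BL" using unit'[OF ps] by simp
    have "AE r in lborel. sym_op p s ?R (\<lambda>r. exp (\<i> * of_real (\<mu> k)) * \<phi> k r) r =
        exp (\<i> * of_real d) * (exp (\<i> * of_real (\<mu> (of_int s *\<^sub>R (p *v k)))) * \<phi> (of_int s *\<^sub>R (p *v k)) r)" for k
    proof -
      let ?k = "of_int s *\<^sub>R (p *v k)"
      have "AE r in lborel. sym_op p s 0 (\<phi> k) (r + - ?R) = \<rho> (p, s) k * \<phi> ?k (r + - ?R)"
        by (rule AE_translate[OF BL \<rho>(2)[OF ps]])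
      moreover have "AE r in lborel. \<phi> ?k (r + - ?R) = plane_wave ?k (- ?R) * \<phi> ?k r"
        using bloch[of ?k] R unfolding bloch_functions_def by blast
      ultimately show ?thesis
      proof eventually_elim
        case (elim r)
        have "sym_op p s ?R (\<lambda>r. exp (\<i> * of_real (\<mu> k)) * \<phi> k r) r =
            exp (\<i> * of_real (of_int s * \<mu> k)) * sym_op p s 0 (\<phi> k) (r + - ?R)"
        proof -
          have eq: "r + - ?R - 0 = r - ?R" by simp
          show ?thesis by (simp only: sym_op_def tr_conj_mult tr_conj_exp[OF PD(2)[OF ps]] eq)
        qed
        also have "\<dots> = exp (\<i> * of_real (of_int s * \<mu> k)) * (exp (\<i> * of_real (h (p, s) k)) * (exp (\<i> * of_real (?k \<bullet> - ?R)) * \<phi> ?k r))"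
          unfolding elim h(2)[OF ps] plane_wave_def ..
        also have "\<dots> = exp (\<i> * of_real (of_int s * \<mu> k + h (p, s) k + ?k \<bullet> - ?R)) * \<phi> ?k r"
          by (simp add: distrib_left exp_add mult.assoc)
        \<comment> \<open>The \<open>H\<close> terms cancel by the coboundary formula. Orthogonality
          of \<open>p\<close> turns the product of the new wavevector with \<open>p *v w\<close>
          into \<open>s\<close> times that of \<open>k\<close> with \<open>w\<close>, which cancels
          the linear part of \<open>of_int s * \<mu> k\<close>.\<close>
        also have "of_int s * \<mu> k + h (p, s) k + ?k \<bullet> - ?R = d + \<mu> ?k"
        proof -
          have "(p *v k) \<bullet> (p *v w) = k \<bullet> w"
            unfolding inner_matrix_transpose orthogonal_matrix_vector_cancel[OF PD(1)[OF ps]] ..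
          then show ?thesis
            by (simp add: \<mu>_def d inner_diff_right right_diff_distrib inner_commute[of w])
        qed
        also have "exp (\<i> * of_real (d + \<mu> ?k)) = exp (\<i> * of_real d) * exp (\<i> * of_real (\<mu> ?k))"
          by (simp add: distrib_left exp_add)
        finally show ?case by (simp add: mult.assoc)
      qed
    qed
    then show ?thesis by (intro exI[of _ "exp (\<i> * of_real d)"]) simp
  qed
  then show ?thesis using cont per unit' by (intro exI[of _ \<mu>] exI[of _ w]) auto
qed

end

section \<open>The analytic symmetric section\<close>

text \<open>A trigonometric polynomial on the Brillouin torus with values between 0 and 1 that
  attains 1 exactly on \<open>RL\<close>. It is periodic because the cosines run over basis vectors
  of \<open>BL\<close>, whose products with \<open>RL\<close> are multiples of 2 pi.\<close>

definition cos_bump :: "(real^'n) set \<Rightarrow> real^'n \<Rightarrow> real" where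
  "cos_bump BL q = (\<Sum>i\<in>UNIV. (1 + cos (q \<bullet> (lattice_basis BL *v axis i 1))) / 2) / real CARD('n)"

lemma cos_bump_bounds: "0 \<le> cos_bump BL q" "cos_bump BL q \<le> 1"
proof -
  have t: "0 \<le> (1 + cos x) / 2 \<and> (1 + cos x) / 2 \<le> 1" for x :: real
  proof -
    have "- 1 \<le> cos x" "cos x \<le> 1" by (rule cos_ge_minus_one, rule cos_le_one)
    then show ?thesis by (auto simp: field_simps simp del: cos_ge_minus_one cos_le_one)
  qed
  show "0 \<le> cos_bump BL q" unfolding cos_bump_def using t by (intro divide_nonneg_nonneg sum_nonneg) auto
  have "(\<Sum>i\<in>UNIV. (1 + cos (q \<bullet> (lattice_basis BL *v axis i 1))) / 2) \<le> (\<Sum>i\<in>(UNIV::'a set). 1)"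
    using t by (intro sum_mono) auto
  then show "cos_bump BL q \<le> 1" unfolding cos_bump_def by simp
qed

lemma continuous_on_cos_bump: "continuous_on S (cos_bump BL)"
  unfolding cos_bump_def[abs_def] by (intro continuous_intros) auto

lemma cos_bump_zero: "cos_bump BL 0 = 1"
  by (simp add: cos_bump_def)

context magnetic_lattice
begin

lemma lattice_basis_axis: "lattice_basis BL *v axis i 1 \<in> BL"
  unfolding mem_lattice_iff[OF BL] lattice_basis_inv[OF BL] by (simp add: axis_def)

lemma cos_bump_periodic: "K \<in> RL \<Longrightarrow> cos_bump BL (q + K) = cos_bump BL q"
proof -
  assume K: "K \<in> RL"
  have "cos ((q + K) \<bullet> (lattice_basis BL *v axis i 1)) = cos (q \<bullet> (lattice_basis BL *v axis i 1))" for i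
  proof -
    obtain m :: int where m: "K \<bullet> (lattice_basis BL *v axis i 1) = 2 * pi * of_int m"
      using K lattice_basis_axis[of i] unfolding reciprocal_lattice_def by blast
    show ?thesis unfolding inner_add_left m
      by (simp add: cos_add cos_int_2pin sin_int_2pin)
  qed
  then show ?thesis by (simp add: cos_bump_def)
qed

text \<open>A mean of numbers at most 1 equals 1 only if all of them do. Then \<open>q\<close> pairs
  to a multiple of 2 pi with each basis vector, hence with all of \<open>BL\<close>.\<close>

lemma cos_bump_eq_1_imp: 
  assumes "cos_bump BL q = 1"
  shows "q \<in> RL"
proof -
  let ?t = "\<lambda>i. (1 + cos (q \<bullet> (lattice_basis BL *v axis i 1))) / 2"
  have "(\<Sum>i\<in>UNIV. ?t i) = real CARD('n)" using assms by (simp add: cos_bump_def)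
  then have "(\<Sum>i\<in>UNIV. 1 - ?t i) = 0" by (simp add: sum_subtractf)
  then have "1 - ?t i = 0" for i
    using sum_nonneg_eq_0_iff[of UNIV "\<lambda>i. 1 - ?t i"] cos_le_one by (auto simp: field_simps)
  then have "cos (q \<bullet> (lattice_basis BL *v axis i 1)) = 1" for i by (simp add: field_simps)
  then have ex: "\<exists>m::int. q \<bullet> (lattice_basis BL *v axis i 1) = of_int m * 2 * pi" for i
    unfolding cos_one_2pi_int[symmetric] by simp
  show ?thesis
    unfolding reciprocal_lattice_def
  proof (intro CollectI ballI)
    fix R assume "R \<in> BL"
    then have "\<forall>i. \<exists>m::int. (matrix_inv (lattice_basis BL) *v R) $ i = of_int m"
      unfolding mem_lattice_iff[OF BL] Ints_def by blast
    from choice[OF this] obtain m :: "'n \<Rightarrow> int" where m: "\<And>i. (matrix_inv (lattice_basis BL) *v R) $ i = of_int (m i)" by blast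
    have "\<forall>i. \<exists>m::int. q \<bullet> (lattice_basis BL *v axis i 1) = of_int m * 2 * pi" using ex by blast
    from choice[OF this] obtain l :: "'n \<Rightarrow> int" where l: "\<And>i. q \<bullet> (lattice_basis BL *v axis i 1) = of_int (l i) * 2 * pi" by blast
    have "R = lattice_basis BL *v (matrix_inv (lattice_basis BL) *v R)" by (simp add: lattice_basis_inv[OF BL])
    also have "matrix_inv (lattice_basis BL) *v R = (\<Sum>i\<in>UNIV. of_int (m i) *\<^sub>R axis i 1)"
      unfolding m[symmetric] using basis_expansion[of "matrix_inv (lattice_basis BL) *v R"] by (simp add: scalar_mult_eq_scaleR)
    also have "lattice_basis BL *v \<dots> = (\<Sum>i\<in>UNIV. of_int (m i) *\<^sub>R (lattice_basis BL *v axis i 1))"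
      by (simp add: matrix_vector_mult_scaleR linear_sum[OF matrix_vector_mul_linear])
    finally have "q \<bullet> R = (\<Sum>i\<in>UNIV. of_int (m i) * (of_int (l i) * 2 * pi))"
      by (simp add: inner_sum_right l)
    also have "\<dots> = 2 * pi * of_int (\<Sum>i\<in>UNIV. m i * l i)"
      by (simp add: sum_distrib_left ac_simps)
    finally show "\<exists>m::int. q \<bullet> R = 2 * pi * of_int m" by blast
  qed
qed

lemma real_analytic_at_cos_bump:
  fixes A :: "real^'n^'n"
  shows "real_analytic_at (\<lambda>k. cos_bump BL (A *v k - c)) k0"
proof -
  have "real_analytic_at (\<lambda>k. cos ((A *v k - c) \<bullet> a)) k0" for a
  proof -
    have "bounded_linear (\<lambda>z. Re (exp (\<i> * of_real (- (c \<bullet> a))) * z))"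
      by (rule bounded_linear_compose[OF bounded_linear_Re bounded_linear_mult_right])
    from real_analytic_at_bounded_linear[OF this real_analytic_at_plane_wave[of "transpose A *v a"]]
    have "real_analytic_at (\<lambda>k. Re (exp (\<i> * of_real (- (c \<bullet> a))) * plane_wave k (transpose A *v a))) k0" .
    moreover have "Re (exp (\<i> * of_real (- (c \<bullet> a))) * plane_wave k (transpose A *v a)) = cos ((A *v k - c) \<bullet> a)" for k
    proof -
      have "exp (\<i> * of_real (- (c \<bullet> a))) * plane_wave k (transpose A *v a) = exp (\<i> * of_real ((A *v k - c) \<bullet> a))"
        unfolding plane_wave_def inner_matrix_transpose[symmetric] exp_add[symmetric]
        by (simp add: inner_diff_left right_diff_distrib)
      then show ?thesis by (simp only: Re_exp) simp
    qed
    ultimately show ?thesis by simp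
  qed
  note cosan = this
  have "bounded_linear (\<lambda>x::real. x / 2 / real CARD('n))"
    by (rule bounded_linear_compose[OF bounded_linear_divide bounded_linear_divide])
  from real_analytic_at_bounded_linear[OF this real_analytic_at_sum[of UNIV, OF real_analytic_at_add[OF real_analytic_at_const[of 1] cosan]]]
  show ?thesis unfolding cos_bump_def by (simp add: sum_divide_distrib)
qed

end

text \<open>The analyticity assumption concerns the projection applied to a fixed vector, an
  expression that does not see the phase of \<open>\<phi> k\<close>. The choice
  \<open>\<phi>\<close> is continuous and already transforms with the constant phases
  \<open>c\<close>.\<close>

locale symmetric_band = continuous_band BL P \<phi>
  for BL :: "(real^'n) set" and P \<phi> +
  fixes w :: "real^'n" and c :: "'n point_op \<Rightarrow> complex"
  assumes unit: "(p, s) \<in> P \<Longrightarrow> p *v w - w \<in> BL"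
    and cmod_c: "(p, s) \<in> P \<Longrightarrow> cmod (c (p, s)) = 1"
    and symmetric: "(p, s) \<in> P \<Longrightarrow>
      AE r in lborel. sym_op p s (w - p *v w) (\<phi> k) r = c (p, s) * \<phi> (of_int s *\<^sub>R (p *v k)) r"
    and analytic: "v \<in> L2_torus BL \<Longrightarrow> real_analytic_at (\<lambda>k. cscale (cinner
      (cell_emb (\<lambda>r. plane_wave (- k) r * \<phi> k r)) (cell_emb v)) (cell_emb (\<lambda>r. plane_wave (- k) r * \<phi> k r))) k0"
begin

text \<open>Two embeddings are in use: \<open>X k\<close> embeds the envelope and carries the
  assumptions on continuity and analyticity, while \<open>\<Phi> k\<close> embeds the Bloch function
  itself and is periodic in \<open>k\<close>. On the cell they differ by a plane wave.\<close>

definition \<Phi> :: "real^'n \<Rightarrow> (real^'n) l2" where "\<Phi> k = cell_emb (\<phi> k)"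

lemma norm_\<Phi>: "norm (\<Phi> k) = 1"
  by (simp add: \<Phi>_def norm_\<phi>)

lemma \<Phi>_periodic: "K \<in> RL \<Longrightarrow> \<Phi> (k + K) = \<Phi> k"
proof -
  assume "K \<in> RL"
  then have "AE r in lborel. r \<in> unit_cell BL \<longrightarrow> \<phi> (k + K) r = \<phi> k r"
    using periodic[of K k] by (auto elim: eventually_mono)
  then show ?thesis unfolding \<Phi>_def by (rule to_l2_eqI[OF C_borel \<phi>_sq \<phi>_sq])
qed

lemma \<Phi>_cell_rep: "\<Phi> (cell_rep RL k) = \<Phi> k"
  using \<Phi>_periodic[OF diff_cell_rep_mem[OF RL], of "cell_rep RL k" k] by simp

lemma isCont_\<Phi>: "isCont \<Phi> k0"
proof -
  \<comment> \<open>The envelope is frozen at \<open>k0\<close> and only the plane wave moves.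
    Replacing \<open>r\<close> by \<open>cell_rep BL r\<close> changes nothing on the cell and makes
    the field bounded on the whole space.\<close>
  define E where "E k = cell_emb (\<lambda>r. plane_wave k (cell_rep BL r) * u k0 r)" for k
  obtain B where B: "\<And>r. norm (cell_rep BL r) \<le> B"
    using bounded_unit_cell[OF BL] cell_rep_mem[OF BL] unfolding bounded_iff by blast
  have "real_analytic_at E k0"
    unfolding E_def by (rule real_analytic_at_plane_wave_mult[OF C_borel u_sq cell_rep_measurable[OF BL] B])
  then have contE: "isCont E k0" by (rule real_analytic_at_isCont)
  have pwu: "square_integrable_on (unit_cell BL) (\<lambda>r. plane_wave k r * v r)"
    if "square_integrable_on (unit_cell BL) v" for k v
    using that by (intro square_integrable_on_bound[OF C_borel that, where B = 1]) (auto simp: norm_mult square_integrable_on_def)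
  have le: "norm (\<Phi> k - \<Phi> k0) \<le> norm (X k - X k0) + norm (E k - E k0)" for k
  proof -
    have Ek: "E k = cell_emb (\<lambda>r. plane_wave k r * u k0 r)" for k
      unfolding E_def
    proof (rule to_l2_eqI[OF C_borel _ pwu[OF u_sq]])
      show "square_integrable_on (unit_cell BL) (\<lambda>r. plane_wave k (cell_rep BL r) * u k0 r)"
      proof (rule square_integrable_on_bound[OF C_borel u_sq[of k0], where B = 1])
        have "(\<lambda>r. plane_wave k (cell_rep BL r)) \<in> borel_measurable borel"
          by (rule measurable_compose[OF cell_rep_measurable[OF BL] plane_wave_measurable])
        then show "(\<lambda>r. plane_wave k (cell_rep BL r) * u k0 r) \<in> borel_measurable borel"
          using u_sq unfolding square_integrable_on_def by (intro borel_measurable_times) auto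
      qed (simp add: norm_mult)
      show "AE r in lborel. r \<in> unit_cell BL \<longrightarrow> plane_wave k (cell_rep BL r) * u k0 r = plane_wave k r * u k0 r"
        by (simp add: cell_rep_eq[OF BL])
    qed
    have \<Phi>k: "\<Phi> k = cell_emb (\<lambda>r. plane_wave k r * u k r)" for k
      unfolding \<Phi>_def u_def by (simp add: mult.assoc[symmetric])
    have diff: "square_integrable_on (unit_cell BL) (\<lambda>r. u k r - u k0 r)"
      by (rule square_integrable_on_diff[OF C_borel u_sq u_sq])
    have "\<Phi> k - E k = cell_emb (\<lambda>r. plane_wave k r * (u k r - u k0 r))"
      unfolding \<Phi>k Ek right_diff_distrib by (rule to_l2_diff[OF C_borel pwu[OF u_sq] pwu[OF u_sq], symmetric])
    also have "norm \<dots> \<le> 1 * norm (cell_emb (\<lambda>r. u k r - u k0 r))"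
      using pwu[OF diff] by (intro norm_to_l2_le[OF C_borel diff]) (auto simp: norm_mult square_integrable_on_def)
    also have "\<dots> = norm (X k - X k0)" by (simp add: X_def to_l2_diff[OF C_borel u_sq u_sq])
    finally have "norm (\<Phi> k - E k) \<le> norm (X k - X k0)" .
    moreover have "\<Phi> k - \<Phi> k0 = (\<Phi> k - E k) + (E k - E k0)" by (simp add: \<Phi>k[of k0] Ek[of k0])
    ultimately show ?thesis using norm_triangle_ineq[of "\<Phi> k - E k" "E k - E k0"] by simp
  qed
  have "((\<lambda>k. norm (X k - X k0) + norm (E k - E k0)) \<longlongrightarrow> 0 + 0) (at k0)"
    using isCont_X[of k0] contE unfolding isCont_def
    by (intro tendsto_add) (simp_all only: tendsto_norm_zero_iff LIM_zero_iff)
  then have lim: "((\<lambda>k. norm (X k - X k0) + norm (E k - E k0)) \<longlongrightarrow> 0) (at k0)" by simp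
  have "((\<lambda>k. \<Phi> k - \<Phi> k0) \<longlongrightarrow> 0) (at k0)"
    by (rule Lim_null_comparison[OF _ lim]) (intro always_eventually allI le)
  then show ?thesis unfolding isCont_def by (simp only: LIM_zero_iff)
qed

section \<open>Overlaps and bumps on the Brillouin torus\<close>

lemma continuous_on_\<Phi>: "continuous_on S \<Phi>"
  by (intro continuous_at_imp_continuous_on ballI isCont_\<Phi>)

lemma Re_cinner_\<Phi>_le: "\<bar>Re (cinner (\<Phi> k) (\<Phi> q))\<bar> \<le> 1"
  using abs_Re_le_cmod[of "cinner (\<Phi> k) (\<Phi> q)"] cmod_cinner_le[of "\<Phi> k" "\<Phi> q"] by (simp add: norm_\<Phi>)

text \<open>By periodicity it suffices to consider wavevectors in the compact closure of the
  reciprocal cell. The pairs with small overlap form a compact set, on which the bump attains its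
  maximum; that maximum is below 1, because a bump equal to 1 means equivalent wavevectors, whose
  overlap is 1.\<close>

lemma overlap_concentrated:
  "\<exists>\<eta>. 0 \<le> \<eta> \<and> \<eta> < 1 \<and> (\<forall>k q. Re (cinner (\<Phi> k) (\<Phi> q)) \<le> 1/2 \<longrightarrow> cos_bump BL (k - q) \<le> \<eta>)"
proof -
  define K where "K = closure (unit_cell RL)"
  have K: "compact K" unfolding K_def using bounded_unit_cell[OF RL] by (simp add: compact_closure)
  have inK: "cell_rep RL k \<in> K" for k unfolding K_def using cell_rep_mem[OF RL] closure_subset by blast
  let ?S = "{x \<in> K \<times> K. Re (cinner (\<Phi> (fst x)) (\<Phi> (snd x))) \<le> 1/2}"
  have cont: "continuous_on UNIV (\<lambda>x. Re (cinner (\<Phi> (fst x)) (\<Phi> (snd x))))"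
    by (intro continuous_on_Re cinner.continuous_on continuous_on_compose2[OF continuous_on_\<Phi>[of UNIV]] continuous_intros) auto
  have "closed {x. Re (cinner (\<Phi> (fst x)) (\<Phi> (snd x))) \<le> 1/2}"
    by (rule closed_Collect_le[OF cont continuous_on_const])
  from compact_Int_closed[OF compact_Times[OF K K] this] have S: "compact ?S"
    by (rule back_subst[where P = compact]) auto
  have reduce: "cos_bump BL (cell_rep RL k - cell_rep RL q) = cos_bump BL (k - q)" for k q
  proof -
    have "(k - cell_rep RL k) - (q - cell_rep RL q) \<in> RL" by (intro lattice_diff[OF RL] diff_cell_rep_mem[OF RL])
    from cos_bump_periodic[OF this, of "cell_rep RL k - cell_rep RL q"] show ?thesis by (simp add: algebra_simps)
  qed
  show ?thesis
  proof (cases "?S = {}")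
    case True
    have "\<not> Re (cinner (\<Phi> k) (\<Phi> q)) \<le> 1/2" for k q
    proof
      assume "Re (cinner (\<Phi> k) (\<Phi> q)) \<le> 1/2"
      then have "(cell_rep RL k, cell_rep RL q) \<in> ?S" using inK by (simp add: \<Phi>_cell_rep)
      then show False using True by blast
    qed
    then show ?thesis by (intro exI[of _ 0]) auto
  next
    case False
    have "continuous_on ?S (\<lambda>x. cos_bump BL (fst x - snd x))"
      by (rule continuous_on_compose2[OF continuous_on_cos_bump[of UNIV]]) (auto intro!: continuous_intros)
    from continuous_attains_sup[OF S False this] obtain x where
      x: "x \<in> ?S" "\<And>y. y \<in> ?S \<Longrightarrow> cos_bump BL (fst y - snd y) \<le> cos_bump BL (fst x - snd x)" by blast
    have "cos_bump BL (fst x - snd x) \<noteq> 1"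
    proof
      assume "cos_bump BL (fst x - snd x) = 1"
      then have "fst x - snd x \<in> RL" by (rule cos_bump_eq_1_imp)
      from \<Phi>_periodic[OF this, of "snd x"] have "\<Phi> (fst x) = \<Phi> (snd x)" by simp
      then have "Re (cinner (\<Phi> (fst x)) (\<Phi> (snd x))) = 1" by (simp add: cinner_self norm_\<Phi>)
      then show False using x(1) by simp
    qed
    then have lt: "cos_bump BL (fst x - snd x) < 1" using cos_bump_bounds(2)[of BL "fst x - snd x"] by simp
    have "cos_bump BL (k - q) \<le> cos_bump BL (fst x - snd x)" if "Re (cinner (\<Phi> k) (\<Phi> q)) \<le> 1/2" for k q
    proof -
      have "(cell_rep RL k, cell_rep RL q) \<in> ?S" using that inK by (simp add: \<Phi>_cell_rep)
      from x(2)[OF this] show ?thesis by (simp add: reduce)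
    qed
    then show ?thesis using lt cos_bump_bounds(1) by (intro exI[of _ "cos_bump BL (fst x - snd x)"]) auto
  qed
qed

text \<open>Compactness again: around every point of the closed cell the bump exceeds
  \<open>\<eta>\<close> on an open set, and periodicity carries the finite cover over to all
  \<open>k\<close>.\<close>

lemma finite_net:
  assumes "\<eta> < 1"
  shows "\<exists>J. finite J \<and> (\<forall>k. \<exists>q\<in>J. \<eta> < cos_bump BL (k - q))"
proof -
  define K where "K = closure (unit_cell RL)"
  have K: "compact K" unfolding K_def using bounded_unit_cell[OF RL] by (simp add: compact_closure)
  have inK: "cell_rep RL k \<in> K" for k unfolding K_def using cell_rep_mem[OF RL] closure_subset by blast
  let ?U = "\<lambda>q. {k. \<eta> < cos_bump BL (k - q)}"
  have "open (?U q)" for q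
    by (intro open_Collect_less continuous_on_const continuous_on_compose2[OF continuous_on_cos_bump[of UNIV]] continuous_intros) auto
  moreover have "K \<subseteq> (\<Union>q\<in>K. ?U q)" using assms cos_bump_zero[of BL] by force
  ultimately obtain J where J: "J \<subseteq> K" "finite J" "K \<subseteq> (\<Union>q\<in>J. ?U q)"
    using compactE_image[OF K, of K ?U] by metis
  have "\<exists>q\<in>J. \<eta> < cos_bump BL (k - q)" for k
  proof -
    obtain q where q: "q \<in> J" "\<eta> < cos_bump BL (cell_rep RL k - q)" using J(3) inK[of k] by blast
    have "cos_bump BL (cell_rep RL k - q) = cos_bump BL (k - q)"
      using cos_bump_periodic[OF diff_cell_rep_mem[OF RL], of "cell_rep RL k - q" k] by simp
    then show ?thesis using q by auto
  qed
  then show ?thesis using J(2) by blast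
qed

definition overlap_sum :: "(real^'n) set \<Rightarrow> nat \<Rightarrow> real^'n \<Rightarrow> complex" where
  "overlap_sum J N k = (\<Sum>q\<in>J. of_real (cos_bump BL (k - q) ^ N) * cinner (\<Phi> k) (\<Phi> q))"

text \<open>For large powers the bumps near \<open>k\<close>, where the overlap has positive real part, outweigh the others.\<close>

lemma overlap_sum_pos: "\<exists>J N. finite J \<and> (\<forall>k. 0 < Re (overlap_sum J N k))"
proof -
  obtain \<eta> where \<eta>: "0 \<le> \<eta>" "\<eta> < 1" "\<And>k q. Re (cinner (\<Phi> k) (\<Phi> q)) \<le> 1/2 \<Longrightarrow> cos_bump BL (k - q) \<le> \<eta>"
    using overlap_concentrated by blast
  \<comment> \<open>A threshold strictly between \<open>\<eta>\<close> and 1: terms with a bump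
    above \<open>\<theta>\<close> eventually dominate those with a bump below
    \<open>\<eta>\<close>.\<close>
  define \<theta> where "\<theta> = (1 + \<eta>) / 2"
  have \<theta>: "\<eta> < \<theta>" "\<theta> < 1" "0 < \<theta>" using \<eta> by (auto simp: \<theta>_def)
  obtain J where J: "finite J" "\<And>k. \<exists>q\<in>J. \<theta> < cos_bump BL (k - q)" using finite_net[OF \<theta>(2)] by blast
  have "(\<lambda>N. (\<eta> / \<theta>) ^ N) \<longlonglongrightarrow> 0" using \<eta> \<theta> by (intro LIMSEQ_power_zero) auto
  then have "\<forall>\<^sub>F N in sequentially. (\<eta> / \<theta>) ^ N < 1 / (2 * (real (card J) + 1))"
    by (rule order_tendstoD(2)) simp
  then obtain N where N: "(\<eta> / \<theta>) ^ N < 1 / (2 * (real (card J) + 1))"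
    using eventually_happens by force
  have "(\<eta> / \<theta>) ^ N * (2 * (real (card J) + 1)) < 1"
    using N by (simp add: pos_less_divide_eq)
  then have N': "2 * (real (card J) + 1) * \<eta> ^ N < \<theta> ^ N"
    using \<theta> by (simp add: power_divide field_simps)
  have "0 < Re (overlap_sum J N k)" for k
  proof -
    obtain q0 where q0: "q0 \<in> J" "\<theta> < cos_bump BL (k - q0)" using J(2) by blast
    let ?t = "\<lambda>q. cos_bump BL (k - q) ^ N * Re (cinner (\<Phi> k) (\<Phi> q))"
    \<comment> \<open>A term can be negative only where the overlap is at most 1/2, and there the
      bump is at most \<open>\<eta>\<close>.\<close>
    have lower: "- (\<eta> ^ N) \<le> ?t q" for q
    proof (cases "Re (cinner (\<Phi> k) (\<Phi> q)) \<le> 1/2")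
      case True
      have "cos_bump BL (k - q) ^ N \<le> \<eta> ^ N" using \<eta>(3)[OF True] cos_bump_bounds(1) by (intro power_mono) auto
      moreover have "- 1 \<le> Re (cinner (\<Phi> k) (\<Phi> q))" using Re_cinner_\<Phi>_le[of k q] by linarith
      moreover have "0 \<le> cos_bump BL (k - q) ^ N" using cos_bump_bounds(1) by (intro zero_le_power)
      ultimately show ?thesis using mult_left_mono[of "- 1" "Re (cinner (\<Phi> k) (\<Phi> q))" "cos_bump BL (k - q) ^ N"] by linarith
    next
      case False
      then have "0 \<le> ?t q" using cos_bump_bounds(1) by (intro mult_nonneg_nonneg zero_le_power) auto
      then show ?thesis using \<eta>(1) zero_le_power[of \<eta> N] by linarith
    qed
    \<comment> \<open>A bump above \<open>\<theta>\<close> also exceeds \<open>\<eta>\<close>, which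
      forces the overlap with this net point above 1/2.\<close>
    have "\<not> Re (cinner (\<Phi> k) (\<Phi> q0)) \<le> 1/2" using \<eta>(3)[of k q0] q0 \<theta>(1) by fastforce
    moreover have "\<theta> ^ N \<le> cos_bump BL (k - q0) ^ N" using q0 \<theta> by (intro power_mono) auto
    ultimately have q0t: "\<theta> ^ N * (1/2) \<le> ?t q0"
      using \<theta> cos_bump_bounds(1)[of BL "k - q0"] by (intro mult_mono zero_le_power) auto
    have "Re (overlap_sum J N k) = (\<Sum>q\<in>J. ?t q)" by (simp add: overlap_sum_def flip: of_real_power)
    also have "\<dots> = ?t q0 + (\<Sum>q\<in>J - {q0}. ?t q)" using J(1) q0(1) by (rule sum.remove)
    finally have split: "Re (overlap_sum J N k) = ?t q0 + (\<Sum>q\<in>J - {q0}. ?t q)" .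
    have "(\<Sum>q\<in>J - {q0}. - (\<eta> ^ N)) \<le> (\<Sum>q\<in>J - {q0}. ?t q)" by (rule sum_mono[OF lower])
    then have "- (real (card (J - {q0})) * \<eta> ^ N) \<le> (\<Sum>q\<in>J - {q0}. ?t q)"
      unfolding sum_constant by simp
    then have "Re (overlap_sum J N k) \<ge> \<theta> ^ N * (1/2) - real (card (J - {q0})) * \<eta> ^ N"
      using q0t split by linarith
    moreover have "real (card (J - {q0})) * \<eta> ^ N \<le> (real (card J) + 1) * \<eta> ^ N"
      using J(1) \<eta>(1) card_Diff1_le[of J q0] by (intro mult_right_mono) auto
    moreover have "(real (card J) + 1) * \<eta> ^ N < \<theta> ^ N * (1/2)"
      using N' unfolding mult.assoc by linarith
    ultimately show ?thesis by linarith
  qed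
  then show ?thesis using J(1) by blast
qed

lemma continuous_on_overlap_sum: "continuous_on UNIV (overlap_sum J N)"
proof -
  have "continuous_on UNIV (\<lambda>k. cos_bump BL (k - q))" for q
    by (rule continuous_on_compose2[OF continuous_on_cos_bump[of UNIV]]) (auto intro!: continuous_intros)
  then show ?thesis
    unfolding overlap_sum_def[abs_def]
    by (intro continuous_on_sum continuous_on_mult continuous_on_of_real continuous_on_power cinner.continuous_on
        continuous_on_\<Phi> continuous_on_const)
qed

lemma overlap_sum_periodic:
  assumes K: "K \<in> RL"
  shows "overlap_sum J N (k + K) = overlap_sum J N k"
proof -
  have "cos_bump BL (k + K - q) = cos_bump BL (k - q)" for q
    using cos_bump_periodic[OF K, of "k - q"] by (simp only: diff_add_eq)
  then show ?thesis by (simp only: overlap_sum_def \<Phi>_periodic[OF K])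
qed

text \<open>Conjugating the terms with \<open>s = -1\<close> produces the equivariance of
  \<open>sym_sum_equivariant\<close>. It leaves real parts unchanged, so positivity of the real part
  of \<open>overlap_sum\<close> is inherited, which mere absence of zeros would not be.\<close>

definition sym_sum :: "(real^'n) set \<Rightarrow> nat \<Rightarrow> real^'n \<Rightarrow> complex" where
  "sym_sum J N k = (\<Sum>(p, s)\<in>P. tr_conj s (overlap_sum J N (of_int s *\<^sub>R (p *v k))))"

lemma Re_sym_sum_pos:
  assumes "\<And>k. 0 < Re (overlap_sum J N k)"
  shows "0 < Re (sym_sum J N k)"
proof -
  have "0 < (\<Sum>x\<in>P. Re (overlap_sum J N (of_int (snd x) *\<^sub>R (fst x *v k))))"
    using finite_P P_one assms by (intro sum_pos) auto
  then show ?thesis by (simp add: sym_sum_def case_prod_unfold)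
qed

lemma sym_sum_periodic: "K \<in> RL \<Longrightarrow> sym_sum J N (k + K) = sym_sum J N k"
  unfolding sym_sum_def
proof (rule sum.cong[OF refl])
  fix x assume K: "K \<in> RL" and x: "x \<in> P"
  obtain p s where x_eq: "x = (p, s)" by (cases x)
  have "of_int s *\<^sub>R (p *v (k + K)) = of_int s *\<^sub>R (p *v k) + of_int s *\<^sub>R (p *v K)"
    by (simp add: matrix_vector_right_distrib scaleR_add_right)
  then show "(case x of (p, s) \<Rightarrow> tr_conj s (overlap_sum J N (of_int s *\<^sub>R (p *v (k + K))))) =
      (case x of (p, s) \<Rightarrow> tr_conj s (overlap_sum J N (of_int s *\<^sub>R (p *v k))))"
    using overlap_sum_periodic[OF RL_image[OF _ K], of p s] x by (simp add: x_eq)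
qed

lemma sym_sum_equivariant:
  assumes qt: "(q, t) \<in> P"
  shows "sym_sum J N (of_int t *\<^sub>R (q *v k)) = tr_conj t (sym_sum J N k)"
proof -
  have "tr_conj t (sym_sum J N k) = (\<Sum>x\<in>P. tr_conj t (case x of (p, s) \<Rightarrow> tr_conj s (overlap_sum J N (of_int s *\<^sub>R (p *v k)))))"
    by (simp add: sym_sum_def tr_conj_sum)
  also have "\<dots> = (\<Sum>(p, s)\<in>P. tr_conj t (tr_conj (s * t) (overlap_sum J N (of_int (s * t) *\<^sub>R ((p ** q) *v k)))))"
    using sum_P_right_mult[OF qt, of "\<lambda>x. tr_conj t (case x of (p, s) \<Rightarrow> tr_conj s (overlap_sum J N (of_int s *\<^sub>R (p *v k))))", symmetric]
    by simp
  also have "\<dots> = sym_sum J N (of_int t *\<^sub>R (q *v k))"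
    unfolding sym_sum_def
  proof (rule sum.cong[OF refl])
    fix x assume x: "x \<in> P"
    obtain p s where x_eq: "x = (p, s)" by (cases x)
    have s: "s \<in> {1, -1}" and t: "t \<in> {1, -1}" using PD(2) x x_eq qt by auto
    have "tr_conj t (tr_conj (s * t) a) = tr_conj s a" for a
      using s t by (auto simp: tr_conj_def)
    moreover have "of_int (s * t) *\<^sub>R ((p ** q) *v k) = of_int s *\<^sub>R (p *v (of_int t *\<^sub>R (q *v k)))"
      by (simp add: matrix_vector_mul_assoc[symmetric] matrix_vector_mult_scaleR)
    ultimately show "(case x of (p, s) \<Rightarrow> tr_conj t (tr_conj (s * t) (overlap_sum J N (of_int (s * t) *\<^sub>R ((p ** q) *v k))))) =
        (case x of (p, s) \<Rightarrow> tr_conj s (overlap_sum J N (of_int s *\<^sub>R (p *v (of_int t *\<^sub>R (q *v k))))))"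
      by (simp add: x_eq)
  qed
  finally show ?thesis by simp
qed

lemma continuous_on_sym_sum: "continuous_on UNIV (sym_sum J N)"
proof -
  have "continuous_on UNIV (\<lambda>k. overlap_sum J N (of_int s *\<^sub>R (p *v k)))" for p s
    by (rule continuous_on_compose2[OF continuous_on_overlap_sum])
      (intro continuous_on_scaleR continuous_on_const matrix_vector_mult_linear_continuous_on, simp)
  moreover have "continuous_on UNIV (\<lambda>k. tr_conj s (f k))" if "continuous_on UNIV f" for s f
    using that by (cases "s = -1") (simp_all add: tr_conj_def continuous_on_cnj)
  ultimately show ?thesis
    unfolding sym_sum_def[abs_def] case_prod_unfold by (intro continuous_on_sum) blast
qed

end

lemma scaleR_matrix_vector: "a *\<^sub>R (A *v x) = (a *\<^sub>R A) *v x" for A :: "real^'n^'m"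
  by (simp add: scaleR_matrix_vector_assoc)

context magnetic_lattice
begin

lemma point_op_cancel:
  assumes "(p, s) \<in> P"
  shows "of_int s *\<^sub>R (p *v (of_int s *\<^sub>R (transpose p *v k))) = k"
    "of_int s *\<^sub>R (transpose p *v (of_int s *\<^sub>R (p *v k))) = k"
  using P_sign[OF assms]
  by (simp_all add: matrix_vector_mult_scaleR orthogonal_matrix_vector_cancel[OF PD(1)[OF assms]] del: transpose_matrix_vector)

lemma orthogonal_transformation_point_op:
  assumes ps: "(p, s) \<in> P"
  shows "orthogonal_transformation (\<lambda>k. of_int s *\<^sub>R (p *v k))"
proof -
  have p: "orthogonal_transformation (\<lambda>k. p *v k)"
    using orthogonal_transformation_transpose[OF PD(1)[OF PD(3)[OF ps]]] by (simp only: transpose_transpose)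
  have "linear (\<lambda>k. of_int s *\<^sub>R (p *v k))"
    by (intro linear_compose_scale_right orthogonal_transformation_linear[OF p])
  moreover have "norm (of_int s *\<^sub>R (p *v k)) = norm k" for k
  proof -
    have "\<bar>of_int s :: real\<bar> = 1" using PD(2)[OF ps] by auto
    then show ?thesis by (simp add: orthogonal_transformation_norm[OF p])
  qed
  ultimately show ?thesis unfolding orthogonal_transformation by blast
qed

lemma point_op_RL:
  assumes ps: "(p, s) \<in> P"
  shows "(\<lambda>k. of_int s *\<^sub>R (p *v k)) ` RL = RL"
proof (intro Set.set_eqI iffI)
  fix K assume "K \<in> RL"
  then have "of_int s *\<^sub>R (transpose p *v K) \<in> RL" by (rule RL_image[OF PD(3)[OF ps]])
  then show "K \<in> (\<lambda>k. of_int s *\<^sub>R (p *v k)) ` RL"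
    by (rule image_eqI[rotated]) (simp only: point_op_cancel(1)[OF ps])
next
  fix K assume "K \<in> (\<lambda>k. of_int s *\<^sub>R (p *v k)) ` RL"
  then show "K \<in> RL" using RL_image[OF ps] by blast
qed

end

section \<open>The symmetrized overlaps as an analytic inner product\<close>

context symmetric_band
begin

text \<open>The negative of the representative of \<open>r\<close> modulo \<open>BL\<close> in the
  transformed cell, that is, the image of the unit cell under the operation of \<open>q\<close> with
  translation \<open>w - q *v w\<close>. It is bounded and lattice-periodic.\<close>

definition shift_field :: "real^'n^'n \<Rightarrow> real^'n \<Rightarrow> real^'n" where
  "shift_field q r = q *v w - w - q *v cell_rep BL (transpose q *v (r - (w - q *v w)))"

text \<open>The values of \<open>\<phi> \<kappa>\<close> on the cell, extended periodically without
  a Bloch phase and transported by the operation. The missing phase is supplied by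
  \<open>shift_field\<close>.\<close>

definition trial :: "real^'n^'n \<Rightarrow> int \<Rightarrow> real^'n \<Rightarrow> real^'n \<Rightarrow> complex" where
  "trial q t \<kappa> = sym_op q t (w - q *v w) (\<lambda>r. \<phi> \<kappa> (cell_rep BL r))"

lemma trial_torus:
  assumes qt: "(q, t) \<in> P"
  shows "trial q t \<kappa> \<in> L2_torus BL"
proof -
  have "(\<lambda>r. \<phi> \<kappa> (cell_rep BL r)) \<in> bloch_functions BL 0"
    using bloch_extension(1)[OF BL \<phi>_sq, of 0] by simp
  from sym_op_bloch[OF qt this] show ?thesis by (simp add: trial_def bloch_functions_0)
qed

lemma trial_sq: "(q, t) \<in> P \<Longrightarrow> square_integrable_on (unit_cell BL) (trial q t \<kappa>)"
  by (rule L2_torus_square_integrable_on[OF BL trial_torus])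

lemma shift_field_measurable:
  assumes qt: "(q, t) \<in> P"
  shows "shift_field q \<in> borel_measurable borel"
proof -
  have m: "(\<lambda>r. A *v r) \<in> borel_measurable borel" for A :: "real^'n^'n"
    by (intro borel_measurable_continuous_onI matrix_vector_mult_linear_continuous_on)
  have "(\<lambda>r. q *v cell_rep BL (transpose q *v (r - (w - q *v w)))) \<in> borel_measurable borel"
    by (rule measurable_compose[OF measurable_compose[OF distr_transpose_affine(2)[OF PD(1)[OF qt]] cell_rep_measurable[OF BL]] m])
  then show ?thesis unfolding shift_field_def[abs_def] by (intro borel_measurable_diff borel_measurable_const)
qed

lemma shift_field_bounded: "\<exists>B. \<forall>r. norm (shift_field q r) \<le> B"
proof -
  have "bounded ((\<lambda>x. q *v x) ` unit_cell BL)"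
    by (intro bounded_linear_image bounded_unit_cell[OF BL]) simp
  then obtain B where B: "\<And>x. x \<in> unit_cell BL \<Longrightarrow> norm (q *v x) \<le> B"
    unfolding bounded_iff by blast
  have "norm (q *v w - w - q *v x) \<le> norm (q *v w - w) + B" if "x \<in> unit_cell BL" for x
    using norm_triangle_ineq4[of "q *v w - w" "q *v x"] B[OF that] by linarith
  then show ?thesis using cell_rep_mem[OF BL] unfolding shift_field_def by blast
qed

lemma plane_wave_trial_sq:
  assumes qt: "(q, t) \<in> P"
  shows "square_integrable_on (unit_cell BL) (\<lambda>r. plane_wave k (shift_field q r) * trial q t \<kappa> r)"
proof (rule square_integrable_on_bound[OF C_borel trial_sq[OF qt, of \<kappa>], where B = 1])
  have "(\<lambda>r. plane_wave k (shift_field q r)) \<in> borel_measurable borel"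
    by (rule measurable_compose[OF shift_field_measurable[OF qt] plane_wave_measurable])
  then show "(\<lambda>r. plane_wave k (shift_field q r) * trial q t \<kappa> r) \<in> borel_measurable borel"
    using trial_sq[OF qt, of \<kappa>] unfolding square_integrable_on_def by (intro borel_measurable_times) simp_all
qed (simp add: norm_mult)

text \<open>The left-hand side is an integral over the image of the unit cell under the operation. The
  trial function moves it back to the unit cell, at the price of a plane wave factor that is
  explicit in \<open>k\<close> and hence analytic.\<close>

lemma tr_conj_overlap:
  assumes qt: "(q, t) \<in> P"
  shows "tr_conj t (cinner (\<Phi> (of_int t *\<^sub>R (transpose q *v k))) (\<Phi> \<kappa>)) =
    cnj (c (q, t)) * cinner (X k) (cell_emb (\<lambda>r. plane_wave k (shift_field q r) * trial q t \<kappa> r))"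
proof -
  let ?k = "of_int t *\<^sub>R (transpose q *v k)" and ?v = "w - q *v w" and ?C = "unit_cell BL"
  note q = PD(1)[OF qt]
  note cancel = orthogonal_matrix_vector_cancel[OF q]
  define h where "h r = cnj (u k r) * (plane_wave k (shift_field q r) * trial q t \<kappa> r)" for r
  have q_orth: "orthogonal_transformation (\<lambda>r. q *v r)"
    using orthogonal_transformation_transpose[OF PD(1)[OF PD(3)[OF qt]]] by (simp only: transpose_transpose)
  have hm: "h \<in> borel_measurable borel"
  proof -
    have m: "u k \<in> borel_measurable borel" "(\<lambda>r. plane_wave k (shift_field q r) * trial q t \<kappa> r) \<in> borel_measurable borel"
      using plane_wave_trial_sq[OF qt, of k \<kappa>] u_sq[of k] unfolding square_integrable_on_def by simp_all
    show ?thesis unfolding h_def[abs_def] by (rule borel_measurable_times[OF borel_measurable_cnj[OF m(1)] m(2)])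
  qed
  have hper: "AE r in lborel. h (r + R) = h r" if R: "R \<in> BL" for R
  proof -
    have ae1: "AE r in lborel. u k (r + R) = u k r" using u_torus[of k] R by (simp add: L2_torus_def)
    have ae2: "AE r in lborel. trial q t \<kappa> (r + R) = trial q t \<kappa> r"
      using trial_torus[OF qt, of \<kappa>] R by (simp add: L2_torus_def)
    have sh: "shift_field q (r + R) = shift_field q r" for r
    proof -
      have "r + R - ?v = (r - ?v) + R" by simp
      then have "transpose q *v (r + R - ?v) = transpose q *v (r - ?v) + transpose q *v R"
        by (simp only: matrix_vector_right_distrib)
      then show ?thesis
        unfolding shift_field_def using cell_rep_add[OF BL PD(4)[OF PD(3)[OF qt] R]] by simp
    qed
    from ae1 ae2 show ?thesis unfolding h_def by eventually_elim (simp add: sh)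
  qed
  have "AE r in lborel. sym_op q t ?v (\<phi> ?k) r = c (q, t) * \<phi> k r"
    using symmetric[OF qt, of ?k] unfolding point_op_cancel(1)[OF qt] .
  then have sym: "AE r in lborel. sym_op q t ?v (\<phi> ?k) (q *v r + ?v) = c (q, t) * \<phi> k (q *v r + ?v)"
    by (rule AE_lborel_transform[OF lborel_distr_orthogonal_affine[OF q_orth]])
  have inv: "transpose q *v (q *v r + ?v - ?v) = r" for r by (simp add: cancel del: transpose_matrix_vector)
  have hg: "AE r in lborel. r \<in> ?C \<longrightarrow> h (q *v r + ?v) = c (q, t) * tr_conj t (cnj (\<phi> ?k r) * \<phi> \<kappa> r)"
    using sym
  proof eventually_elim
    case (elim r)
    show ?case
    proof
      assume r: "r \<in> ?C"
      have rep: "cell_rep BL r = r" by (rule cell_rep_eq[OF BL r])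
      have tr: "trial q t \<kappa> (q *v r + ?v) = tr_conj t (\<phi> \<kappa> r)" by (simp only: trial_def sym_op_def inv rep)
      \<comment> \<open>On the transformed cell the field is exactly minus the position, so its
        plane wave cancels the one that distinguishes \<open>u k\<close> from
        \<open>\<phi> k\<close>.\<close>
      have sh: "shift_field q (q *v r + ?v) = - (q *v r + ?v)" by (simp only: shift_field_def inv rep) simp
      have uk: "cnj (u k (q *v r + ?v)) = plane_wave k (q *v r + ?v) * cnj (\<phi> k (q *v r + ?v))"
        by (simp add: u_def cnj_plane_wave)
      have "tr_conj t (\<phi> ?k r) = c (q, t) * \<phi> k (q *v r + ?v)" using elim by (simp only: sym_op_def inv)
      then have "cnj (tr_conj t (\<phi> ?k r)) = cnj (c (q, t)) * cnj (\<phi> k (q *v r + ?v))" by simp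
      then have "c (q, t) * cnj (tr_conj t (\<phi> ?k r)) = (c (q, t) * cnj (c (q, t))) * cnj (\<phi> k (q *v r + ?v))" by simp
      moreover have "c (q, t) * cnj (c (q, t)) = 1"
        using cmod_c[OF qt] by (simp add: complex_norm_square[symmetric])
      ultimately have ph: "cnj (\<phi> k (q *v r + ?v)) = c (q, t) * tr_conj t (cnj (\<phi> ?k r))"
        by (simp add: tr_conj_def split: if_splits)
      have "h (q *v r + ?v) = (plane_wave k (q *v r + ?v) * plane_wave k (- (q *v r + ?v))) *
          (cnj (\<phi> k (q *v r + ?v)) * tr_conj t (\<phi> \<kappa> r))"
        unfolding h_def uk tr sh by (simp only: ac_simps)
      also have "plane_wave k (q *v r + ?v) * plane_wave k (- (q *v r + ?v)) = 1"
        unfolding plane_wave_uminus_right by simp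
      finally show "h (q *v r + ?v) = c (q, t) * tr_conj t (cnj (\<phi> ?k r) * \<phi> \<kappa> r)"
        unfolding ph by (simp add: tr_conj_mult)
    qed
  qed
  have "cinner (X k) (cell_emb (\<lambda>r. plane_wave k (shift_field q r) * trial q t \<kappa> r)) = (LINT r:?C|lborel. h r)"
    unfolding X_def h_def by (rule cinner_to_l2[OF C_borel u_sq plane_wave_trial_sq[OF qt]])
  also have "\<dots> = (LINT r:?C|lborel. h (q *v r + ?v))"
    by (rule cell_integral_transform[OF BL q_orth PD(5)[OF qt] hm hper, symmetric])
  also have "\<dots> = (LINT r:?C|lborel. c (q, t) * tr_conj t (cnj (\<phi> ?k r) * \<phi> \<kappa> r))"
  proof (rule set_lebesgue_integral_cong_AE)
    show "?C \<in> sets lborel" using C_borel by simp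
    show "(\<lambda>r. h (q *v r + ?v)) \<in> borel_measurable lborel"
      using measurable_compose[OF lborel_distr_orthogonal_affine(2)[OF q_orth] hm] by simp
    show "(\<lambda>r. c (q, t) * tr_conj t (cnj (\<phi> ?k r) * \<phi> \<kappa> r)) \<in> borel_measurable lborel"
      using \<phi>_meas by (simp add: borel_measurable_times tr_conj_measurable borel_measurable_cnj)
    show "AE r\<in>?C in lborel. h (q *v r + ?v) = c (q, t) * tr_conj t (cnj (\<phi> ?k r) * \<phi> \<kappa> r)" by (rule hg)
  qed
  also have "\<dots> = c (q, t) * tr_conj t (LINT r:?C|lborel. cnj (\<phi> ?k r) * \<phi> \<kappa> r)"
  proof -
    have "indicat_real ?C r *\<^sub>R (c (q, t) * tr_conj t (cnj (\<phi> ?k r) * \<phi> \<kappa> r)) =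
        c (q, t) * tr_conj t (indicat_real ?C r *\<^sub>R (cnj (\<phi> ?k r) * \<phi> \<kappa> r))" for r
      by (simp add: indicator_def tr_conj_def)
    then show ?thesis unfolding set_lebesgue_integral_def by (simp only: integral_mult_right_zero integral_tr_conj)
  qed
  also have "(LINT r:?C|lborel. cnj (\<phi> ?k r) * \<phi> \<kappa> r) = cinner (\<Phi> ?k) (\<Phi> \<kappa>)"
    unfolding \<Phi>_def by (rule cinner_to_l2[OF C_borel \<phi>_sq \<phi>_sq, symmetric])
  finally have "cnj (c (q, t)) * cinner (X k) (cell_emb (\<lambda>r. plane_wave k (shift_field q r) * trial q t \<kappa> r)) =
      (cnj (c (q, t)) * c (q, t)) * tr_conj t (cinner (\<Phi> ?k) (\<Phi> \<kappa>))" by simp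
  moreover have "cnj (c (q, t)) * c (q, t) = 1"
    using cmod_c[OF qt] by (simp add: complex_norm_square[symmetric] mult.commute[of "cnj _"])
  ultimately show ?thesis by simp
qed

text \<open>Collects all kets so that \<open>sym_sum\<close> is the inner product of
  \<open>X k\<close> with one vector. That vector involves \<open>\<phi>\<close> only at the
  finitely many \<open>\<kappa>\<close> in \<open>J\<close>, hence is analytic in \<open>k\<close>.
  Transposes occur because \<open>tr_conj_overlap\<close> evaluates at the transposed
  operation.\<close>

definition trial_sum :: "(real^'n) set \<Rightarrow> nat \<Rightarrow> real^'n \<Rightarrow> (real^'n) l2" where
  "trial_sum J N k = (\<Sum>x\<in>P. \<Sum>\<kappa>\<in>J. cos_bump BL ((of_int (snd x) *\<^sub>R fst x) *v k - \<kappa>) ^ N *\<^sub>R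
     cscale (cnj (c (transpose (fst x), snd x)))
       (cell_emb (\<lambda>r. plane_wave k (shift_field (transpose (fst x)) r) * trial (transpose (fst x)) (snd x) \<kappa> r)))"

lemma sym_sum_eq: "sym_sum J N k = cinner (X k) (trial_sum J N k)"
  unfolding sym_sum_def trial_sum_def cinner.sum_right
proof (rule sum.cong[OF refl])
  fix x assume x: "x \<in> P"
  obtain p s where x_eq: "x = (p, s)" by (cases x)
  have ps: "(transpose p, s) \<in> P" using PD(3) x x_eq by blast
  have "tr_conj s (overlap_sum J N (of_int s *\<^sub>R (p *v k))) =
      (\<Sum>\<kappa>\<in>J. of_real (cos_bump BL (of_int s *\<^sub>R (p *v k) - \<kappa>) ^ N) * tr_conj s (cinner (\<Phi> (of_int s *\<^sub>R (p *v k))) (\<Phi> \<kappa>)))"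
    by (simp only: overlap_sum_def tr_conj_sum tr_conj_mult tr_conj_of_real)
  also have "\<dots> = (\<Sum>\<kappa>\<in>J. cinner (X k) (cos_bump BL ((of_int s *\<^sub>R p) *v k - \<kappa>) ^ N *\<^sub>R
     cscale (cnj (c (transpose p, s))) (cell_emb (\<lambda>r. plane_wave k (shift_field (transpose p) r) * trial (transpose p) s \<kappa> r))))"
    using tr_conj_overlap[OF ps, of k]
    by (simp only: transpose_transpose cinner.scaleR_right cinner_cscale_right scaleR_conv_of_real[where 'a = complex] scaleR_matrix_vector)
  finally show "(case x of (p, s) \<Rightarrow> tr_conj s (overlap_sum J N (of_int s *\<^sub>R (p *v k)))) =
      (\<Sum>\<kappa>\<in>J. cinner (X k) (cos_bump BL ((of_int (snd x) *\<^sub>R fst x) *v k - \<kappa>) ^ N *\<^sub>R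
     cscale (cnj (c (transpose (fst x), snd x)))
       (cell_emb (\<lambda>r. plane_wave k (shift_field (transpose (fst x)) r) * trial (transpose (fst x)) (snd x) \<kappa> r))))"
    by (simp only: x_eq fst_conv snd_conv prod.case)
qed

lemma real_analytic_at_trial_sum: "real_analytic_at (trial_sum J N) k0"
  unfolding trial_sum_def[abs_def]
proof (intro real_analytic_at_sum)
  fix x \<kappa> assume x: "x \<in> P"
  obtain p s where x_eq: "x = (p, s)" by (cases x)
  have ps: "(transpose p, s) \<in> P" using PD(3) x x_eq by blast
  obtain B where B: "\<And>r. norm (shift_field (transpose p) r) \<le> B" using shift_field_bounded by blast
  have 1: "real_analytic_at (\<lambda>k. cell_emb (\<lambda>r. plane_wave k (shift_field (transpose p) r) * trial (transpose p) s \<kappa> r)) k0"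
    by (rule real_analytic_at_plane_wave_mult[OF C_borel trial_sq[OF ps] shift_field_measurable[OF ps] B])
  have 2: "real_analytic_at (\<lambda>k. cos_bump BL ((of_int s *\<^sub>R p) *v k - \<kappa>) ^ N) k0"
    by (rule real_analytic_at_power[OF real_analytic_at_cos_bump])
  have 3: "real_analytic_at (\<lambda>k. cscale (cnj (c (transpose p, s)))
      (cell_emb (\<lambda>r. plane_wave k (shift_field (transpose p) r) * trial (transpose p) s \<kappa> r))) k0"
    by (rule real_analytic_at_bounded_linear[OF cscale.bounded_linear_right 1])
  show "real_analytic_at (\<lambda>k. cos_bump BL ((of_int (snd x) *\<^sub>R fst x) *v k - \<kappa>) ^ N *\<^sub>R
     cscale (cnj (c (transpose (fst x), snd x)))
       (cell_emb (\<lambda>r. plane_wave k (shift_field (transpose (fst x)) r) * trial (transpose (fst x)) (snd x) \<kappa> r))) k0"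
    unfolding x_eq fst_conv snd_conv by (rule real_analytic_at_bounded_bilinear[OF bounded_bilinear_scaleR 2 3])
qed

text \<open>Near \<open>k0\<close> the projection applied to \<open>X k0\<close> is an analytic multiple of \<open>X k\<close>; normalizing it
  together with the overlap sum leaves exactly the phase of the latter.\<close>

lemma real_analytic_at_section:
  assumes pos: "\<And>k. 0 < Re (overlap_sum J N k)"
  shows "real_analytic_at (\<lambda>k. cscale (sgn (sym_sum J N k)) (X k)) k0"
proof -
  \<comment> \<open>The projection at \<open>k\<close> applied to the fixed vector
    \<open>X k0\<close>, the analytic substitute for \<open>X k\<close>.\<close>
  define W where "W k = cscale (cinner (X k) (X k0)) (X k)" for k
  \<comment> \<open>Here \<open>W k\<close> occurs once as bra and once as ket, so the coefficients
    from the projection combine to a squared modulus, and the only phase left in front of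
    \<open>X k\<close> is that of \<open>sym_sum\<close>.\<close>
  define Y where "Y k = cscale (cinner (W k) (trial_sum J N k)) (W k)" for k
  have "real_analytic_at W k0"
    unfolding W_def X_def u_def using analytic[OF u_torus[of k0], of k0] unfolding u_def .
  moreover from real_analytic_at_bounded_bilinear[OF bounded_bilinear_cinner this real_analytic_at_trial_sum]
  have "real_analytic_at (\<lambda>k. cinner (W k) (trial_sum J N k)) k0" .
  ultimately have Y: "real_analytic_at Y k0"
    unfolding Y_def by (intro real_analytic_at_bounded_bilinear[OF bounded_bilinear_cscale])
  have Y_eq: "Y k = cscale (of_real ((cmod (cinner (X k) (X k0)))\<^sup>2) * sym_sum J N k) (X k)" for k
    unfolding Y_def W_def cinner_cscale_left cscale_cscale sym_sum_eq complex_norm_square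
    by (simp only: ac_simps)
  have sym_nz: "sym_sum J N k \<noteq> 0" for k using Re_sym_sum_pos[OF pos, of k] by auto
  have X0: "cinner (X k0) (X k0) = 1" by (simp add: cinner_self norm_X)
  have "Y k0 \<noteq> 0"
  proof
    assume "Y k0 = 0"
    then have "norm (Y k0) = 0" by simp
    then show False using sym_nz[of k0] unfolding Y_eq norm_cscale norm_X X0 by simp
  qed
  then have "real_analytic_at (\<lambda>k. Y k /\<^sub>R norm (Y k)) k0" by (rule real_analytic_at_normalize[OF Y])
  moreover have "\<forall>\<^sub>F k in nhds k0. Y k /\<^sub>R norm (Y k) = cscale (sgn (sym_sum J N k)) (X k)"
  proof -
    \<comment> \<open>The overlap is 1 at \<open>k0\<close>, so by continuity it stays nonzero
      nearby; only there does normalizing \<open>Y k\<close> give the section.\<close>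
    have "((\<lambda>k. cinner (X k) (X k0)) \<longlongrightarrow> cinner (X k0) (X k0)) (nhds k0)"
      using isCont_X[of k0] unfolding isCont_def tendsto_at_iff_tendsto_nhds
      by (intro cinner.tendsto tendsto_const)
    then have "\<forall>\<^sub>F k in nhds k0. cinner (X k) (X k0) \<noteq> 0"
      unfolding X0 by (rule tendsto_imp_eventually_ne) simp
    then show ?thesis
    proof eventually_elim
      case (elim k)
      let ?a = "(cmod (cinner (X k) (X k0)))\<^sup>2"
      have a: "?a > 0" using elim by simp
      have n: "norm (Y k) = ?a * cmod (sym_sum J N k)"
        unfolding Y_eq norm_cscale norm_X norm_mult by (simp add: norm_power)
      have "Y k /\<^sub>R norm (Y k) = cscale (of_real (inverse (norm (Y k))) * (of_real ?a * sym_sum J N k)) (X k)"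
        unfolding cscale_scaleR[symmetric] Y_eq[of k] cscale_cscale ..
      also have "of_real (inverse (norm (Y k))) * (of_real ?a * sym_sum J N k) = sgn (sym_sum J N k)"
        unfolding n using a sym_nz[of k] by (simp add: sgn_div_norm scaleR_conv_of_real field_simps)
      finally show ?case .
    qed
  qed
  ultimately show ?thesis by (rule real_analytic_at_cong)
qed

text \<open>The phase \<open>\<sigma>\<close> of \<open>sym_sum\<close> is periodic and equivariant,
  so multiplying by it preserves periodicity and the constants \<open>c\<close>. Analyticity comes
  from \<open>real_analytic_at_section\<close>, and continuity of the embedded section gives the
  jointly measurable representatives that the Wannier integrals require.\<close>

lemma analytic_symmetric_section:
  "\<exists>\<zeta>. (\<forall>k. \<zeta> k \<in> bloch_functions BL k) \<and>
    (\<forall>k. \<exists>a. cmod a = 1 \<and> (AE r in lborel. \<zeta> k r = a * \<phi> k r)) \<and>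
    (\<forall>k0. real_analytic_at (\<lambda>k. cell_emb (\<lambda>r. plane_wave (- k) r * \<zeta> k r)) k0) \<and>
    (\<forall>k. \<forall>K\<in>RL. AE r in lborel. \<zeta> (k + K) r = \<zeta> k r) \<and>
    (\<lambda>(k, r). \<zeta> k r) \<in> borel_measurable (borel \<Otimes>\<^sub>M borel) \<and>
    (\<forall>(p, s)\<in>P. \<forall>k. AE r in lborel. sym_op p s (w - p *v w) (\<zeta> k) r = c (p, s) * \<zeta> (of_int s *\<^sub>R (p *v k)) r)"
proof -
  obtain J N where pos: "\<And>k. 0 < Re (overlap_sum J N k)" using overlap_sum_pos by blast
  define \<sigma> where "\<sigma> k = sgn (sym_sum J N k)" for k
  have nz: "sym_sum J N k \<noteq> 0" for k using Re_sym_sum_pos[OF pos, of k] by auto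
  have cmod_\<sigma>: "cmod (\<sigma> k) = 1" for k using nz[of k] by (simp add: \<sigma>_def norm_sgn)
  have \<sigma>_per: "\<sigma> (k + K) = \<sigma> k" if "K \<in> RL" for k K by (simp add: \<sigma>_def sym_sum_periodic[OF that])
  have \<sigma>_eq: "\<sigma> (of_int s *\<^sub>R (p *v k)) = tr_conj s (\<sigma> k)" if "(p, s) \<in> P" for p s k
    unfolding \<sigma>_def sym_sum_equivariant[OF that] by (simp add: tr_conj_def sgn_div_norm)
  define Z where "Z k = cscale (\<sigma> k) (\<Phi> k)" for k
  have "continuous_on UNIV \<sigma>"
    unfolding \<sigma>_def sgn_div_norm using nz
    by (intro continuous_on_scaleR continuous_on_inverse continuous_on_norm continuous_on_sym_sum) simp
  then have Zc: "continuous_on UNIV Z"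
    unfolding Z_def by (intro cscale.continuous_on continuous_on_\<Phi>)
  have Z_emb: "Z k = cell_emb (\<lambda>r. \<sigma> k * \<phi> k r)" for k
    unfolding Z_def \<Phi>_def by (rule to_l2_cmult[OF C_borel \<phi>_sq, symmetric])
  have \<sigma>\<phi>: "(\<lambda>r. \<sigma> k * \<phi> k r) \<in> bloch_functions BL k" for k by (rule bloch_functions_cmult[OF bloch])
  obtain \<zeta>0 where joint: "(\<lambda>(k, r). \<zeta>0 k r) \<in> borel_measurable (borel \<Otimes>\<^sub>M borel)"
    and \<zeta>0: "\<And>k. square_integrable (\<zeta>0 k)" "\<And>k. abs_l2 (\<zeta>0 k) = Z k"
    using jointly_measurable_representative[OF Zc] by blast
  \<comment> \<open>The representative \<open>\<zeta>0\<close> has the right values only on the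
    cell; they are kept there and continued by the Bloch condition, which preserves joint
    measurability.\<close>
  define \<zeta> where "\<zeta> k r = plane_wave k (r - cell_rep BL r) * \<zeta>0 k (cell_rep BL r)" for k r
  note sq0 = square_integrable_imp_on[OF C_borel \<zeta>0(1)]
  have \<zeta>_bloch: "\<zeta> k \<in> bloch_functions BL k" for k
    using bloch_extension(1)[OF BL sq0, of k k] unfolding \<zeta>_def[abs_def] .
  have "cell_emb (\<zeta> k) = cell_emb (\<lambda>r. \<sigma> k * \<phi> k r)" for k
  proof -
    have "cell_emb (\<zeta> k) = cell_emb (\<zeta>0 k)"
      using bloch_extension(2)[OF BL sq0, of k k] unfolding \<zeta>_def[abs_def] .
    also have "\<dots> = restrict_l2 (unit_cell BL) (Z k)"
      unfolding \<zeta>0(2)[symmetric] by (rule restrict_l2_abs[OF C_borel \<zeta>0(1), symmetric])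
    also have "\<dots> = Z k"
      unfolding Z_emb by (rule restrict_l2_to_l2[OF C_borel bloch_square_integrable_on[OF BL \<sigma>\<phi>]])
    finally show ?thesis by (simp only: Z_emb)
  qed
  then have \<zeta>_ae: "AE r in lborel. \<zeta> k r = \<sigma> k * \<phi> k r" for k
    using bloch_emb_eq_iff[OF BL \<zeta>_bloch \<sigma>\<phi>] by blast
  have per: "AE r in lborel. \<zeta> (k + K) r = \<zeta> k r" if K: "K \<in> RL" for k K
    using \<zeta>_ae[of "k + K"] \<zeta>_ae[of k] periodic[OF K, of k] by eventually_elim (simp add: \<sigma>_per[OF K])
  have an: "real_analytic_at (\<lambda>k. cell_emb (\<lambda>r. plane_wave (- k) r * \<zeta> k r)) k0" for k0
  proof -
    have "cell_emb (\<lambda>r. plane_wave (- k) r * \<zeta> k r) = cscale (\<sigma> k) (X k)" for k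
    proof -
      have "cell_emb (\<lambda>r. plane_wave (- k) r * \<zeta> k r) = cell_emb (\<lambda>r. \<sigma> k * u k r)"
      proof (rule to_l2_eqI[OF C_borel])
        show "square_integrable_on (unit_cell BL) (\<lambda>r. plane_wave (- k) r * \<zeta> k r)"
          by (rule L2_torus_square_integrable_on[OF BL bloch_functions_L2_torus[OF \<zeta>_bloch]])
        show "square_integrable_on (unit_cell BL) (\<lambda>r. \<sigma> k * u k r)" by (rule square_integrable_on_cmult[OF C_borel u_sq])
        show "AE r in lborel. r \<in> unit_cell BL \<longrightarrow> plane_wave (- k) r * \<zeta> k r = \<sigma> k * u k r"
          using \<zeta>_ae[of k] by eventually_elim (simp add: u_def)
      qed
      then show ?thesis unfolding X_def to_l2_cmult[OF C_borel u_sq] .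
    qed
    then show ?thesis using real_analytic_at_section[OF pos, of k0] by (simp add: \<sigma>_def)
  qed
  have sym: "AE r in lborel. sym_op p s (w - p *v w) (\<zeta> k) r = c (p, s) * \<zeta> (of_int s *\<^sub>R (p *v k)) r"
    if ps: "(p, s) \<in> P" for p s k
  proof -
    have "AE r in lborel. sym_op p s (w - p *v w) (\<zeta> k) r = sym_op p s (w - p *v w) (\<lambda>r. \<sigma> k * \<phi> k r) r"
      by (rule sym_op_AE_cong[OF PD(1)[OF ps] \<zeta>_ae])
    with symmetric[OF ps, of k] \<zeta>_ae[of "of_int s *\<^sub>R (p *v k)"] show ?thesis
    proof eventually_elim
      case (elim r)
      have "sym_op p s (w - p *v w) (\<zeta> k) r = tr_conj s (\<sigma> k) * sym_op p s (w - p *v w) (\<phi> k) r"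
        unfolding elim(3) by (simp only: sym_op_def tr_conj_mult)
      then show ?case unfolding elim(1,2) \<sigma>_eq[OF ps] by (simp only: ac_simps)
    qed
  qed
  have "(\<lambda>p. \<zeta> (fst p) (snd p)) \<in> borel_measurable (borel \<Otimes>\<^sub>M borel)"
  proof -
    have rep: "(\<lambda>p. cell_rep BL (snd p)) \<in> borel_measurable (borel \<Otimes>\<^sub>M borel)"
      by (rule measurable_compose[OF measurable_snd cell_rep_measurable[OF BL]])
    have 1: "(\<lambda>p. \<zeta>0 (fst p) (cell_rep BL (snd p))) \<in> borel_measurable (borel \<Otimes>\<^sub>M borel)"
      using measurable_compose[OF measurable_Pair[OF measurable_fst rep] joint] by simp
    have 2: "(\<lambda>p. plane_wave (fst p) (snd p - cell_rep BL (snd p))) \<in> borel_measurable (borel \<Otimes>\<^sub>M borel)"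
    proof -
      have "(\<lambda>p. fst p \<bullet> (snd p - cell_rep BL (snd p))) \<in> borel_measurable (borel \<Otimes>\<^sub>M borel)"
        using rep by (intro borel_measurable_inner borel_measurable_diff measurable_fst measurable_snd)
      moreover have "(\<lambda>x::real. exp (\<i> * of_real x)) \<in> borel_measurable borel"
        by (intro borel_measurable_continuous_onI continuous_intros)
      ultimately show ?thesis unfolding plane_wave_def by (rule measurable_compose)
    qed
    show ?thesis unfolding \<zeta>_def by (rule borel_measurable_times[OF 2 1])
  qed
  then have "(\<lambda>(k, r). \<zeta> k r) \<in> borel_measurable (borel \<Otimes>\<^sub>M borel)" by (simp add: case_prod_unfold)
  moreover have "\<exists>a. cmod a = 1 \<and> (AE r in lborel. \<zeta> k r = a * \<phi> k r)" for k using \<zeta>_ae cmod_\<sigma> by blast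
  ultimately show ?thesis using \<zeta>_bloch an per sym by (intro exI[of _ \<zeta>]) auto
qed

end

section \<open>Symmetry of the Wannier functions\<close>

context magnetic_lattice
begin

lemma sg_op_eq_sym_op:
  assumes "((p, s), R) \<in> P \<times> BL"
  shows "sg_op (magnetic_space_group BL P) ((p, s), R) f = sym_op p s R f"
  by (rule ext) (simp only: sg_op_def sym_op_def inv_magnetic_space_group[OF BL P assms] fst_conv snd_conv)

text \<open>The translation \<open>R\<close> makes the operation fix the site \<open>w + R0\<close>.
  It then permutes the Bloch functions in the Wannier integral up to the constant \<open>a\<close>,
  and the change of wavevector is absorbed by invariance of the integral over the Brillouin
  torus.\<close>

lemma wannier_symmetric:
  assumes bloch: "\<And>k. \<zeta> k \<in> bloch_functions BL k"
    and per: "\<And>k K. K \<in> RL \<Longrightarrow> AE r in lborel. \<zeta> (k + K) r = \<zeta> k r"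
    and joint: "(\<lambda>(k, r). \<zeta> k r) \<in> borel_measurable (borel \<Otimes>\<^sub>M borel)"
    and sym: "\<And>k. AE r in lborel. sym_op p s (w - p *v w) (\<zeta> k) r = a * \<zeta> (of_int s *\<^sub>R (p *v k)) r"
    and ps: "(p, s) \<in> P" and R0: "R0 \<in> BL" and R: "R = (w + R0) - p *v (w + R0)"
  shows "AE r in lborel. sym_op p s R (wannier BL \<zeta> R0) r = a * wannier BL \<zeta> R0 r"
proof -
  note p = PD(1)[OF ps] and s = PD(2)[OF ps]
  let ?g = "\<lambda>k. of_int s *\<^sub>R (p *v k)" and ?T = "\<lambda>r. transpose p *v (r - R)"
  define Y where "Y k r = plane_wave (- k) R0 * \<zeta> k r" for k r
  have Y_joint: "(\<lambda>x. Y (f x) (g x)) \<in> borel_measurable M"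
    if "f \<in> borel_measurable M" "g \<in> borel_measurable M" for f g :: "'c \<Rightarrow> real^'n" and M
  proof -
    have 1: "(\<lambda>x. \<zeta> (f x) (g x)) \<in> borel_measurable M"
      using measurable_compose[OF measurable_Pair[OF that] joint] by simp
    have "(\<lambda>k::real^'n. plane_wave (- k) R0) \<in> borel_measurable borel"
      unfolding plane_wave_def by (intro borel_measurable_continuous_onI continuous_intros)
    from borel_measurable_times[OF measurable_compose[OF that(1) this] 1] show ?thesis unfolding Y_def .
  qed
  have gm: "?g \<in> borel_measurable borel"
    using lborel_distr_orthogonal_affine(2)[OF orthogonal_transformation_point_op[OF ps], of 0] by simp
  have Tm: "?T \<in> borel_measurable borel" by (rule distr_transpose_affine(2)[OF p])
  \<comment> \<open>The identities hold for every \<open>k\<close> outside a null set of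
    \<open>r\<close> depending on \<open>k\<close>. Joint measurability and Fubini give, for almost
    every \<open>r\<close>, validity for almost all \<open>k\<close>, as the integral over
    \<open>k\<close> at fixed \<open>r\<close> demands.\<close>
  have commute: "AE r in lborel. AE k in lborel. F1 k r = F2 k r"
    if F: "\<And>k. AE r in lborel. F1 k r = F2 k r"
      and m: "(\<lambda>x. F1 (fst x) (snd x)) \<in> borel_measurable (borel \<Otimes>\<^sub>M borel)"
        "(\<lambda>x. F2 (fst x) (snd x)) \<in> borel_measurable (borel \<Otimes>\<^sub>M borel)"
    for F1 F2 :: "real^'n \<Rightarrow> real^'n \<Rightarrow> complex"
  proof -
    have pm: "sets ((lborel :: (real^'n) measure) \<Otimes>\<^sub>M (lborel :: (real^'n) measure)) = sets (borel \<Otimes>\<^sub>M borel)"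
      by (rule sets_pair_measure_cong) simp_all
    have "(\<lambda>x. F1 (fst x) (snd x) - F2 (fst x) (snd x)) -` {0} \<inter> space (borel \<Otimes>\<^sub>M borel) \<in> sets (borel \<Otimes>\<^sub>M borel)"
      by (rule measurable_sets[OF borel_measurable_diff[OF m]]) simp
    moreover have "(\<lambda>x. F1 (fst x) (snd x) - F2 (fst x) (snd x)) -` {0} \<inter> space (borel \<Otimes>\<^sub>M borel) =
        {x \<in> space (borel \<Otimes>\<^sub>M borel). F1 (fst x) (snd x) = F2 (fst x) (snd x)}" by auto
    ultimately have "{x \<in> space (borel \<Otimes>\<^sub>M borel). F1 (fst x) (snd x) = F2 (fst x) (snd x)} \<in> sets (borel \<Otimes>\<^sub>M borel)"
      by simp
    then have "{x \<in> space (lborel \<Otimes>\<^sub>M lborel). F1 (fst x) (snd x) = F2 (fst x) (snd x)} \<in> sets (lborel \<Otimes>\<^sub>M lborel)"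
      unfolding pm by (simp add: space_pair_measure)
    from lborel_pair.AE_commute[OF this] show ?thesis using F by simp
  qed
  have Ysym: "AE r in lborel. tr_conj s (Y k (?T r)) = a * Y (?g k) r" for k
  proof -
    let ?v = "w - p *v w"
    \<comment> \<open>The operation about the site \<open>w + R0\<close> is the operation about
      \<open>w\<close> conjugated by the translation by \<open>R0\<close>; the two translations
      contribute plane waves that the factor in \<open>Y\<close> absorbs.\<close>
    have T_eq: "?T r = transpose p *v ((r + - R0) - ?v) + R0" for r
    proof -
      have "r - R = ((r + - R0) - ?v) + p *v R0"
        by (simp add: R matrix_vector_right_distrib)
      then show ?thesis by (simp only: matrix_vector_right_distrib orthogonal_matrix_vector_cancel[OF p])
    qed
    have "AE r in lborel. \<zeta> k (r + R0) = plane_wave k R0 * \<zeta> k r"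
      using bloch[of k] R0 by (simp add: bloch_functions_def)
    from AE_translate[OF BL AE_transpose_affine[OF p this, of ?v], of "- R0"]
    have 1: "AE r in lborel. \<zeta> k (?T r) = plane_wave k R0 * \<zeta> k (transpose p *v ((r + - R0) - ?v))"
      unfolding T_eq .
    have 2: "AE r in lborel. sym_op p s ?v (\<zeta> k) (r + - R0) = a * \<zeta> (?g k) (r + - R0)"
      by (rule AE_translate[OF BL sym])
    have "- R0 \<in> BL" by (rule lattice_uminus[OF BL R0])
    then have 3: "AE r in lborel. \<zeta> (?g k) (r + - R0) = plane_wave (?g k) (- R0) * \<zeta> (?g k) r"
      using bloch[of "?g k"] unfolding bloch_functions_def by blast
    from 1 2 3 show ?thesis
    proof eventually_elim
      case (elim r)
      have "Y k (?T r) = (plane_wave (- k) R0 * plane_wave k R0) * \<zeta> k (transpose p *v ((r + - R0) - ?v))"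
        unfolding Y_def elim(1) by (simp only: mult.assoc)
      then have "Y k (?T r) = \<zeta> k (transpose p *v ((r + - R0) - ?v))" by simp
      then have "tr_conj s (Y k (?T r)) = a * (plane_wave (?g k) (- R0) * \<zeta> (?g k) r)"
        using elim(2) unfolding sym_op_def elim(3) by simp
      then show ?case unfolding Y_def plane_wave_uminus_right .
    qed
  qed
  have "AE r in lborel. AE k in lborel. tr_conj s (Y k (?T r)) = a * Y (?g k) r"
  proof (rule commute[OF Ysym])
    show "(\<lambda>x. tr_conj s (Y (fst x) (?T (snd x)))) \<in> borel_measurable (borel \<Otimes>\<^sub>M borel)"
      by (intro tr_conj_measurable Y_joint measurable_fst measurable_compose[OF measurable_snd Tm])
    show "(\<lambda>x. a * Y (?g (fst x)) (snd x)) \<in> borel_measurable (borel \<Otimes>\<^sub>M borel)"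
      by (intro borel_measurable_times borel_measurable_const Y_joint measurable_snd measurable_compose[OF measurable_fst gm])
  qed
  \<comment> \<open>One null set of \<open>r\<close> for all of \<open>RL\<close> at once, so that
    \<open>cell_integral_transform\<close> applies to the integrand as a function of
    \<open>k\<close>.\<close>
  moreover have "AE r in lborel. \<forall>K\<in>RL. AE k in lborel. Y (k + K) r = Y k r"
  proof (rule AE_lattice_shifts[OF RL])
    fix K assume K: "K \<in> RL"
    show "AE r in lborel. AE k in lborel. Y (k + K) r = Y k r"
    proof (rule commute)
      show "AE r in lborel. Y (k + K) r = Y k r" for k
        using per[OF K, of k]
      proof eventually_elim
        case (elim r)
        have "plane_wave (- (k + K)) R0 = plane_wave (- k) R0 * plane_wave (- K) R0"
          by (simp add: plane_wave_add_left[symmetric])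
        also have "plane_wave (- K) R0 = 1"
          by (rule plane_wave_reciprocal[OF lattice_uminus[OF RL K] R0])
        finally show ?case using elim by (simp add: Y_def)
      qed
      have "(\<lambda>x. fst x + K) \<in> borel_measurable (borel \<Otimes>\<^sub>M (borel :: (real^'n) measure))"
        by (intro borel_measurable_add measurable_fst borel_measurable_const)
      then show "(\<lambda>x. Y (fst x + K) (snd x)) \<in> borel_measurable (borel \<Otimes>\<^sub>M borel)"
        by (rule Y_joint[OF _ measurable_snd])
      show "(\<lambda>x. Y (fst x) (snd x)) \<in> borel_measurable (borel \<Otimes>\<^sub>M borel)"
        by (rule Y_joint[OF measurable_fst measurable_snd])
    qed
  qed
  ultimately show ?thesis
  proof eventually_elim
    case (elim r)
    let ?C = "unit_cell RL" and ?V = "of_real (measure lborel (unit_cell RL) powr (-1/2)) :: complex"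
    have Yr: "(\<lambda>k. Y k r) \<in> borel_measurable borel" for r
      by (rule Y_joint) simp_all
    have wan: "wannier BL \<zeta> R0 r = ?V * (LINT k:?C|lborel. Y k r)" for r
      by (simp add: wannier_def Y_def Let_def)
    have "sym_op p s R (wannier BL \<zeta> R0) r = ?V * tr_conj s (LINT k:?C|lborel. Y k (?T r))"
      unfolding sym_op_def wan tr_conj_mult tr_conj_of_real ..
    also have "tr_conj s (LINT k:?C|lborel. Y k (?T r)) = (LINT k:?C|lborel. tr_conj s (Y k (?T r)))"
    proof -
      have "tr_conj s (indicat_real ?C k *\<^sub>R z) = indicat_real ?C k *\<^sub>R tr_conj s z" for k z
        by (simp add: tr_conj_def)
      then show ?thesis unfolding set_lebesgue_integral_def integral_tr_conj[symmetric] by simp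
    qed
    also have "\<dots> = (LINT k:?C|lborel. a * Y (?g k) r)"
    proof (rule set_lebesgue_integral_cong_AE)
      show "?C \<in> sets lborel" using unit_cell_borel[OF RL] by simp
      show "(\<lambda>k. tr_conj s (Y k (?T r))) \<in> borel_measurable lborel"
        using tr_conj_measurable[OF Yr] by simp
      show "(\<lambda>k. a * Y (?g k) r) \<in> borel_measurable lborel"
        using measurable_compose[OF gm Yr] by simp
      show "AE k\<in>?C in lborel. tr_conj s (Y k (?T r)) = a * Y (?g k) r"
        using elim(1) by eventually_elim simp
    qed
    also have "\<dots> = a * (LINT k:?C|lborel. Y (?g k + 0) r)" by simp
    also have "(LINT k:?C|lborel. Y (?g k + 0) r) = (LINT k:?C|lborel. Y k r)"
      by (rule cell_integral_transform[OF RL orthogonal_transformation_point_op[OF ps] point_op_RL[OF ps] Yr])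
        (use elim(2) in blast)
    finally show ?case unfolding wan by (simp only: mult.left_commute)
  qed
qed

end

section \<open>Choices of Bloch functions\<close>

locale analytic_band = magnetic_lattice BL P
  for BL :: "(real^'n) set" and P +
  fixes \<psi> :: "real^'n \<Rightarrow> real^'n \<Rightarrow> complex"
  assumes simple: "simple_band BL (magnetic_space_group BL P) \<psi>"
    and analytic: "analytic_projection BL \<psi>"
begin

abbreviation envelope :: "(real^'n \<Rightarrow> real^'n \<Rightarrow> complex) \<Rightarrow> real^'n \<Rightarrow> (real^'n) l2" where
  "envelope \<phi> k \<equiv> cell_emb (\<lambda>r. plane_wave (- k) r * \<phi> k r)"

lemma \<psi>_bloch: "\<psi> k \<in> bloch_functions BL k"
  using simple unfolding simple_band_def by blast

lemma norm_\<psi>: "norm (cell_emb (\<psi> k)) = 1"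
proof -
  have "cell_norm BL (\<psi> k) = 1" using simple unfolding simple_band_def by blast
  then show ?thesis by (simp add: cell_norm_eq[OF BL bloch_square_integrable_on[OF BL \<psi>_bloch]])
qed

lemma simple_band_sym_op:
  assumes ps: "(p, s) \<in> P"
  shows "\<exists>\<rho>. cmod \<rho> = 1 \<and> (AE r in lborel. sym_op p s 0 (\<psi> k) r = \<rho> * \<psi> (of_int s *\<^sub>R (p *v k)) r)"
proof -
  let ?G = "magnetic_space_group BL P"
  have g: "((p, s), 0) \<in> P \<times> BL" using ps lattice_zero[OF BL] by simp
  then have "((p, s), 0) \<in> carrier ?G" by (simp add: magnetic_space_group_def)
  moreover have "\<forall>g\<in>carrier ?G. \<forall>k. \<exists>\<rho>. cmod \<rho> = 1 \<and>
      (AE r in lborel. sg_op ?G g (\<psi> k) r = \<rho> * \<psi> (sg_act_k g k) r)"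
    using simple unfolding simple_band_def by blast
  ultimately show ?thesis unfolding sg_op_eq_sym_op[OF g, symmetric] by fastforce
qed

lemma band_choice_bloch: "band_choice BL \<psi> \<phi> \<Longrightarrow> \<phi> k \<in> bloch_functions BL k"
  unfolding band_choice_def by blast

lemma band_choice_phase:
  assumes "band_choice BL \<psi> \<phi>"
  obtains a where "cmod a = 1" "AE r in lborel. \<phi> k r = a * \<psi> k r"
  using assms unfolding band_choice_def by blast

lemma envelope_torus: "band_choice BL \<psi> \<phi> \<Longrightarrow> (\<lambda>r. plane_wave (- k) r * \<phi> k r) \<in> L2_torus BL"
  by (rule bloch_functions_L2_torus[OF band_choice_bloch])

lemma continuous_choice_iff:
  "band_choice BL \<psi> \<phi> \<Longrightarrow> continuous_choice BL \<phi> \<longleftrightarrow> (\<forall>k. isCont (envelope \<phi>) k)"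
  unfolding continuous_choice_def by (rule L2_continuous_iff[OF BL envelope_torus])

lemma analytic_choice_iff:
  "band_choice BL \<psi> \<phi> \<Longrightarrow> analytic_choice BL \<phi> \<longleftrightarrow> (\<forall>k. real_analytic_at (envelope \<phi>) k)"
  unfolding analytic_choice_def by (rule L2_analytic_iff[OF BL envelope_torus])

lemma norm_band_choice:
  assumes "band_choice BL \<psi> \<phi>"
  shows "norm (cell_emb (\<phi> k)) = 1"
proof -
  obtain a where a: "cmod a = 1" "AE r in lborel. \<phi> k r = a * \<psi> k r" by (rule band_choice_phase[OF assms])
  have "cell_emb (\<phi> k) = cell_emb (\<lambda>r. a * \<psi> k r)"
    using bloch_emb_eq_iff[OF BL band_choice_bloch[OF assms] bloch_functions_cmult[OF \<psi>_bloch]] a(2) by blast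
  then show ?thesis
    by (simp add: to_l2_cmult[OF unit_cell_borel[OF BL] bloch_square_integrable_on[OF BL \<psi>_bloch]] norm_cscale a(1) norm_\<psi>)
qed

lemma band_choice_symmetric:
  assumes \<phi>: "band_choice BL \<psi> \<phi>" and ps: "(p, s) \<in> P"
  shows "\<exists>\<rho>. cmod \<rho> = 1 \<and> (AE r in lborel. sym_op p s 0 (\<phi> k) r = \<rho> * \<phi> (of_int s *\<^sub>R (p *v k)) r)"
proof -
  let ?k = "of_int s *\<^sub>R (p *v k)"
  obtain a where a: "cmod a = 1" "AE r in lborel. \<phi> k r = a * \<psi> k r" by (rule band_choice_phase[OF \<phi>])
  obtain b where b: "cmod b = 1" "AE r in lborel. \<phi> ?k r = b * \<psi> ?k r" by (rule band_choice_phase[OF \<phi>])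
  obtain \<rho> where \<rho>: "cmod \<rho> = 1" "AE r in lborel. sym_op p s 0 (\<psi> k) r = \<rho> * \<psi> ?k r"
    using simple_band_sym_op[OF ps] by blast
  have "AE r in lborel. sym_op p s 0 (\<phi> k) r = sym_op p s 0 (\<lambda>r. a * \<psi> k r) r"
    by (rule sym_op_AE_cong[OF PD(1)[OF ps] a(2)])
  with \<rho>(2) b(2) have "AE r in lborel. sym_op p s 0 (\<phi> k) r = (tr_conj s a * \<rho> / b) * \<phi> ?k r"
  proof eventually_elim
    case (elim r)
    have "b \<noteq> 0" using b(1) by auto
    moreover have "sym_op p s 0 (\<phi> k) r = tr_conj s a * sym_op p s 0 (\<psi> k) r"
      unfolding elim(3) by (simp only: sym_op_def tr_conj_mult)
    ultimately show ?case unfolding elim(1,2) by simp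
  qed
  moreover have "cmod (tr_conj s a * \<rho> / b) = 1" by (simp add: norm_mult norm_divide a b \<rho>)
  ultimately show ?thesis by blast
qed

text \<open>The hypothesis speaks about \<open>\<psi>\<close>. A unimodular change of the spanning
  function cancels between bra and ket, so the projection, and its analyticity on a fixed vector,
  pass to every choice.\<close>

lemma band_choice_projection_analytic:
  assumes \<phi>: "band_choice BL \<psi> \<phi>" and v: "v \<in> L2_torus BL"
  shows "real_analytic_at (\<lambda>k. cscale (cinner (envelope \<phi> k) (cell_emb v)) (envelope \<phi> k)) k0"
proof -
  let ?Q = "\<lambda>k u r. plane_wave (- k) r * rank_one_projection BL (\<psi> k) (\<lambda>x. plane_wave k x * u x) r"
  note B = unit_cell_borel[OF BL]
  have t: "(\<lambda>r. plane_wave (- k) r * \<psi> k r) \<in> L2_torus BL" for k by (rule bloch_functions_L2_torus[OF \<psi>_bloch])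
  note tsq = L2_torus_square_integrable_on[OF BL t] and vsq = L2_torus_square_integrable_on[OF BL v]
  have inner: "cell_inner BL (\<psi> k) (\<lambda>x. plane_wave k x * v x) = cinner (envelope \<psi> k) (cell_emb v)" for k
  proof -
    have "cell_inner BL (\<psi> k) (\<lambda>x. plane_wave k x * v x) = cell_inner BL (\<lambda>r. plane_wave (- k) r * \<psi> k r) v"
      unfolding cell_inner_def by (simp add: cnj_plane_wave mult.assoc mult.left_commute)
    also have "\<dots> = cinner (envelope \<psi> k) (cell_emb v)" by (rule cell_inner_eq[OF BL tsq vsq])
    finally show ?thesis .
  qed
  have Q: "?Q k v = (\<lambda>r. cinner (envelope \<psi> k) (cell_emb v) * (plane_wave (- k) r * \<psi> k r))" for k
    unfolding rank_one_projection_def inner by (rule ext) (simp only: mult.left_commute)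
  have "real_analytic_at (\<lambda>k. cell_emb (?Q k v)) k0"
  proof (rule operator_analytic_apply[OF BL _ v])
    show "operator_analytic BL ?Q" using analytic unfolding analytic_projection_def .
    show "?Q k v \<in> L2_torus BL" for k
      unfolding Q using bloch_functions_cmult[of _ BL 0] t unfolding bloch_functions_0 by blast
  qed
  moreover have "cell_emb (?Q k v) = cscale (cinner (envelope \<phi> k) (cell_emb v)) (envelope \<phi> k)" for k
  proof -
    obtain a where a: "cmod a = 1" "AE r in lborel. \<phi> k r = a * \<psi> k r" by (rule band_choice_phase[OF \<phi>])
    have "envelope \<phi> k = cell_emb (\<lambda>r. a * (plane_wave (- k) r * \<psi> k r))"
    proof (rule to_l2_eqI[OF B L2_torus_square_integrable_on[OF BL envelope_torus[OF \<phi>]] square_integrable_on_cmult[OF B tsq]])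
      show "AE r in lborel. r \<in> unit_cell BL \<longrightarrow> plane_wave (- k) r * \<phi> k r = a * (plane_wave (- k) r * \<psi> k r)"
        using a(2) by eventually_elim simp
    qed
    also have "\<dots> = cscale a (envelope \<psi> k)" by (rule to_l2_cmult[OF B tsq])
    finally have env: "envelope \<phi> k = cscale a (envelope \<psi> k)" .
    have "a * cnj a = 1" using a(1) complex_norm_square[of a] by simp
    then have "cnj a * z * a = z" for z by (metis mult.assoc mult.commute mult_1)
    then have "cscale (cinner (envelope \<phi> k) (cell_emb v)) (envelope \<phi> k) =
        cscale (cinner (envelope \<psi> k) (cell_emb v)) (envelope \<psi> k)"
      unfolding env cinner_cscale_left cscale_cscale by (simp only:)
    then show ?thesis unfolding Q to_l2_cmult[OF B tsq] by simp
  qed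
  ultimately show ?thesis by (simp only:)
qed

lemma band_representation_imp_trivial:
  assumes "band_representation BL (magnetic_space_group BL P) \<psi>"
  shows "topologically_trivial BL \<psi>"
proof -
  obtain \<phi> where \<phi>: "band_choice BL \<psi> \<phi>" "analytic_choice BL \<phi>" "periodic_choice BL \<phi>"
    using assms unfolding band_representation_def by blast
  have "continuous_choice BL \<phi>"
    using \<phi>(2) real_analytic_at_isCont unfolding continuous_choice_iff[OF \<phi>(1)] analytic_choice_iff[OF \<phi>(1)] by blast
  with \<phi> show ?thesis unfolding topologically_trivial_def by blast
qed

text \<open>The given choice is multiplied by the continuous periodic phase from
  \<open>symmetric_gauge\<close>. The constant for each group element is fixed before
  \<open>k\<close>, which is why \<open>c\<close> can be chosen as a function on \<open>P\<close>
  alone.\<close>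

lemma trivial_imp_symmetric_band:
  assumes "topologically_trivial BL \<psi>"
  obtains \<phi> w c where "band_choice BL \<psi> \<phi>" "symmetric_band BL P \<phi> w c"
proof -
  obtain \<phi>0 where \<phi>0: "band_choice BL \<psi> \<phi>0" "continuous_choice BL \<phi>0" "periodic_choice BL \<phi>0"
    using assms unfolding topologically_trivial_def by blast
  have per0: "AE r in lborel. \<phi>0 (k + K) r = \<phi>0 k r" if "K \<in> RL" for k K
    using \<phi>0(3) that unfolding periodic_choice_def by blast
  have cont0: "isCont (envelope \<phi>0) k" for k using \<phi>0(2) unfolding continuous_choice_iff[OF \<phi>0(1)] by blast
  have "band_gauge BL P \<phi>0"
    by (unfold_locales) (fact band_choice_bloch[OF \<phi>0(1)] norm_band_choice[OF \<phi>0(1)] per0 cont0 band_choice_symmetric[OF \<phi>0(1)])+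
  from band_gauge.symmetric_gauge[OF this] obtain \<mu> w where cont: "continuous_on UNIV \<mu>"
    and per: "\<And>k K. K \<in> RL \<Longrightarrow> \<mu> (k + K) = \<mu> k"
    and sym: "\<forall>(p, s)\<in>P. p *v w - w \<in> BL \<and> (\<exists>c. cmod c = 1 \<and> (\<forall>k. AE r in lborel.
        sym_op p s (w - p *v w) (\<lambda>r. exp (\<i> * of_real (\<mu> k)) * \<phi>0 k r) r =
        c * (exp (\<i> * of_real (\<mu> (of_int s *\<^sub>R (p *v k)))) * \<phi>0 (of_int s *\<^sub>R (p *v k)) r)))"
    by blast
  define \<phi> where "\<phi> k r = exp (\<i> * of_real (\<mu> k)) * \<phi>0 k r" for k r
  have sym': "\<forall>x\<in>P. \<exists>a. cmod a = 1 \<and> (\<forall>k. AE r in lborel.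
      sym_op (fst x) (snd x) (w - fst x *v w) (\<phi> k) r = a * \<phi> (of_int (snd x) *\<^sub>R (fst x *v k)) r)"
    using sym unfolding \<phi>_def[abs_def] by auto
  obtain c where c: "\<forall>x\<in>P. cmod (c x) = 1 \<and> (\<forall>k. AE r in lborel.
      sym_op (fst x) (snd x) (w - fst x *v w) (\<phi> k) r = c x * \<phi> (of_int (snd x) *\<^sub>R (fst x *v k)) r)"
    using bchoice[OF sym'] by (elim exE)
  have \<phi>: "band_choice BL \<psi> \<phi>"
    unfolding band_choice_def
  proof (intro allI conjI)
    fix k
    show "\<phi> k \<in> bloch_functions BL k"
      unfolding \<phi>_def[abs_def] by (rule bloch_functions_cmult[OF band_choice_bloch[OF \<phi>0(1)]])
    obtain a where a: "cmod a = 1" "AE r in lborel. \<phi>0 k r = a * \<psi> k r" by (rule band_choice_phase[OF \<phi>0(1)])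
    have "AE r in lborel. \<phi> k r = (exp (\<i> * of_real (\<mu> k)) * a) * \<psi> k r"
      using a(2) by eventually_elim (simp add: \<phi>_def)
    moreover have "cmod (exp (\<i> * of_real (\<mu> k)) * a) = 1" by (simp add: norm_mult a(1))
    ultimately show "\<exists>c. cmod c = 1 \<and> (AE r in lborel. \<phi> k r = c * \<psi> k r)" by blast
  qed
  have env: "envelope \<phi> = (\<lambda>k. cscale (exp (\<i> * of_real (\<mu> k))) (envelope \<phi>0 k))"
  proof
    fix k
    show "envelope \<phi> k = cscale (exp (\<i> * of_real (\<mu> k))) (envelope \<phi>0 k)"
      unfolding \<phi>_def mult.left_commute[of "plane_wave (- k) _"]
      by (rule to_l2_cmult[OF unit_cell_borel[OF BL] L2_torus_square_integrable_on[OF BL envelope_torus[OF \<phi>0(1)]]])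
  qed
  have "symmetric_band BL P \<phi> w c"
  proof unfold_locales
    fix k K assume K: "K \<in> RL"
    show "AE r in lborel. \<phi> (k + K) r = \<phi> k r"
      using per0[OF K, of k] by eventually_elim (simp add: \<phi>_def per[OF K])
  next
    fix k
    have "isCont \<mu> k" using cont by (simp add: continuous_on_eq_continuous_at)
    then have "isCont (\<lambda>k. exp (\<i> * of_real (\<mu> k))) k" by (intro continuous_intros)
    then show "isCont (envelope \<phi>) k" unfolding env by (rule cscale.isCont[OF _ cont0])
  next
    fix p s assume ps: "(p, s) \<in> P"
    show "p *v w - w \<in> BL" using sym ps by blast
    show "cmod (c (p, s)) = 1" using c ps by blast
    show "AE r in lborel. sym_op p s (w - p *v w) (\<phi> k) r = c (p, s) * \<phi> (of_int s *\<^sub>R (p *v k)) r" for k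
      using bspec[OF c ps] by simp
  qed (fact band_choice_bloch[OF \<phi>] norm_band_choice[OF \<phi>] band_choice_projection_analytic[OF \<phi>])+
  with \<phi> show ?thesis by (rule that)
qed

lemma trivial_imp_band_representation:
  assumes "topologically_trivial BL \<psi>"
  shows "band_representation BL (magnetic_space_group BL P) \<psi>"
proof -
  let ?G = "magnetic_space_group BL P"
  obtain \<phi> w c where \<phi>: "band_choice BL \<psi> \<phi>" and "symmetric_band BL P \<phi> w c"
    by (rule trivial_imp_symmetric_band[OF assms])
  then interpret S: symmetric_band BL P \<phi> w c by simp
  obtain \<zeta> where bloch: "\<And>k. \<zeta> k \<in> bloch_functions BL k"
    and phase: "\<And>k. \<exists>a. cmod a = 1 \<and> (AE r in lborel. \<zeta> k r = a * \<phi> k r)"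
    and an: "\<And>k0. real_analytic_at (envelope \<zeta>) k0"
    and per: "\<And>k K. K \<in> RL \<Longrightarrow> AE r in lborel. \<zeta> (k + K) r = \<zeta> k r"
    and joint: "(\<lambda>(k, r). \<zeta> k r) \<in> borel_measurable (borel \<Otimes>\<^sub>M borel)"
    and sym: "\<And>p s k. (p, s) \<in> P \<Longrightarrow>
      AE r in lborel. sym_op p s (w - p *v w) (\<zeta> k) r = c (p, s) * \<zeta> (of_int s *\<^sub>R (p *v k)) r"
    using S.analytic_symmetric_section by blast
  have \<zeta>: "band_choice BL \<psi> \<zeta>"
    unfolding band_choice_def
  proof (intro allI conjI bloch)
    fix k
    obtain a where a: "cmod a = 1" "AE r in lborel. \<phi> k r = a * \<psi> k r" by (rule band_choice_phase[OF \<phi>])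
    obtain b where b: "cmod b = 1" "AE r in lborel. \<zeta> k r = b * \<phi> k r" using phase by blast
    from a(2) b(2) have "AE r in lborel. \<zeta> k r = (b * a) * \<psi> k r" by eventually_elim simp
    moreover have "cmod (b * a) = 1" by (simp add: norm_mult a(1) b(1))
    ultimately show "\<exists>c. cmod c = 1 \<and> (AE r in lborel. \<zeta> k r = c * \<psi> k r)" by blast
  qed
  have "analytic_choice BL \<zeta>" unfolding analytic_choice_iff[OF \<zeta>] using an by blast
  moreover have "periodic_choice BL \<zeta>" unfolding periodic_choice_def using per by blast
  moreover have "sets ((lborel :: (real^'n) measure) \<Otimes>\<^sub>M (lborel :: (real^'n) measure)) = sets (borel \<Otimes>\<^sub>M borel)"
    by (rule sets_pair_measure_cong) simp_all
  then have "(\<lambda>(k, r). \<zeta> k r) \<in> borel_measurable (lborel \<Otimes>\<^sub>M lborel)"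
    using joint measurable_cong_sets[OF _ refl] by blast
  moreover have "unit_multiplicity BL ?G w"
    unfolding unit_multiplicity_def
  proof
    fix g assume "g \<in> carrier ?G"
    then obtain p s R where g: "g = ((p, s), R)" and ps: "(p, s) \<in> P" and R: "R \<in> BL"
      by (auto simp: magnetic_space_group_def)
    have "(p *v w - w) + R \<in> BL" by (rule lattice_add[OF BL S.unit[OF ps] R])
    then show "sg_act g w - w \<in> BL" by (simp add: g algebra_simps)
  qed
  moreover have "\<exists>c. cmod c = 1 \<and> (AE r in lborel. sg_op ?G g (wannier BL \<zeta> R0) r = c * wannier BL \<zeta> R0 r)"
    if R0: "R0 \<in> BL" and g: "g \<in> site_stabilizer ?G (w + R0)" for g R0
  proof -
    obtain p s R where g_eq: "g = ((p, s), R)" and m: "((p, s), R) \<in> P \<times> BL" and fixed: "p *v (w + R0) + R = w + R0"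
      using g by (auto simp: site_stabilizer_def magnetic_space_group_def)
    have ps: "(p, s) \<in> P" using m by simp
    \<comment> \<open>Membership in the stabilizer of the site determines the translation part, in
      the form that \<open>wannier_symmetric\<close> expects.\<close>
    have "R = (w + R0) - p *v (w + R0)" using fixed by (simp add: algebra_simps)
    from wannier_symmetric[OF bloch per joint sym[OF ps] ps R0 this]
    show ?thesis unfolding g_eq sg_op_eq_sym_op[OF m] using S.cmod_c[OF ps] by blast
  qed
  ultimately show ?thesis unfolding band_representation_def using \<zeta> by blast
qed

end

theorem theorem1:
  fixes BL :: "(real^'n) set"
    and P :: "'n point_op set"
    and G :: "'n space_op monoid"
    and \<psi> :: "real^'n \<Rightarrow> real^'n \<Rightarrow> complex"
  assumes "full_rank_lattice BL"
    and "point_group BL P"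
    and "G = magnetic_space_group BL P"
    and "simple_band BL G \<psi>"
    and "analytic_projection BL \<psi>"
  shows "band_representation BL G \<psi> \<longleftrightarrow> topologically_trivial BL \<psi>"
proof -
  interpret analytic_band BL P \<psi>
    using assms by unfold_locales simp_all
  show ?thesis
    unfolding assms(3) using band_representation_imp_trivial trivial_imp_band_representation by blast
qed

end
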